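(* Let $\mathfrak{g}=\mathfrak{so}(2n,\mathbb{C})$ and let $\mathfrak{p}$ be a standard parabolic subalgebra of type $(n_1,n_2,\dots,n_k)$. (1) Suppose $n_k\neq1$. Let $p=(p_1,\dots,p_N)$ be the shape (row lengths) of the Z-diagram of type $(n_k;n_1,\dots,n_{k-1})$, so that its sequence of column lengths is $$p^t=(m_1,m_1,m_2,m_2,\dots,m_{s-1},m_{s-1},2m_s,m_{s+1},m_{s+1},\dots,m_k,m_k),$$ where $m_s=n_k$ and $(m_1,\dots,m_k)$ is the arrangement of $(n_1,\dots,n_k)$ for which this sequence is in descending order. Then the Richardson orbit $\mathcal{O}$ associated to $\mathfrak{p}$ has partition $$\mathbf{p}=[p_1,p_2,\dots,p_N]_{D}.$$ (2) Suppose $n_k=1$. Let $\bar p=(p'_1,\dots,p'_N)$ be the shape of the Z-diagram of type $(0;n_1,\dots,n_{k-2},n_{k-1}+1)$, so that $$\bar p^{\,t}=(m_1,m_1,m_2,m_2,\dots,m_{k-1},m_{k-1}),$$ where $(m_1,\dots,m_{k-1})$ is the arrangement of $(n_1,\dots,n_{k-2},n_{k-1}+1)$ in descending order. Then the Richardson orbit $\mathcal{O}$ associated to $\mathfrak{p}$ has partition $$\bar{\mathbf{p}}=[p'_1,p'_2,\dots,p'_N]_{D}.$$ Here $[\,\cdot\,]_D$ denotes the $D$-collapse.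
   Context: Lie algebra and parabolics. $\mathfrak{g}=\mathfrak{so}(2n,\mathbb{C})$ (type $D_n$) with simple roots $\Delta$: $\alpha_i=e_i-e_{i+1}$ ($1\le i\le n-1$), $\alpha_n=e_{n-1}+e_n$. For $I\subset\Delta$, $\mathfrak{p}=\mathfrak{p}_I=\mathfrak{l}\oplus\mathfrak{u}$ is the standard parabolic subalgebra whose Levi factor $\mathfrak{l}$ has root system generated by $I$, $\mathfrak{u}$ being its nilradical. It is of type $(n_1,\dots,n_k)$ if $n_1,\dots,n_{k-1}$ are positive integers, $n_k=n-\sum_{i<k}n_i\ge0$, and $\Delta\setminus I=\{\alpha_{p_1},\dots,\alpha_{p_{k-1}}\}$ with $p_t=n_1+\dots+n_t$ (these indices are unrelated to the row lengths $p_i$ in the claim). Richardson orbit: the unique nilpotent $G$-orbit in $\mathfrak{g}$ ($G$ a connected complex Lie group with Lie algebra $\mathfrak{g}$) meeting $\mathfrak{u}$ in an open dense subset of $\mathfrak{u}$. The partition of a nilpotent orbit in $\mathfrak{so}(2n,\mathbb{C})$ is its Jordan type; it is a partition of $2n$ of type $D_n$, i.e. one in which even parts occur with even multiplicity (each such partition corresponds to one orbit, except that partitions with only even parts correspond to two orbits). Z-diagram. For integers $a_0\ge0$, $b_1,\dots,b_{k-1}>0$, the Z-diagram of type $(a_0;b_1,\dots,b_{k-1})$ is the Young diagram whose multiset of column lengths is $\{2a_0,b_1,b_1,\dots,b_{k-1},b_{k-1}\}$. Collapse. A partition $\mathbf{d}$ dominates $\mathbf{f}$ (of the same integer) if $\sum_{j\le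 l}d_j\ge\sum_{j\le l}f_j$ for all $l$. For a partition $\mathbf{d}$ of $2n$, its $D$-collapse $\mathbf{d}_D$ is the unique largest partition of $2n$ of type $D_n$ dominated by $\mathbf{d}$. *)

theory Defs
  imports
    "HOL-Analysis.Analysis"
    "Jordan_Normal_Form.Jordan_Normal_Form"
    "Jordan_Normal_Form.VS_Connect"
begin

section \<open>The Lie algebra so(2n) and its standard parabolic subalgebras\<close>

text \<open>
  The split realisation: the symmetric form pairs the basis vectors number i and n + i, so that
  the diagonal matrices diag(h_1, ..., h_n, -h_1, ..., -h_n) form a Cartan subalgebra. Matrix
  entries are indexed from 0, whereas the coordinates e_1, ..., e_n and the simple roots
  are indexed from 1.
\<close>

definition so_form :: "nat \<Rightarrow> complex mat" where
  "so_form n = four_block_mat (0\<^sub>m n n) (1\<^sub>m n) (1\<^sub>m n) (0\<^sub>m n n)"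

definition so :: "nat \<Rightarrow> complex mat set" where
  "so n = {X \<in> carrier_mat (2*n) (2*n).
             transpose_mat X * so_form n + so_form n * X = 0\<^sub>m (2*n) (2*n)}"

definition SO :: "nat \<Rightarrow> complex mat set" where
  "SO n = {g \<in> carrier_mat (2*n) (2*n).
             transpose_mat g * so_form n * g = so_form n \<and> det g = 1}"

definition cartan :: "nat \<Rightarrow> complex mat set" where
  "cartan n = {H \<in> so n. diagonal_mat H}"

text \<open>A weight is given by its coefficient vector: the function \<open>\<beta>\<close> stands for the functional
  \<beta>(1) e_1 + ... + \<beta>(n) e_n on the Cartan subalgebra, where e_i maps
  diag(h_1, ..., h_n, -h_1, ..., -h_n) to h_i.\<close>

definition weight_value :: "nat \<Rightarrow> (nat \<Rightarrow> int) \<Rightarrow> complex mat \<Rightarrow> complex" where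
  "weight_value n \<beta> H = (\<Sum>i = 1..n. of_int (\<beta> i) * H $$ (i - 1, i - 1))"

definition root_space :: "nat \<Rightarrow> (nat \<Rightarrow> int) \<Rightarrow> complex mat set" where
  "root_space n \<beta> = {X \<in> so n. \<forall>H \<in> cartan n. H * X - X * H = weight_value n \<beta> H \<cdot>\<^sub>m X}"

definition roots :: "nat \<Rightarrow> (nat \<Rightarrow> int) set" where
  "roots n = {\<beta>. (\<forall>i. i \<notin> {1..n} \<longrightarrow> \<beta> i = 0) \<and> (\<exists>i. \<beta> i \<noteq> 0)
                 \<and> (\<exists>X \<in> root_space n \<beta>. X \<noteq> 0\<^sub>m (2*n) (2*n))}"

definition simple_root :: "nat \<Rightarrow> nat \<Rightarrow> (nat \<Rightarrow> int)" where
  "simple_root n i =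
     (if i < n then (\<lambda>k. if k = i then 1 else if k = i + 1 then -1 else 0)
      else (\<lambda>k. if k = n - 1 \<or> k = n then 1 else 0))"

definition positive_roots :: "nat \<Rightarrow> (nat \<Rightarrow> int) set" where
  "positive_roots n =
     {\<beta> \<in> roots n. \<exists>c :: nat \<Rightarrow> nat. \<forall>k. \<beta> k = (\<Sum>j = 1..n. int (c j) * simple_root n j k)}"

text \<open>A set of simple roots is given by the set \<open>I\<close> of their indices.\<close>

definition levi_roots :: "nat \<Rightarrow> nat set \<Rightarrow> (nat \<Rightarrow> int) set" where
  "levi_roots n I =
     {\<beta> \<in> roots n. \<exists>c :: nat \<Rightarrow> int. \<forall>k. \<beta> k = (\<Sum>j \<in> I. c j * simple_root n j k)}"

abbreviation mat_span :: "nat \<Rightarrow> complex mat set \<Rightarrow> complex mat set" where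
  "mat_span m \<equiv> LinearCombinations.module.span class_ring (module_mat TYPE(complex) m m)"

text \<open>The nilradical u of the standard parabolic subalgebra p = l + u attached to \<open>I\<close>, where
  l is spanned by the Cartan subalgebra and the root spaces for \<open>levi_roots n I\<close>.\<close>

definition parabolic_nilradical :: "nat \<Rightarrow> nat set \<Rightarrow> complex mat set" where
  "parabolic_nilradical n I =
     mat_span (2*n) (\<Union>\<beta> \<in> positive_roots n - levi_roots n I. root_space n \<beta>)"

text \<open>\<open>ns\<close> is the list (n_1, ..., n_k).\<close>

definition parabolic_type :: "nat \<Rightarrow> nat set \<Rightarrow> nat list \<Rightarrow> bool" where
  "parabolic_type n I ns \<longleftrightarrow>
     I \<subseteq> {1..n} \<and> ns \<noteq> [] \<and> (\<forall>m \<in> set (butlast ns). 0 < m) \<and> sum_list ns = n \<and>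
     {1..n} - I = (\<lambda>t. sum_list (take t ns)) ` {1..<length ns}"

section \<open>Richardson orbits\<close>

text \<open>SO(2n) serves as the connected group with Lie algebra so(2n).\<close>

definition nilpotent_orbit :: "nat \<Rightarrow> complex mat set \<Rightarrow> bool" where
  "nilpotent_orbit n \<O> \<longleftrightarrow>
     (\<exists>X \<in> so n. (\<exists>r. X ^\<^sub>m r = 0\<^sub>m (2*n) (2*n)) \<and>
        \<O> = {Y. \<exists>g \<in> SO n. \<exists>h. similar_mat_wit Y X g h})"

text \<open>The usual topology on square matrices: the one of their tuples of entries.\<close>

definition mat_topology :: "nat \<Rightarrow> complex mat topology" where
  "mat_topology m =
     pullback_topology (carrier_mat m m) (\<lambda>A. restrict (\<lambda>ij. A $$ ij) ({..<m} \<times> {..<m}))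
       (product_topology (\<lambda>_. euclidean) ({..<m} \<times> {..<m}))"

definition richardson_orbit :: "nat \<Rightarrow> nat set \<Rightarrow> complex mat set \<Rightarrow> bool" where
  "richardson_orbit n I \<O> \<longleftrightarrow>
     nilpotent_orbit n \<O> \<and>
     (let u = parabolic_nilradical n I; T = subtopology (mat_topology (2*n)) u
      in openin T (\<O> \<inter> u) \<and> T closure_of (\<O> \<inter> u) = u)"

section \<open>Partitions\<close>

definition is_partition :: "nat \<Rightarrow> nat list \<Rightarrow> bool" where
  "is_partition m d \<longleftrightarrow> sorted_wrt (\<ge>) d \<and> 0 \<notin> set d \<and> sum_list d = m"

definition orbit_partition :: "nat \<Rightarrow> complex mat set \<Rightarrow> nat list \<Rightarrow> bool" where
  "orbit_partition n \<O> d \<longleftrightarrow>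
     is_partition (2*n) d \<and> (\<forall>X \<in> \<O>. jordan_nf X (map (\<lambda>r. (r, 0)) d))"

definition D_partition :: "nat \<Rightarrow> nat list \<Rightarrow> bool" where
  "D_partition n d \<longleftrightarrow>
     is_partition (2*n) d \<and> (\<forall>r \<in> set d. even r \<longrightarrow> even (count_list d r))"

definition dominates :: "nat list \<Rightarrow> nat list \<Rightarrow> bool" where
  "dominates d f \<longleftrightarrow> (\<forall>l. sum_list (take l f) \<le> sum_list (take l d))"

definition D_collapse :: "nat \<Rightarrow> nat list \<Rightarrow> nat list" where
  "D_collapse n d = (THE f. D_partition n f \<and> dominates d f \<and>
     (\<forall>g. D_partition n g \<and> dominates d g \<longrightarrow> dominates f g))"

text \<open>For a list of the row (column) lengths of a Young diagram, in any order and possibly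
  with zeros, the column (row) lengths in descending order.\<close>

definition conjugate_lengths :: "nat list \<Rightarrow> nat list" where
  "conjugate_lengths cs =
     map (\<lambda>i. length (filter (\<lambda>c. i \<le> c) cs)) [1..<Suc (Max (insert 0 (set cs)))]"

definition Z_diagram_shape :: "nat \<Rightarrow> nat list \<Rightarrow> nat list" where
  "Z_diagram_shape a0 bs = conjugate_lengths (2 * a0 # bs @ bs)"

text \<open>The sequence m_1, m_1, ..., m_{s-1}, m_{s-1}, 2 m_s, m_{s+1}, m_{s+1}, ..., m_k, m_k,
  with \<open>ms\<close> and \<open>s\<close> indexed from 0.\<close>

definition doubled_except :: "nat list \<Rightarrow> nat \<Rightarrow> nat list" where
  "doubled_except ms s =
     concat (map (\<lambda>i. if i = s then [2 * ms ! i] else [ms ! i, ms ! i]) [0..<length ms])"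

end

theory Submission
  imports Defs "Jordan_Normal_Form.Jordan_Normal_Form_Existence"
begin

text \<open>
  Conjugacy classes of nilpotent matrices are compared through the ranks of powers: if d is the
  Jordan type of X, then the rank of \<open>X ^ i\<close> is the sum of the numbers d_j - i over the parts d_j > i,
  and these sums detect the dominance order. The nilradical consists of the matrices in so(2n) that
  strictly raise a level function on the basis vectors, whose level sets are the blocks of the parabolic.
  Strictness bounds the rank of the i-th power by the size of all but the i largest blocks, so the type of
  the Richardson orbit is dominated by the shape of the Z-diagram; it is of type D_n, since the odd powers
  of an element of so(2n) are skew with respect to the form and so have even rank.

  Conversely, ranks of powers can only drop in the limit, so by density every element of the nilradical
  bounds the type of the Richardson orbit from below. Working outwards from the block of level 0, one
  extends the Jordan chains of an element by new end vectors, keeping each chain dual to itself (odd length)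
  or to its neighbour of the same length (even length). If only one of two dual chains of even length can be
  extended at its start, so is the other one at its end, both become odd, and sum and difference are
  self-dual. The resulting element has as its type the Z-diagram in which each pair of rows of
  different even lengths a > b is replaced by a - 1, b + 1. By parity and convexity of the rank function,
  this partition dominates every partition of type D_n dominated by the Z-diagram.
\<close>

section \<open>Dominance order and collapse\<close>

text \<open>Rank is split into two one-sided notions: \<open>rank_le\<close>, a factorisation
  through r dimensions, is what strictness yields; \<open>rank_ge\<close>, a nonzero r by r
  determinant, is an open condition. The chains of the constructed element only have to exhibit such
  determinants, because the bound on the partitions of type D_n below the Z-diagram closes the gap.

  The case n_k = 1 is separate because of the diagram automorphism e_n -> -e_n, which exchanges the
  simple roots \<alpha>_(n-1) and \<alpha>_n. For n_k = 1 the root \<alpha>_n = e_(n-1) + e_n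
  belongs to the Levi factor and \<alpha>_(n-1) does not, so -e_n joins the block of e_(n-1): no
  vector is left on level 0, and the last block has n_(k-1) + 1 elements.

  The grading element of the removed simple roots may take half-integral values, and its values do
  not always number the blocks. Integral levels counted by blocks are available because the entries
  of so(2n) between dual indices vanish: two level functions define the same space as soon as they
  compare non-dual indices alike.\<close>

definition excess :: "nat \<Rightarrow> nat list \<Rightarrow> nat" where
  "excess i d = (\<Sum>x \<leftarrow> d. x - i)"

lemma excess_simps [simp]:
  "excess i [] = 0" "excess i (x # d) = (x - i) + excess i d" "excess i (d @ e) = excess i d + excess i e"
  by (auto simp: excess_def)

text \<open>Prefix sums in l and excesses in i are related by a discrete Legendre transform. This is
  its inequality, from x \<le> i + (x - i) for each of the first l parts; it holds in any order of
  the parts. Equality needs descending order.\<close>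

lemma sum_take_le_excess: "sum_list (take l f) \<le> i * l + excess i f"
proof (induction f arbitrary: l)
  case (Cons x f)
  show ?case
  proof (cases l)
    case (Suc m)
    then show ?thesis using Cons[of m] by simp
  qed simp
qed simp

lemma excess_eq_0: "(\<And>x. x \<in> set d \<Longrightarrow> x \<le> i) \<Longrightarrow> excess i d = 0"
  by (induction d) auto

lemma excess_all_ge: "(\<And>x. x \<in> set d \<Longrightarrow> i \<le> x) \<Longrightarrow> sum_list d = i * length d + excess i d"
proof (induction d)
  case (Cons x d)
  have "i \<le> x" "sum_list d = i * length d + excess i d" using Cons by simp_all
  thus ?case unfolding sum_list.Cons list.size excess_simps add_Suc_right mult_Suc_right add_0_right by linarith
qed simp

text \<open>The supporting slope at l is the part number l, counted from 0: the parts before it are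
  at least as large, those from it on at most as large. Beyond the end of the list the slope is
  0.\<close>

lemma sum_take_eq_excess:
  assumes "sorted_wrt (\<ge>) (d :: nat list)"
  obtains i where "sum_list (take l d) = i * l + excess i d"
proof (cases "l < length d")
  case True
  let ?i = "d ! l"
  have "excess ?i (drop l d) = 0"
  proof (rule excess_eq_0)
    fix x assume "x \<in> set (drop l d)"
    then obtain k where "k < length d - l" "x = d ! (l + k)" by (auto simp: in_set_conv_nth)
    thus "x \<le> ?i" using assms True by (cases k) (auto simp: sorted_wrt_iff_nth_less)
  qed
  moreover have "sum_list (take l d) = ?i * length (take l d) + excess ?i (take l d)"
  proof (rule excess_all_ge)
    fix x assume "x \<in> set (take l d)"
    then obtain k where "k < l" "x = d ! k" using True by (auto simp: in_set_conv_nth)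
    thus "?i \<le> x" using assms True by (auto simp: sorted_wrt_iff_nth_less)
  qed
  moreover have "excess ?i d = excess ?i (take l d) + excess ?i (drop l d)"
    by (metis append_take_drop_id excess_simps(3))
  ultimately show ?thesis using True by (intro that[of ?i]) simp
next
  case False
  then show ?thesis using that[of 0] by (simp add: excess_def)
qed

lemma dominates_if_excess_le:
  assumes "sorted_wrt (\<ge>) d" "\<And>i. excess i f \<le> excess i d"
  shows "dominates d f"
  unfolding dominates_def
proof
  fix l
  obtain i where i: "sum_list (take l d) = i * l + excess i d" using sum_take_eq_excess[OF assms(1)] .
  have "sum_list (take l f) \<le> i * l + excess i f" by (rule sum_take_le_excess)
  thus "sum_list (take l f) \<le> sum_list (take l d)" using i assms(2)[of i] by simp
qed

text \<open>The dual choice: for given i the maximum is attained at the number of parts exceeding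
  i.\<close>

lemma excess_eq_sum_take:
  assumes "sorted_wrt (\<ge>) (f :: nat list)"
  obtains l where "sum_list (take l f) = i * l + excess i f"
proof -
  let ?u = "takeWhile (\<lambda>x. i < x) f" and ?v = "dropWhile (\<lambda>x. i < x) f"
  have "excess i ?v = 0"
  proof (rule excess_eq_0)
    fix x assume x: "x \<in> set ?v"
    then obtain y ys where v: "?v = y # ys" by (cases ?v) auto
    hence "y \<le> i" by (metis hd_dropWhile leI list.discI list.sel(1))
    moreover have "sorted_wrt (\<ge>) ?v" using assms by (metis sorted_wrt_append takeWhile_dropWhile_id)
    ultimately show "x \<le> i" using x v by auto
  qed
  moreover have "excess i f = excess i ?u + excess i ?v" by (metis excess_simps(3) takeWhile_dropWhile_id)
  moreover have "sum_list ?u = i * length ?u + excess i ?u"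
    by (rule excess_all_ge) (auto dest: set_takeWhileD)
  moreover have "take (length ?u) f = ?u" by (metis takeWhile_eq_take)
  ultimately show ?thesis by (intro that[of "length ?u"]) simp
qed

lemma excess_le_if_dominates:
  assumes "sorted_wrt (\<ge>) f" "dominates d f"
  shows "excess i f \<le> excess i d"
proof -
  obtain l where l: "sum_list (take l f) = i * l + excess i f" using excess_eq_sum_take[OF assms(1)] .
  have "sum_list (take l d) \<le> i * l + excess i d" by (rule sum_take_le_excess)
  moreover have "sum_list (take l f) \<le> sum_list (take l d)" using assms(2) unfolding dominates_def by blast
  ultimately show ?thesis using l by linarith
qed

text \<open>Prefix sums determine a list up to trailing zeros, which the first two assumptions
  exclude.\<close>

lemma dominates_antisym:
  assumes "0 \<notin> set d" "0 \<notin> set f" "dominates d f" "dominates f d"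
  shows "d = f"
proof -
  have eq: "sum_list (take l d) = sum_list (take l f)" for l
    using assms(3,4) unfolding dominates_def by (meson order_antisym)
  have len: "length e \<le> length e'" if "0 \<notin> set e" "\<And>l. sum_list (take l e) = sum_list (take l e')" for e e' :: "nat list"
  proof (rule ccontr)
    let ?l = "length e'"
    assume "\<not> length e \<le> ?l"
    hence l: "?l < length e" by simp
    have "sum_list (take (Suc ?l) e) = sum_list (take ?l e) + e ! ?l" using l by (simp add: take_Suc_conv_app_nth)
    moreover have "sum_list (take (Suc ?l) e) = sum_list (take ?l e)" using that(2)[of "Suc ?l"] that(2)[of ?l] by simp
    ultimately have "e ! ?l = 0" by simp
    thus False using that(1) l nth_mem by metis
  qed
  have l: "length d = length f" using len[of d f] len[of f d] assms eq by (simp add: le_antisym)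
  show ?thesis
  proof (rule nth_equalityI[OF l])
    fix k assume k: "k < length d"
    show "d ! k = f ! k" using eq[of k] eq[of "Suc k"] k l by (simp add: take_Suc_conv_app_nth)
  qed
qed

lemma D_collapse_eqI:
  assumes "D_partition n d" "dominates p d"
    and max: "\<And>g. D_partition n g \<Longrightarrow> dominates p g \<Longrightarrow> dominates d g"
  shows "D_collapse n p = d"
  unfolding D_collapse_def
proof (rule the_equality)
  show "D_partition n d \<and> dominates p d \<and> (\<forall>g. D_partition n g \<and> dominates p g \<longrightarrow> dominates d g)"
    using assms by blast
next
  fix f assume "D_partition n f \<and> dominates p f \<and> (\<forall>g. D_partition n g \<and> dominates p g \<longrightarrow> dominates f g)"
  thus "f = d" using assms by (intro dominates_antisym) (auto simp: D_partition_def is_partition_def)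
qed

lemma excess_eq_sum_count: "excess i d = (\<Sum>v \<in> set d. count_list d v * (v - i))"
  unfolding excess_def by (rule sum_list_map_eq_sum_count)

text \<open>For odd i an odd part v contributes an even number (0 if v < i), while an even part
  occurs an even number of times. Together with \<open>D_partitionI\<close>, type D_n becomes a
  parity condition on the ranks of odd powers.\<close>

lemma D_partition_even_excess:
  assumes "D_partition n d" "odd i"
  shows "even (excess i d)"
  unfolding excess_eq_sum_count
proof (rule dvd_sum)
  fix v assume v: "v \<in> set d"
  show "even (count_list d v * (v - i))"
  proof (cases "even v")
    case True
    then show ?thesis using assms v unfolding D_partition_def by auto
  next
    case False
    then show ?thesis using assms(2) by (cases "i \<le> v") auto
  qed
qed

text \<open>The second difference of i -> x - i, with truncated subtraction, is 1 at i = x and 0 at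
  all other positive i; so multiplicities are second differences of the excess. Convexity of the
  excess follows as well.\<close>

lemma count_list_add_excess: "0 < r \<Longrightarrow> count_list d r + 2 * excess r d = excess (r - 1) d + excess (r + 1) d"
proof (induction d)
  case (Cons x d)
  have "(if x = r then 1 else 0) + 2 * (x - r) = (x - (r - 1)) + (x - (r + 1))"
    using \<open>0 < r\<close> by (cases "x < r"; cases "x = r") simp_all
  thus ?case using Cons by (cases "x = r") (simp_all add: algebra_simps)
qed simp

lemma D_partitionI:
  assumes "is_partition (2 * n) d" "\<And>i. odd i \<Longrightarrow> even (excess i d)"
  shows "D_partition n d"
  unfolding D_partition_def
proof (intro conjI ballI impI)
  fix r assume r: "r \<in> set d" "even r"
  hence "0 < r" using assms(1) unfolding is_partition_def by (metis gr0I)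
  hence "even (excess (r - 1) d + excess (r + 1) d)" using r assms(2)[of "r - 1"] assms(2)[of "r + 1"] by simp
  thus "even (count_list d r)" using count_list_add_excess[OF \<open>0 < r\<close>, of d] by presburger
qed (rule assms(1))

lemma excess_convex: "0 < r \<Longrightarrow> 2 * excess r d \<le> excess (r - 1) d + excess (r + 1) d"
  using count_list_add_excess[of r d] by linarith

text \<open>Rows are paired as \<open>(2t, 2t+1)\<close>. A pair of unequal even rows loses a box in its first row
  to its second row.\<close>

definition collapse_row :: "nat \<Rightarrow> (nat \<Rightarrow> nat) \<Rightarrow> nat \<Rightarrow> nat" where
  "collapse_row a0 p r =
     (if r < 2 * a0 then p r
      else if even r then (if p r = p (r + 1) then p r else p r - 1)
      else (if p r = p (r - 1) then p r else p r + 1))"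

section \<open>Row sums of the collapsed diagram\<close>

lemma sum_pairs: "(\<Sum>r<2 * T. f r) = (\<Sum>t<T. f (2 * t) + f (2 * t + 1))" for f :: "nat \<Rightarrow> nat"
  by (induction T) auto

text \<open>Passing from rows a > b to a - 1, b + 1 changes the truncated sum only for i strictly
  between b and a, where it drops by exactly 1.\<close>

lemma collapse_row_sum_cong:
  assumes "antimono p" "\<And>t. a0 \<le> t \<Longrightarrow> \<not> (p (2 * t + 1) < i \<and> i < p (2 * t))"
  shows "(\<Sum>r<2 * T. collapse_row a0 p r - i) = (\<Sum>r<2 * T. p r - i)"
  unfolding sum_pairs
proof (rule sum.cong)
  fix t
  have "p (2 * t + 1) \<le> p (2 * t)" using antimonoD[OF assms(1), of "2 * t" "2 * t + 1"] by simp
  thus "collapse_row a0 p (2 * t) - i + (collapse_row a0 p (2 * t + 1) - i) = p (2 * t) - i + (p (2 * t + 1) - i)"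
    using assms(2)[of t] unfolding collapse_row_def by auto
qed simp

text \<open>As p descends, the open intervals between the two rows of the pairs are disjoint, so a
  given i lies in at most one of them and the total loss is at most 1.\<close>

lemma collapse_row_sum_Suc:
  assumes "antimono p" "a0 \<le> t0" "p (2 * t0 + 1) < i" "i < p (2 * t0)"
  shows "(\<Sum>r<2 * T. p r - i) \<le> Suc (\<Sum>r<2 * T. collapse_row a0 p r - i)"
proof -
  have "(\<Sum>t<T. p (2 * t) - i + (p (2 * t + 1) - i)) \<le>
      (\<Sum>t<T. collapse_row a0 p (2 * t) - i + (collapse_row a0 p (2 * t + 1) - i) + (if t = t0 then 1 else 0))"
  proof (rule sum_mono)
    fix t
    have le: "p (2 * t + 1) \<le> p (2 * t)" using antimonoD[OF assms(1), of "2 * t" "2 * t + 1"] by simp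
    consider "t = t0" | "t < t0" | "t > t0" by linarith
    thus "p (2 * t) - i + (p (2 * t + 1) - i) \<le>
      collapse_row a0 p (2 * t) - i + (collapse_row a0 p (2 * t + 1) - i) + (if t = t0 then 1 else 0)"
    proof cases
      case 1
      then show ?thesis using le unfolding collapse_row_def by auto
    next
      case 2
      then have "i < p (2 * t + 1)" using antimonoD[OF assms(1), of "2 * t + 1" "2 * t0"] assms by simp
      then show ?thesis using le unfolding collapse_row_def by auto
    next
      case 3
      then have "p (2 * t) < i" using antimonoD[OF assms(1), of "2 * t0 + 1" "2 * t"] assms by simp
      then show ?thesis using le unfolding collapse_row_def by auto
    qed
  qed
  also have "\<dots> \<le> Suc (\<Sum>r<2 * T. collapse_row a0 p r - i)"
    unfolding sum_pairs by (simp add: sum.distrib)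
  finally show ?thesis unfolding sum_pairs .
qed

text \<open>Exactly the rows up to 2 * t0 exceed i. The first 2 * a0 of them are odd and contribute
  even numbers; the others are even, contribute odd numbers, and number 2 * (t0 - a0) + 1.\<close>

lemma parity_row_sum:
  fixes p :: "nat \<Rightarrow> nat"
  assumes anti: "antimono p" and t0: "a0 \<le> t0" "t0 < T" "p (2 * t0 + 1) < i" "i < p (2 * t0)"
    and odd_rows: "\<And>r. r < 2 * a0 \<Longrightarrow> odd (p r)" and even_rows: "\<And>r. 2 * a0 \<le> r \<Longrightarrow> even (p r)"
    and "odd i"
  shows "odd (\<Sum>r<2 * T. p r - i)"
proof -
  have "(\<Sum>r<2 * T. p r - i) = (\<Sum>r<2 * t0 + 1. p r - i)"
  proof (rule sum.mono_neutral_right)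
    show "\<forall>r \<in> {..<2 * T} - {..<2 * t0 + 1}. p r - i = 0"
    proof
      fix r assume "r \<in> {..<2 * T} - {..<2 * t0 + 1}"
      hence "p r \<le> p (2 * t0 + 1)" by (intro antimonoD[OF anti]) auto
      thus "p r - i = 0" using t0 by simp
    qed
  qed (use t0 in auto)
  also have "\<dots> = (\<Sum>r<2 * a0. p r - i) + (\<Sum>r = 2 * a0..<2 * t0 + 1. p r - i)"
    using t0 unfolding lessThan_atLeast0 by (intro sum.atLeastLessThan_concat[symmetric]) auto
  finally have eq: "(\<Sum>r<2 * T. p r - i) = (\<Sum>r<2 * a0. p r - i) + (\<Sum>r = 2 * a0..<2 * t0 + 1. p r - i)" .
  have gt: "i < p r" if "r \<le> 2 * t0" for r using antimonoD[OF anti that] t0 by simp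
  have "even (\<Sum>r<2 * a0. p r - i)"
    using gt t0 odd_rows \<open>odd i\<close> by (intro dvd_sum) (simp add: less_imp_le)
  moreover have "odd (\<Sum>r = 2 * a0..<2 * t0 + 1. p r - i)"
  proof -
    have "odd (p r - i)" if "r \<in> {2 * a0..<2 * t0 + 1}" for r
      using that gt[of r] even_rows[of r] \<open>odd i\<close> by (simp add: less_imp_le)
    hence "{r \<in> {2 * a0..<2 * t0 + 1}. odd (p r - i)} = {2 * a0..<2 * t0 + 1}" by blast
    thus ?thesis using t0 by (subst even_sum_iff) auto
  qed
  ultimately show ?thesis unfolding eq by simp
qed

text \<open>Only an i inside the gap of a pair needs an argument, and there strict inequality for
  the uncollapsed rows suffices. For odd i it comes from parity. For even i it comes from i - 1 and
  i + 1, which are still in the gap because its ends are even: the excess of g is convex, while the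
  row sum is affine around i since no row has length i.\<close>

lemma excess_le_collapse_row:
  assumes anti: "antimono p"
    and odd_rows: "\<And>r. r < 2 * a0 \<Longrightarrow> odd (p r)" and even_rows: "\<And>r. 2 * a0 \<le> r \<Longrightarrow> even (p r)"
    and T: "p (2 * T) = 0"
    and g: "D_partition n g" and le: "\<And>i. excess i g \<le> (\<Sum>r<2 * T. p r - i)"
  shows "excess i g \<le> (\<Sum>r<2 * T. collapse_row a0 p r - i)"
proof (cases "\<exists>t \<ge> a0. p (2 * t + 1) < i \<and> i < p (2 * t)")
  case False
  then show ?thesis using collapse_row_sum_cong[OF anti, of a0 i T] le[of i] by auto
next
  case True
  then obtain t where t: "a0 \<le> t" "p (2 * t + 1) < i" "i < p (2 * t)" by blast
  have "t < T"
  proof (rule ccontr)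
    assume "\<not> t < T"
    hence "p (2 * t) \<le> p (2 * T)" by (intro antimonoD[OF anti]) simp
    thus False using T t by simp
  qed
  have odd_less: "excess j g < (\<Sum>r<2 * T. p r - j)" if "odd j" "p (2 * t + 1) < j" "j < p (2 * t)" for j
  proof -
    have "odd (\<Sum>r<2 * T. p r - j)"
      using parity_row_sum[OF anti t(1) \<open>t < T\<close> that(2,3) odd_rows even_rows that(1)] by blast
    thus ?thesis using le[of j] D_partition_even_excess[OF g that(1)] by (metis le_neq_implies_less)
  qed
  have "excess i g < (\<Sum>r<2 * T. p r - i)"
  proof (cases "odd i")
    case True
    then show ?thesis using odd_less t by blast
  next
    case False
    have ev: "even (p (2 * t))" "even (p (2 * t + 1))" using even_rows t by auto
    have i: "0 < i" using t by simp
    have 1: "excess (i - 1) g < (\<Sum>r<2 * T. p r - (i - 1))"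
    proof (rule odd_less)
      show odd: "odd (i - 1)" using False i by simp
      have "p (2 * t + 1) \<noteq> i - 1" using ev False i odd by auto
      thus "p (2 * t + 1) < i - 1" "i - 1 < p (2 * t)" using t by auto
    qed
    have 2: "excess (i + 1) g < (\<Sum>r<2 * T. p r - (i + 1))"
    proof (rule odd_less)
      show "odd (i + 1)" using False by simp
      have "p (2 * t) \<noteq> i + 1" using ev False by auto
      thus "p (2 * t + 1) < i + 1" "i + 1 < p (2 * t)" using t by auto
    qed
    have ne: "p r \<noteq> i" for r
    proof (cases "r \<le> 2 * t")
      case True
      then show ?thesis using antimonoD[OF anti True] t by simp
    next
      case False
      then show ?thesis using antimonoD[OF anti, of "2 * t + 1" r] t by simp
    qed
    have "(\<Sum>r<2 * T. p r - (i - 1)) + (\<Sum>r<2 * T. p r - (i + 1)) = 2 * (\<Sum>r<2 * T. p r - i)"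
      unfolding sum.distrib[symmetric] sum_distrib_left
    proof (rule sum.cong)
      fix r show "p r - (i - 1) + (p r - (i + 1)) = 2 * (p r - i)" using ne[of r] i by (cases "p r < i") simp_all
    qed simp
    thus ?thesis using 1 2 excess_convex[OF i, of g] by linarith
  qed
  thus ?thesis using collapse_row_sum_Suc[OF anti t, of T] by linarith
qed

section \<open>Conjugate partitions\<close>

text \<open>The length of row r, counted from 0, of the diagram with column lengths
  \<open>cs\<close>. As a function of all r it allows diagrams of different heights to be compared
  without padding lists.\<close>

definition col_count :: "nat list \<Rightarrow> nat \<Rightarrow> nat" where
  "col_count cs r = length (filter (\<lambda>c. r < c) cs)"

lemma col_count_antimono: "antimono (col_count cs)"
  unfolding col_count_def
proof (rule antimonoI)
  fix x y :: nat assume "x \<le> y"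
  thus "length (filter (\<lambda>c. y < c) cs) \<le> length (filter (\<lambda>c. x < c) cs)"
    by (induction cs) auto
qed

lemma conjugate_lengths_eq:
  "conjugate_lengths cs = map (col_count cs) [0..<Max (insert 0 (set cs))]"
  unfolding conjugate_lengths_def col_count_def
  by (rule nth_equalityI) (auto simp: Suc_le_eq simp del: upt_Suc intro!: arg_cong[where f = length] filter_cong)

lemma sorted_conjugate_lengths: "sorted_wrt (\<ge>) (conjugate_lengths cs)"
  unfolding conjugate_lengths_eq
  by (auto simp: sorted_wrt_iff_nth_less intro!: antimonoD[OF col_count_antimono])

lemma col_count_eq_0: "(\<And>c. c \<in> set cs \<Longrightarrow> c \<le> r) \<Longrightarrow> col_count cs r = 0"
  by (auto simp: col_count_def filter_empty_conv not_less)

lemma col_count_pos: "c \<in> set cs \<Longrightarrow> r < c \<Longrightarrow> 0 < col_count cs r"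
  by (auto simp: col_count_def filter_empty_conv)

lemma excess_conjugate_lengths:
  assumes "\<And>c. c \<in> set cs \<Longrightarrow> c \<le> R"
  shows "excess i (conjugate_lengths cs) = (\<Sum>r<R. col_count cs r - i)"
proof -
  let ?M = "Max (insert 0 (set cs))"
  have "excess i (conjugate_lengths cs) = (\<Sum>r<?M. col_count cs r - i)"
    unfolding excess_def conjugate_lengths_eq by (simp add: comp_def interv_sum_list_conv_sum_set_nat lessThan_atLeast0)
  also have "\<dots> = (\<Sum>r<R. col_count cs r - i)"
  proof (rule sum.mono_neutral_left)
    show "{..<?M} \<subseteq> {..<R}" using assms by auto
    show "\<forall>r \<in> {..<R} - {..<?M}. col_count cs r - i = 0" by (auto simp: col_count_eq_0 not_less)
  qed simp
  finally show ?thesis .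
qed

lemma zero_notin_conjugate_lengths: "0 \<notin> set (conjugate_lengths cs)"
proof
  assume "0 \<in> set (conjugate_lengths cs)"
  then obtain r where r: "r < Max (insert 0 (set cs))" "col_count cs r = 0"
    unfolding conjugate_lengths_eq by auto
  let ?M = "Max (insert 0 (set cs))"
  have "?M \<in> insert 0 (set cs)" by (rule Max_in) auto
  hence "?M \<in> set cs" using r by auto
  from col_count_pos[OF this r(1)] r show False by simp
qed

lemma col_count_cong_mset:
  assumes "mset (filter (\<lambda>c. c \<noteq> 0) cs) = mset (filter (\<lambda>c. c \<noteq> 0) ds)"
  shows "col_count cs r = col_count ds r"
proof -
  have "col_count es r = size (filter_mset (\<lambda>c. r < c) (mset (filter (\<lambda>c. c \<noteq> 0) es)))" for es
    unfolding col_count_def mset_filter[symmetric] size_mset filter_filter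
    by (rule arg_cong[where f = length], rule filter_cong) auto
  thus ?thesis using assms by simp
qed

text \<open>Both sides say that a given cell belongs to the diagram, once seen along rows and once
  along columns; this symmetry makes conjugation an involution.\<close>

lemma less_col_count_sorted:
  assumes "sorted_wrt (\<ge>) (d :: nat list)"
  shows "r < col_count d i \<longleftrightarrow> r < length d \<and> i < d ! r"
proof
  assume r: "r < length d \<and> i < d ! r"
  have "Suc r = length (filter (\<lambda>c. i < c) (take (Suc r) d))"
  proof -
    have "\<forall>c \<in> set (take (Suc r) d). i < c"
    proof
      fix c assume "c \<in> set (take (Suc r) d)"
      then obtain k where "k \<le> r" "c = d ! k" using r by (auto simp: in_set_conv_nth less_Suc_eq_le)
      moreover have "d ! r \<le> d ! k" if "k < r" using assms r that by (simp add: sorted_wrt_iff_nth_less)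
      ultimately show "i < c" using r by (cases "k = r") auto
    qed
    thus ?thesis using r by (simp add: filter_id_conv[THEN iffD2])
  qed
  also have "\<dots> \<le> col_count d i"
    unfolding col_count_def by (metis append_take_drop_id filter_append le_add1 length_append)
  finally show "r < col_count d i" by simp
next
  assume r: "r < col_count d i"
  have l: "r < length d" using r unfolding col_count_def by (meson length_filter_le less_le_trans)
  moreover have "i < d ! r"
  proof (rule ccontr)
    assume n: "\<not> i < d ! r"
    have "filter (\<lambda>c. i < c) (drop r d) = []"
    proof (unfold filter_empty_conv, rule ballI)
      fix c assume "c \<in> set (drop r d)"
      then obtain k where "k < length d - r" "c = d ! (r + k)" by (auto simp: in_set_conv_nth)
      moreover have "d ! (r + k) \<le> d ! r" if "0 < k" "k < length d - r"
        using assms that by (simp add: sorted_wrt_iff_nth_less)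
      ultimately show "\<not> i < c" using n by (cases "k = 0") auto
    qed
    hence "col_count d i = length (filter (\<lambda>c. i < c) (take r d))"
      unfolding col_count_def by (metis append_Nil2 append_take_drop_id filter_append)
    also have "\<dots> \<le> r" by (rule order_trans[OF length_filter_le]) simp
    finally show False using r by simp
  qed
  ultimately show "r < length d \<and> i < d ! r" ..
qed

text \<open>The lists are compared through their excesses, which give dominance in both directions;
  antisymmetry then yields equality.\<close>

lemma conjugate_conjugate_lengths:
  assumes d: "sorted_wrt (\<ge>) d" "0 \<notin> set d" and eq: "mset (filter (\<lambda>c. c \<noteq> 0) cs) = mset d"
  shows "conjugate_lengths (conjugate_lengths cs) = d"
proof -
  have fd: "filter (\<lambda>c. c \<noteq> 0) d = d" using d(2) by (metis (mono_tags, lifting) filter_True)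
  have cc: "col_count cs r = col_count d r" for r
    by (rule col_count_cong_mset) (simp only: eq fd)
  have excess: "excess i (conjugate_lengths (conjugate_lengths cs)) = excess i d" for i
  proof -
    let ?E = "conjugate_lengths cs" and ?M = "Max (insert 0 (set cs))"
    have le: "c \<le> ?M" if "c \<in> set d" for c
    proof -
      have "c \<in># mset (filter (\<lambda>c. c \<noteq> 0) cs)" using that by (simp only: eq set_mset_mset)
      thus ?thesis by simp
    qed
    have E: "col_count ?E r = (if r < length d then d ! r else 0)" for r
    proof -
      have "col_count ?E r = length (filter (\<lambda>i. r < col_count d i) [0..<?M])"
        unfolding conjugate_lengths_eq by (simp add: col_count_def[of "map _ _"] filter_map comp_def cc)
      also have "\<dots> = card {i. i < ?M \<and> r < col_count d i}"
        by (subst distinct_length_filter) (auto intro!: arg_cong[where f = card])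
      also have "{i. i < ?M \<and> r < col_count d i} = {..<(if r < length d then d ! r else 0)}"
        using le[OF nth_mem, of r] by (auto simp: less_col_count_sorted[OF d(1)])
      finally show ?thesis by simp
    qed
    define R where "R = Max (insert (length d) (set ?E))"
    have R: "length d \<le> R" "\<And>c. c \<in> set ?E \<Longrightarrow> c \<le> R" unfolding R_def by auto
    have "excess i (conjugate_lengths ?E) = (\<Sum>r<R. (if r < length d then d ! r else 0) - i)"
      using excess_conjugate_lengths[OF R(2)] E by simp
    also have "\<dots> = (\<Sum>r<length d. d ! r - i)"
      using R(1) by (intro sum.mono_neutral_cong_right) auto
    also have "\<dots> = excess i d"
      by (simp add: excess_def sum_list_sum_nth lessThan_atLeast0)
    finally show ?thesis .
  qed
  show ?thesis
  proof (rule dominates_antisym)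
    show "dominates (conjugate_lengths (conjugate_lengths cs)) d"
      by (rule dominates_if_excess_le[OF sorted_conjugate_lengths]) (simp only: excess order_refl)
    show "dominates d (conjugate_lengths (conjugate_lengths cs))"
      by (rule dominates_if_excess_le[OF d(1)]) (simp only: excess order_refl)
  qed (rule zero_notin_conjugate_lengths, rule d(2))
qed

section \<open>Rank by factorisation and by minors\<close>

definition rank_le :: "'a :: field mat \<Rightarrow> nat \<Rightarrow> bool" where
  "rank_le A r \<longleftrightarrow> (\<exists>B \<in> carrier_mat (dim_row A) r. \<exists>C \<in> carrier_mat r (dim_col A). A = B * C)"

text \<open>For P and Q selecting rows and columns the determinant is a minor. Arbitrary P and Q
  make invariance under similarity immediate.\<close>

definition rank_ge :: "'a :: field mat \<Rightarrow> nat \<Rightarrow> bool" where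
  "rank_ge A r \<longleftrightarrow> (\<exists>P \<in> carrier_mat r (dim_row A). \<exists>Q \<in> carrier_mat (dim_col A) r. det (P * A * Q) \<noteq> 0)"

lemma mat_assoc_dim:
  "dim_col A = dim_row B \<Longrightarrow> dim_col B = dim_row C \<Longrightarrow> (A * B) * C = A * (B * (C :: 'a :: semiring_0 mat))"
  by (rule assoc_mult_mat[of A "dim_row A" "dim_row B" B "dim_row C" C "dim_col C"]) auto

lemma mult_mat_index:
  assumes "A \<in> carrier_mat n m" "B \<in> carrier_mat m l" "i < n" "j < l"
  shows "(A * B) $$ (i,j) = (\<Sum>k = 0..<m. A $$ (i,k) * B $$ (k,j))"
  using assms by (auto simp: scalar_prod_def intro!: sum.cong)

lemma rank_leI:
  "B \<in> carrier_mat n r \<Longrightarrow> C \<in> carrier_mat r m \<Longrightarrow> A = B * C \<Longrightarrow> rank_le A r"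
  unfolding rank_le_def by auto

lemma rank_geI:
  "P \<in> carrier_mat r n \<Longrightarrow> Q \<in> carrier_mat m r \<Longrightarrow> A \<in> carrier_mat n m \<Longrightarrow>
   det (P * A * Q) \<noteq> 0 \<Longrightarrow> rank_ge A r"
  unfolding rank_ge_def by auto

text \<open>Padding both factors with zeros to square matrices of size r leaves the product
  unchanged and gives the second factor a zero row.\<close>

lemma det_mult_eq_0:
  fixes A B :: "'a :: field mat"
  assumes A: "A \<in> carrier_mat r s" and B: "B \<in> carrier_mat s r" and "s < r"
  shows "det (A * B) = 0"
proof -
  define A' where "A' = mat r r (\<lambda>(i,j). if j < s then A $$ (i,j) else 0)"
  define B' where "B' = mat r r (\<lambda>(i,j). if i < s then B $$ (i,j) else 0)"
  have [simp]: "A' \<in> carrier_mat r r" "B' \<in> carrier_mat r r" by (auto simp: A'_def B'_def)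
  have "A * B = A' * B'"
  proof (rule eq_matI)
    fix i j assume ij: "i < dim_row (A' * B')" "j < dim_col (A' * B')"
    hence ij: "i < r" "j < r" by (auto simp: A'_def B'_def)
    have "(A' * B') $$ (i,j) = (\<Sum>k = 0..<r. A' $$ (i,k) * B' $$ (k,j))"
      using ij by (auto simp: scalar_prod_def A'_def B'_def)
    also have "\<dots> = (\<Sum>k = 0..<s. A' $$ (i,k) * B' $$ (k,j))"
      using ij \<open>s < r\<close> by (intro sum.mono_neutral_right) (auto simp: A'_def)
    also have "\<dots> = (\<Sum>k = 0..<s. A $$ (i,k) * B $$ (k,j))"
      using ij \<open>s < r\<close> by (intro sum.cong) (auto simp: A'_def B'_def)
    also have "\<dots> = (A * B) $$ (i,j)" using ij A B by (auto simp: scalar_prod_def)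
    finally show "(A * B) $$ (i,j) = (A' * B') $$ (i,j)" by simp
  qed (use A B in \<open>auto simp: A'_def B'_def\<close>)
  moreover have "det B' = 0"
  proof -
    have "row B' s = 0\<^sub>v r" using \<open>s < r\<close> by (auto simp: B'_def)
    thus ?thesis using \<open>s < r\<close>
      by (subst laplace_expansion_row[of B' r s]) (auto intro!: sum.neutral simp: B'_def)
  qed
  ultimately show ?thesis using det_mult[of A' r B'] by simp
qed

lemma rank_ge_le_imp_le:
  assumes "rank_ge A r" "rank_le A s"
  shows "r \<le> s"
proof (rule ccontr)
  assume "\<not> r \<le> s"
  from assms obtain P Q where P: "P \<in> carrier_mat r (dim_row A)" and Q: "Q \<in> carrier_mat (dim_col A) r"
    and d: "det (P * A * Q) \<noteq> 0" unfolding rank_ge_def by auto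
  from assms obtain B C where B: "B \<in> carrier_mat (dim_row A) s" and C: "C \<in> carrier_mat s (dim_col A)"
    and A: "A = B * C" unfolding rank_le_def by auto
  note dims = P[THEN carrier_matD(1)] P[THEN carrier_matD(2)] Q[THEN carrier_matD(1)] Q[THEN carrier_matD(2)] B[THEN carrier_matD(1)] B[THEN carrier_matD(2)] C[THEN carrier_matD(1)] C[THEN carrier_matD(2)]
  have "P * A * Q = (P * B) * (C * Q)" unfolding A by (simp only: mat_assoc_dim index_mult_mat index_transpose_mat dims)
  with d det_mult_eq_0[of "P * B" r s "C * Q"] P B C Q \<open>\<not> r \<le> s\<close> show False by auto
qed

lemma rank_le_mult_left:
  assumes "rank_le A r" "A \<in> carrier_mat n m" "B \<in> carrier_mat m k"
  shows "rank_le (A * B) r"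
proof -
  from assms obtain U V where "U \<in> carrier_mat n r" "V \<in> carrier_mat r m" "A = U * V"
    unfolding rank_le_def by auto
  with assms show ?thesis
    using assoc_mult_mat[of U n r V m B k] by (intro rank_leI[of U n r "V * B" k]) auto
qed

lemma rank_le_mult_right:
  assumes "rank_le A r" "A \<in> carrier_mat n m" "B \<in> carrier_mat k n"
  shows "rank_le (B * A) r"
proof -
  from assms obtain U V where "U \<in> carrier_mat n r" "V \<in> carrier_mat r m" "A = U * V"
    unfolding rank_le_def by auto
  with assms show ?thesis
    using assoc_mult_mat[of B k n U r V m] by (intro rank_leI[of "B * U" k r V m]) auto
qed

lemma rank_le_mono:
  assumes "rank_le A r" "r \<le> s"
  shows "rank_le A s"
proof -
  let ?n = "dim_row A" and ?m = "dim_col A"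
  from assms obtain U V where U: "U \<in> carrier_mat ?n r" and V: "V \<in> carrier_mat r ?m" and A: "A = U * V"
    unfolding rank_le_def by auto
  define U' where "U' = mat ?n s (\<lambda>(i,j). if j < r then U $$ (i,j) else 0)"
  define V' where "V' = mat s ?m (\<lambda>(i,j). if i < r then V $$ (i,j) else 0)"
  have "A = U' * V'"
  proof (rule eq_matI)
    fix i j assume "i < dim_row (U' * V')" "j < dim_col (U' * V')"
    hence ij: "i < ?n" "j < ?m" by (auto simp: U'_def V'_def)
    have "(U' * V') $$ (i,j) = (\<Sum>k = 0..<s. U' $$ (i,k) * V' $$ (k,j))"
      using ij by (auto simp: scalar_prod_def U'_def V'_def)
    also have "\<dots> = (\<Sum>k = 0..<r. U' $$ (i,k) * V' $$ (k,j))"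
      using ij \<open>r \<le> s\<close> by (intro sum.mono_neutral_right) (auto simp: U'_def)
    also have "\<dots> = (\<Sum>k = 0..<r. U $$ (i,k) * V $$ (k,j))"
      using ij \<open>r \<le> s\<close> by (intro sum.cong) (auto simp: U'_def V'_def)
    also have "\<dots> = (U * V) $$ (i,j)" using ij U V by (auto simp: scalar_prod_def)
    finally show "A $$ (i,j) = (U' * V') $$ (i,j)" using A by simp
  qed (auto simp: U'_def V'_def)
  thus ?thesis by (intro rank_leI[of U' ?n s V' ?m]) (auto simp: U'_def V'_def)
qed

lemma rank_le_add:
  assumes "rank_le A r" "rank_le B s" "A \<in> carrier_mat n m" "B \<in> carrier_mat n m"
  shows "rank_le (A + B) (r + s)"
proof -
  from assms obtain U V where U: "U \<in> carrier_mat n r" and V: "V \<in> carrier_mat r m" and A: "A = U * V"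
    unfolding rank_le_def by auto
  from assms obtain W Z where W: "W \<in> carrier_mat n s" and Z: "Z \<in> carrier_mat s m" and B: "B = W * Z"
    unfolding rank_le_def by auto
  \<comment> \<open>Blocks of height or width 0 turn \<open>four_block_mat\<close> into
    concatenation: F puts U and W side by side, G stacks V on Z, and F * G = U * V + W * Z.\<close>
  define F where "F = four_block_mat U W (0\<^sub>m 0 r) (0\<^sub>m 0 s)"
  define G where "G = four_block_mat V (0\<^sub>m r 0) Z (0\<^sub>m s 0)"
  have "F * G = four_block_mat (U * V + W * Z) (U * 0\<^sub>m r 0 + W * 0\<^sub>m s 0) (0\<^sub>m 0 r * V + 0\<^sub>m 0 s * Z)
       (0\<^sub>m 0 r * 0\<^sub>m r 0 + 0\<^sub>m 0 s * 0\<^sub>m s 0)"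
    unfolding F_def G_def using U V W Z by (intro mult_four_block_mat[of _ n r _ s _ 0 _ _ m _ 0]) auto
  also have "\<dots> = A + B" using A B assms U V W Z by (intro eq_matI) auto
  finally have "A + B = F * G" ..
  moreover have "F \<in> carrier_mat n (r + s)" "G \<in> carrier_mat (r + s) m"
    using U V W Z by (auto simp: F_def G_def)
  ultimately show ?thesis by (intro rank_leI)
qed

lemma mult_block_diag:
  fixes A B D E :: "'a :: field mat"
  assumes "A \<in> carrier_mat r n" "D \<in> carrier_mat s m" "B \<in> carrier_mat n k" "E \<in> carrier_mat m l"
  shows "four_block_mat A (0\<^sub>m r m) (0\<^sub>m s n) D * four_block_mat B (0\<^sub>m n l) (0\<^sub>m m k) E =
    four_block_mat (A * B) (0\<^sub>m r l) (0\<^sub>m s k) (D * E)"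
  using assms
  by (subst mult_four_block_mat[of _ r n _ m _ s _ _ k _ l]) (simp_all add: mult_carrier_mat[of A r n B k] mult_carrier_mat[of D s m E l])

lemma rank_le_block_diag:
  assumes "rank_le A r" "rank_le D s" "A \<in> carrier_mat n n" "D \<in> carrier_mat m m"
  shows "rank_le (four_block_mat A (0\<^sub>m n m) (0\<^sub>m m n) D) (r + s)"
proof -
  from assms obtain U V where U: "U \<in> carrier_mat n r" and V: "V \<in> carrier_mat r n" and A: "A = U * V"
    unfolding rank_le_def by auto
  from assms obtain W Z where W: "W \<in> carrier_mat m s" and Z: "Z \<in> carrier_mat s m" and D: "D = W * Z"
    unfolding rank_le_def by auto
  show ?thesis
    by (rule rank_leI[of "four_block_mat U (0\<^sub>m n s) (0\<^sub>m m r) W" "n + m" _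
          "four_block_mat V (0\<^sub>m r m) (0\<^sub>m s n) Z" "n + m"])
      (use U V W Z in \<open>simp_all add: A D mult_block_diag[OF U W V Z]\<close>)
qed

lemma rank_ge_block_diag:
  assumes "rank_ge A r" "rank_ge D s" "A \<in> carrier_mat n n" "D \<in> carrier_mat m m"
  shows "rank_ge (four_block_mat A (0\<^sub>m n m) (0\<^sub>m m n) D) (r + s)"
proof -
  from assms obtain U V where U: "U \<in> carrier_mat r n" and V: "V \<in> carrier_mat n r" and A: "det (U * A * V) \<noteq> 0"
    unfolding rank_ge_def by auto
  from assms obtain W Z where W: "W \<in> carrier_mat s m" and Z: "Z \<in> carrier_mat m s" and D: "det (W * D * Z) \<noteq> 0"
    unfolding rank_ge_def by auto
  let ?P = "four_block_mat U (0\<^sub>m r m) (0\<^sub>m s n) W" and ?Q = "four_block_mat V (0\<^sub>m n s) (0\<^sub>m m r) Z"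
  have "?P * four_block_mat A (0\<^sub>m n m) (0\<^sub>m m n) D = four_block_mat (U * A) (0\<^sub>m r m) (0\<^sub>m s n) (W * D)"
    by (rule mult_block_diag) (use assms U W in auto)
  also have "\<dots> * ?Q = four_block_mat (U * A * V) (0\<^sub>m r s) (0\<^sub>m s r) (W * D * Z)"
    by (rule mult_block_diag) (use assms U W V Z in auto)
  also have "det \<dots> = det (U * A * V) * det (W * D * Z)"
    by (rule det_four_block_mat_upper_right_zero) (use assms U W V Z in auto)
  finally show ?thesis using A D assms U W V Z
    by (intro rank_geI[of ?P _ "n + m" ?Q "n + m"]) auto
qed

lemma rank_similar:
  assumes "A \<in> carrier_mat n n" "B \<in> carrier_mat n n" "P \<in> carrier_mat n n" "Q \<in> carrier_mat n n"
    and PQ: "P * Q = 1\<^sub>m n" "Q * P = 1\<^sub>m n" and A: "A = P * B * Q"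
  shows "rank_le B r \<Longrightarrow> rank_le A r" "rank_ge B r \<Longrightarrow> rank_ge A r"
proof -
  assume "rank_le B r"
  thus "rank_le A r" unfolding A using assms
    by (meson mult_carrier_mat rank_le_mult_left rank_le_mult_right)
next
  assume "rank_ge B r"
  then obtain U V where U: "U \<in> carrier_mat r n" and V: "V \<in> carrier_mat n r" and d: "det (U * B * V) \<noteq> 0"
    unfolding rank_ge_def using assms by auto
  note dims = assms(2)[THEN carrier_matD(1)] assms(2)[THEN carrier_matD(2)] assms(3)[THEN carrier_matD(1)] assms(3)[THEN carrier_matD(2)] assms(4)[THEN carrier_matD(1)] assms(4)[THEN carrier_matD(2)] U[THEN carrier_matD(1)] U[THEN carrier_matD(2)] V[THEN carrier_matD(1)] V[THEN carrier_matD(2)]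
  have "(U * Q) * A * (P * V) = U * (Q * P) * B * ((Q * P) * V)"
    unfolding A by (simp only: mat_assoc_dim index_mult_mat index_transpose_mat dims)
  also have "\<dots> = U * B * V" using assms U V unfolding PQ by auto
  finally show "rank_ge A r" using d U V assms
    by (intro rank_geI[of "U * Q" r n "P * V" n]) auto
qed

text \<open>A is carried by congruence to an invertible skew matrix W = P * A * P^T of size r, for
  which det W = (-1)^r * det W. Invertibility is the point: P and Q are only known to make P * A * Q
  invertible, so C has to be rewritten in terms of the transpose of B.\<close>

lemma rank_even_if_skew:
  fixes A :: "complex mat"
  assumes A: "A \<in> carrier_mat n n" and skew: "transpose_mat A = - A" and "rank_le A r" "rank_ge A r"
  shows "even r"
proof -
  from assms obtain B C where B: "B \<in> carrier_mat n r" and C: "C \<in> carrier_mat r n" and ABC: "A = B * C"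
    unfolding rank_le_def by auto
  from assms obtain P Q where P: "P \<in> carrier_mat r n" and Q: "Q \<in> carrier_mat n r" and d: "det (P * A * Q) \<noteq> 0"
    unfolding rank_ge_def by auto
  note dims = P[THEN carrier_matD(1)] P[THEN carrier_matD(2)] Q[THEN carrier_matD(1)] Q[THEN carrier_matD(2)] B[THEN carrier_matD(1)] B[THEN carrier_matD(2)] C[THEN carrier_matD(1)] C[THEN carrier_matD(2)]
  have "P * A * Q = (P * B) * (C * Q)" unfolding ABC by (simp only: mat_assoc_dim index_mult_mat index_transpose_mat dims)
  with d det_mult[of "P * B" r "C * Q"] P Q B C have dPB: "det (P * B) \<noteq> 0" and dCQ: "det (C * Q) \<noteq> 0" by auto
  from B P have PB: "P * B \<in> carrier_mat r r" by auto
  obtain R where R: "R \<in> carrier_mat r r" "R * (P * B) = 1\<^sub>m r"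
    using det_non_zero_imp_unit[OF PB dPB, of "()"]
    unfolding Units_def ring_mat_def by auto
  define W where "W = P * A * transpose_mat P"
  \<comment> \<open>Skewness reads B * C = - C^T * B^T; multiplying by P and then by the inverse R
    of P * B solves it for C, namely C = S * B^T.\<close>
  define S where "S = - (R * (P * transpose_mat C))"
  have S: "S \<in> carrier_mat r r" using R P C by (auto simp: S_def)
  note dims = dims A[THEN carrier_matD(1)] A[THEN carrier_matD(2)] R(1)[THEN carrier_matD(1)] R(1)[THEN carrier_matD(2)] S[THEN carrier_matD(1)] S[THEN carrier_matD(2)]
  have "transpose_mat A = transpose_mat C * transpose_mat B" unfolding ABC by (rule transpose_mult[OF B C])
  hence "B * C = - (transpose_mat C * transpose_mat B)" using skew ABC
    by (metis uminus_uminus_mat)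
  hence "P * (B * C) = P * (- (transpose_mat C * transpose_mat B))" by simp
  hence "P * B * C = - (P * transpose_mat C * transpose_mat B)" using P B C assoc_mult_mat[OF P B C] assoc_mult_mat[of P r n "transpose_mat C" r "transpose_mat B" n] by simp
  hence "R * (P * B * C) = R * - (P * transpose_mat C * transpose_mat B)" by simp
  moreover have "R * (P * B * C) = C"
    using R P B C assoc_mult_mat[OF R(1) PB C] by simp
  moreover have "R * - (P * transpose_mat C * transpose_mat B) = S * transpose_mat B"
    unfolding S_def
    by (simp only: mat_assoc_dim index_mult_mat index_transpose_mat index_uminus_mat dims uminus_mult_left_mat uminus_mult_right_mat)
  ultimately have CS: "C = S * transpose_mat B" by simp
  have "C * Q = S * (transpose_mat B * Q)" unfolding CS using S B Q by (intro assoc_mult_mat) auto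
  with dCQ det_mult[of S r "transpose_mat B * Q"] S B Q have dS: "det S \<noteq> 0" by auto
  have W: "W = (P * B) * S * transpose_mat (P * B)"
    unfolding W_def ABC CS
    by (subst transpose_mult[OF P B]) (simp only: mat_assoc_dim index_mult_mat index_transpose_mat dims)
  have "det W = det (P * B) * det S * det (P * B)"
    unfolding W using PB S by (simp add: det_mult[of _ r] det_transpose[OF PB])
  hence "det W \<noteq> 0" using dPB dS by simp
  have Wc: "W \<in> carrier_mat r r" using P A by (auto simp: W_def)
  have "transpose_mat W = P * transpose_mat A * transpose_mat P"
  proof -
    have "transpose_mat W = transpose_mat (transpose_mat P) * transpose_mat (P * A)"
      unfolding W_def by (rule transpose_mult[of _ r n _ r]) (use P A in auto)
    also have "transpose_mat (P * A) = transpose_mat A * transpose_mat P" by (rule transpose_mult[OF P A])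
    finally show ?thesis by (simp only: mat_assoc_dim index_mult_mat index_transpose_mat transpose_transpose dims)
  qed
  also have "\<dots> = - W" unfolding skew W_def using P A by simp
  finally have "det W = det (- W)" using det_transpose[OF Wc] by simp
  also have "- W = (-1) \<cdot>\<^sub>m W" using Wc by (intro eq_matI) auto
  also have "det \<dots> = (-1) ^ r * det W" using Wc by simp
  finally show "even r" using \<open>det W \<noteq> 0\<close> by (cases "even r") auto
qed

section \<open>Ranks of powers of nilpotent Jordan matrices\<close>

lemma rank_jordan_block_pow:
  fixes d i :: nat
  defines "J \<equiv> jordan_block d (0 :: complex) ^\<^sub>m i"
  shows "rank_le J (d - i)" "rank_ge J (d - i)"
proof -
  have J: "J = mat d d (\<lambda>(a,b). if a \<le> b \<and> b - a = i then 1 else 0)"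
    unfolding J_def by (rule jordan_block_zero_pow)
  let ?r = "d - i"
  let ?B = "mat d ?r (\<lambda>(a,b). if a = b then 1 else 0) :: complex mat"
  let ?C = "mat ?r d (\<lambda>(a,b). if a + i = b then 1 else 0) :: complex mat"
  show "rank_le J ?r"
  proof (rule rank_leI[of ?B d ?r ?C d])
    show "J = ?B * ?C"
    proof (rule eq_matI)
      fix a b assume ab: "a < dim_row (?B * ?C)" "b < dim_col (?B * ?C)"
      hence "(?B * ?C) $$ (a,b) = (\<Sum>k = 0..<?r. ?B $$ (a,k) * ?C $$ (k,b))"
        by (intro mult_mat_index) auto
      also have "\<dots> = (\<Sum>k = 0..<?r. (if a = k then (if k + i = b then 1 else 0) else 0))"
        using ab by (intro sum.cong) auto
      also have "\<dots> = J $$ (a,b)" using ab by (auto simp: J)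
      finally show "J $$ (a,b) = (?B * ?C) $$ (a,b)" ..
    qed (auto simp: J)
  qed auto
  let ?P = "mat ?r d (\<lambda>(a,b). if b = a then 1 else 0) :: complex mat"
  let ?Q = "mat d ?r (\<lambda>(a,b). if a = b + i then 1 else 0) :: complex mat"
  have PJ: "?P * J = ?C"
  proof (rule eq_matI)
    fix a b assume ab: "a < dim_row ?C" "b < dim_col ?C"
    hence "(?P * J) $$ (a,b) = (\<Sum>k = 0..<d. ?P $$ (a,k) * J $$ (k,b))"
      by (intro mult_mat_index) (auto simp: J)
    also have "\<dots> = (\<Sum>k = 0..<d. (if k = a then (if a \<le> b \<and> b - a = i then 1 else 0) else 0))"
      using ab by (intro sum.cong) (auto simp: J)
    also have "\<dots> = ?C $$ (a,b)" using ab by auto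
    finally show "(?P * J) $$ (a,b) = ?C $$ (a,b)" .
  qed (auto simp: J)
  have "?C * ?Q = 1\<^sub>m ?r"
  proof (rule eq_matI)
    fix a b assume ab: "a < dim_row (1\<^sub>m ?r :: complex mat)" "b < dim_col (1\<^sub>m ?r :: complex mat)"
    hence "(?C * ?Q) $$ (a,b) = (\<Sum>k = 0..<d. ?C $$ (a,k) * ?Q $$ (k,b))"
      by (intro mult_mat_index) auto
    also have "\<dots> = (\<Sum>k = 0..<d. (if k = a + i then (if a = b then 1 else 0) else 0))"
      using ab by (intro sum.cong) auto
    also have "\<dots> = 1\<^sub>m ?r $$ (a,b)" using ab by auto
    finally show "(?C * ?Q) $$ (a,b) = 1\<^sub>m ?r $$ (a,b)" .
  qed auto
  thus "rank_ge J ?r" using PJ by (intro rank_geI[of ?P ?r d ?Q d]) (auto simp: J)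
qed

lemma nilpotent_jordan_matrix_carrier: "jordan_matrix (map (\<lambda>r. (r, 0)) d) \<in> carrier_mat (sum_list d) (sum_list d)"
  by (intro carrier_matI) (auto simp: comp_def)

lemma rank_jordan_matrix_pow:
  fixes d :: "nat list" and i :: nat
  defines "J \<equiv> jordan_matrix (map (\<lambda>r. (r, 0 :: complex)) d) ^\<^sub>m i"
  shows "rank_le J (excess i d) \<and> rank_ge J (excess i d)"
  unfolding J_def
proof (induction d)
  case Nil
  show ?case
    by (auto simp: excess_def jordan_matrix_def rank_le_def rank_ge_def intro!: bexI[of _ "0\<^sub>m 0 0"])
next
  case (Cons x d)
  let ?n = "sum_list d"
  let ?M = "jordan_matrix (map (\<lambda>r. (r, 0 :: complex)) d)"
  have "jordan_matrix (map (\<lambda>r. (r, 0 :: complex)) (x # d)) =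
     four_block_mat (jordan_block x 0) (0\<^sub>m x ?n) (0\<^sub>m ?n x) ?M"
    by (simp add: jordan_matrix_Cons comp_def)
  also have "\<dots> ^\<^sub>m i = four_block_mat (jordan_block x 0 ^\<^sub>m i) (0\<^sub>m x ?n) (0\<^sub>m ?n x) (?M ^\<^sub>m i)"
    by (rule pow_four_block_mat) (auto simp: nilpotent_jordan_matrix_carrier)
  finally show ?case using Cons rank_jordan_block_pow[of x i]
    by (auto simp: excess_def nilpotent_jordan_matrix_carrier pow_carrier_mat intro!: rank_le_block_diag rank_ge_block_diag)
qed

lemma jordan_nf_rank_pow:
  assumes A: "A \<in> carrier_mat n n" and jnf: "jordan_nf A (map (\<lambda>r. (r, 0 :: complex)) d)"
  shows "rank_le (A ^\<^sub>m i) (excess i d)" "rank_ge (A ^\<^sub>m i) (excess i d)"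
proof -
  let ?J = "jordan_matrix (map (\<lambda>r. (r, 0 :: complex)) d)"
  from jnf obtain P Q where w: "similar_mat_wit A ?J P Q"
    unfolding jordan_nf_def similar_mat_def by auto
  have w': "similar_mat_wit (A ^\<^sub>m i) (?J ^\<^sub>m i) P Q" by (rule similar_mat_wit_pow[OF w])
  note * = similar_mat_witD2[OF pow_carrier_mat[OF A] w']
  show "rank_le (A ^\<^sub>m i) (excess i d)" "rank_ge (A ^\<^sub>m i) (excess i d)"
    by (rule rank_similar[OF _ _ _ _ *(1,2,3)]; use * rank_jordan_matrix_pow in auto)+
qed

section \<open>Upper bound for the ranks of powers\<close>

definition proj_mat :: "nat \<Rightarrow> (nat \<Rightarrow> bool) \<Rightarrow> 'a :: field mat" where
  "proj_mat N D = mat N N (\<lambda>(a,b). if a = b \<and> D a then 1 else 0)"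

lemma proj_mat_carrier [simp]: "proj_mat N D \<in> carrier_mat N N"
  by (simp add: proj_mat_def)

lemma mult_proj_mat_index:
  assumes "A \<in> carrier_mat N N" "a < N" "b < N"
  shows "(A * proj_mat N D) $$ (a,b) = (if D b then A $$ (a,b) else 0)"
    "(proj_mat N D * A) $$ (a,b) = (if D a then A $$ (a,b) else 0)"
proof -
  have "(A * proj_mat N D) $$ (a,b) = (\<Sum>k = 0..<N. A $$ (a,k) * proj_mat N D $$ (k,b))"
    using assms by (intro mult_mat_index) auto
  also have "\<dots> = (\<Sum>k = 0..<N. if k = b then (if D b then A $$ (a,b) else 0) else 0)"
    using assms by (intro sum.cong) (auto simp: proj_mat_def)
  finally show "(A * proj_mat N D) $$ (a,b) = (if D b then A $$ (a,b) else 0)" using assms by simp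
  have "(proj_mat N D * A) $$ (a,b) = (\<Sum>k = 0..<N. proj_mat N D $$ (a,k) * A $$ (k,b))"
    using assms by (intro mult_mat_index) auto
  also have "\<dots> = (\<Sum>k = 0..<N. if k = a then (if D a then A $$ (a,b) else 0) else 0)"
    using assms by (intro sum.cong) (auto simp: proj_mat_def)
  finally show "(proj_mat N D * A) $$ (a,b) = (if D a then A $$ (a,b) else 0)" using assms by simp
qed

lemma rank_le_proj_mat: "rank_le (proj_mat N D :: 'a :: field mat) (card {a. a < N \<and> D a})"
proof -
  let ?r = "card {a. a < N \<and> D a}"
  obtain e where e: "bij_betw e {0..<?r} {a. a < N \<and> D a}"
    using ex_bij_betw_nat_finite[of "{a. a < N \<and> D a}"] by auto
  let ?B = "mat N ?r (\<lambda>(a,k). if a = e k then 1 else 0) :: 'a mat"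
  let ?C = "mat ?r N (\<lambda>(k,a). if a = e k then 1 else 0) :: 'a mat"
  show ?thesis
  proof (rule rank_leI[of ?B N ?r ?C N])
    show "proj_mat N D = ?B * ?C"
    proof (rule eq_matI)
      fix a b assume "a < dim_row (?B * ?C)" "b < dim_col (?B * ?C)"
      hence ab: "a < N" "b < N" by auto
      hence "(?B * ?C) $$ (a,b) = (\<Sum>k = 0..<?r. ?B $$ (a,k) * ?C $$ (k,b))"
        by (intro mult_mat_index) auto
      also have "\<dots> = (\<Sum>k = 0..<?r. if e k = a \<and> a = b then 1 else 0)"
        using ab by (intro sum.cong) auto
      also have "\<dots> = (\<Sum>c \<in> {a. a < N \<and> D a}. if c = a \<and> a = b then 1 else 0)"
        by (rule sum.reindex_bij_betw[OF e])
      also have "\<dots> = (\<Sum>c \<in> {a. a < N \<and> D a}. if c = a then (if a = b then 1 else 0) else 0)"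
        by (intro sum.cong) auto
      also have "\<dots> = (if D a \<and> a = b then 1 else 0)" using ab by auto
      finally show "proj_mat N D $$ (a,b) = (?B * ?C) $$ (a,b)" using ab by (cases "a = b"; cases "D a"; simp add: proj_mat_def)
    qed (auto simp: proj_mat_def)
  qed auto
qed

text \<open>When R bounds the column lengths, this is the number of boxes left after removing the i
  longest columns: they take min k i boxes from a row of length k.\<close>

definition row_excess :: "nat \<Rightarrow> nat \<Rightarrow> nat list \<Rightarrow> nat" where
  "row_excess R i cs = (\<Sum>r<R. col_count cs r - i)"

lemma col_count_Cons [simp]: "col_count (c # cs) r = (if r < c then 1 else 0) + col_count cs r"
  by (simp add: col_count_def)

lemma col_count_Nil [simp]: "col_count [] r = 0"
  by (simp add: col_count_def)

text \<open>If b > 0, at least i columns of \<open>M\<close> have length b or more, so the new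
  column survives the removal of the i longest ones.\<close>

lemma row_excess_Cons_all:
  assumes "b \<le> R" "\<And>r. r < b \<Longrightarrow> i \<le> col_count M r"
  shows "row_excess R i (b # M) = row_excess R i M + b"
proof -
  have "row_excess R i (b # M) = (\<Sum>r<R. (col_count M r - i) + (if r < b then 1 else 0))"
    unfolding row_excess_def using assms(2) by (intro sum.cong) (auto simp: Suc_diff_le)
  also have "\<dots> = row_excess R i M + (\<Sum>r<R. if r < b then 1 else 0)"
    by (simp add: row_excess_def sum.distrib)
  also have "(\<Sum>r<R. if r < b then 1 else 0) = (\<Sum>r<b. 1 :: nat)"
    using assms(1) by (intro sum.mono_neutral_cong_right) auto
  finally show ?thesis by simp
qed

text \<open>At most i columns of \<open>M\<close> reach the row r0 < b, so the new column may be
  taken among the \<open>Suc i\<close> longest ones and is removed with them.\<close>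

lemma row_excess_Cons_ex:
  assumes "r0 < b" "col_count M r0 \<le> i"
  shows "row_excess R (Suc i) (b # M) = row_excess R i M"
  unfolding row_excess_def
proof (rule sum.cong)
  fix r
  show "col_count (b # M) r - Suc i = col_count M r - i"
  proof (cases "r < b")
    case False
    hence "col_count M r \<le> i" using antimonoD[OF col_count_antimono, of r0 r M] assms by simp
    thus ?thesis using False by simp
  qed simp
qed simp

text \<open>Adjoining the level set of \<open>j\<close>, of size b, raises the rank of \<open>X ^ i\<close> by at most b;
  on the other hand \<open>X\<close> maps into the higher levels, where the rank of \<open>X ^ (i - 1)\<close> is known.\<close>

lemma rank_le_pow_proj:
  fixes X :: "'a :: field mat" and L :: "nat \<Rightarrow> int"
  assumes X: "X \<in> carrier_mat N N"
    and strict: "\<And>a b. a < N \<Longrightarrow> b < N \<Longrightarrow> X $$ (a,b) \<noteq> 0 \<Longrightarrow> L b < L a"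
    and top: "\<And>a. a < N \<Longrightarrow> L a \<le> K"
  defines "sz \<equiv> \<lambda>j. card {a. a < N \<and> L a = j}"
  shows "rank_le (X ^\<^sub>m i * proj_mat N (\<lambda>a. K - int m < L a)) (row_excess N i (map sz [K - int m + 1..K]))"
proof (induction m arbitrary: i)
  case 0
  have "proj_mat N (\<lambda>a. K - int 0 < L a) = (0\<^sub>m N N :: 'a mat)"
    using top by (intro eq_matI) (auto simp: proj_mat_def not_less)
  hence "X ^\<^sub>m i * proj_mat N (\<lambda>a. K - int 0 < L a) = 0\<^sub>m N N"
    using right_mult_zero_mat[OF pow_carrier_mat[OF X]] by simp
  moreover have "rank_le (0\<^sub>m N N :: 'a mat) 0"
    by (rule rank_leI[of "0\<^sub>m N 0" N 0 "0\<^sub>m 0 N" N]) auto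
  ultimately show ?case by (auto intro: rank_le_mono)
next
  case (Suc m)
  define j where "j = K - int m"
  let ?E = "proj_mat N (\<lambda>a. j < L a) :: 'a mat" and ?E' = "proj_mat N (\<lambda>a. j - 1 < L a) :: 'a mat"
    and ?F = "proj_mat N (\<lambda>a. L a = j) :: 'a mat"
  let ?M = "map sz [j + 1..K]"
  have IH: "rank_le (X ^\<^sub>m i * ?E) (row_excess N i ?M)" for i using Suc[of i] by (simp add: j_def)
  note Xi = pow_carrier_mat[OF X]
  have sz: "sz j \<le> N" unfolding sz_def using card_mono[of "{..<N}" "{a. a < N \<and> L a = j}"] by auto
  have "rank_le (X ^\<^sub>m i * ?E') (row_excess N i (sz j # ?M))"
  \<comment> \<open>Whether the new level belongs to the i largest ones decides which of the two
    bounds is used: adding its size, or spending one factor X.\<close>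
  proof (cases "\<forall>r < sz j. i \<le> col_count ?M r")
    case True
    have "?E' = ?E + ?F" by (rule eq_matI) (auto simp: proj_mat_def)
    hence "X ^\<^sub>m i * ?E' = X ^\<^sub>m i * ?E + X ^\<^sub>m i * ?F"
      using mult_add_distrib_mat[OF Xi proj_mat_carrier proj_mat_carrier] by metis
    moreover have "rank_le (X ^\<^sub>m i * ?F) (sz j)"
      unfolding sz_def by (rule rank_le_mult_right[OF rank_le_proj_mat proj_mat_carrier Xi])
    ultimately have "rank_le (X ^\<^sub>m i * ?E') (row_excess N i ?M + sz j)"
      using rank_le_add[OF IH[of i], of "X ^\<^sub>m i * ?F" "sz j" N N]
        mult_carrier_mat[OF Xi proj_mat_carrier] by simp
    thus ?thesis using row_excess_Cons_all[OF sz, of i ?M] True by simp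
  next
    case False
    then obtain r0 where r0: "r0 < sz j" "col_count ?M r0 < i" by auto
    then obtain i' where i: "i = Suc i'" by (cases i) auto
    \<comment> \<open>By strictness X maps the span of the levels from j on into that of the levels
      above j, where the bound for the exponent i' is known.\<close>
    have "X * ?E' = ?E * (X * ?E')"
    proof (rule eq_matI)
      fix a b assume "a < dim_row (?E * (X * ?E'))" "b < dim_col (?E * (X * ?E'))"
      hence ab: "a < N" "b < N" by (auto simp: proj_mat_def)
      have "X $$ (a,b) = 0" if "j - 1 < L b" "\<not> j < L a"
        using strict[OF ab] that by (cases "X $$ (a,b) = 0") auto
      thus "(X * ?E') $$ (a,b) = (?E * (X * ?E')) $$ (a,b)"
        using X ab by (simp add: mult_proj_mat_index[of "X * ?E'"] mult_proj_mat_index[OF X])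
    qed (use X in \<open>auto simp: proj_mat_def\<close>)
    hence "X ^\<^sub>m i * ?E' = X ^\<^sub>m i' * (?E * (X * ?E'))"
      using X Xi[of i'] assoc_mult_mat[of "X ^\<^sub>m i'" N N X N ?E' N] by (simp add: i)
    also have "\<dots> = X ^\<^sub>m i' * ?E * (X * ?E')"
      using X Xi[of i'] by (intro assoc_mult_mat[symmetric, of _ N N _ N _ N]) auto
    finally have "rank_le (X ^\<^sub>m i * ?E') (row_excess N i' ?M)"
      using rank_le_mult_left[OF IH[of i'], of N N "X * ?E'" N] X Xi[of i'] by simp
    thus ?thesis using row_excess_Cons_ex[of r0 "sz j" ?M i' N] r0 by (simp add: i)
  qed
  moreover have "sz j # ?M = map sz [K - int (Suc m) + 1..K]"
    by (subst (2) upto_rec1) (auto simp: j_def algebra_simps)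
  ultimately show ?case by (simp add: j_def algebra_simps)
qed

lemma rank_le_pow_levels:
  fixes X :: "'a :: field mat" and L :: "nat \<Rightarrow> int"
  assumes X: "X \<in> carrier_mat N N"
    and strict: "\<And>a b. a < N \<Longrightarrow> b < N \<Longrightarrow> X $$ (a,b) \<noteq> 0 \<Longrightarrow> L b < L a"
    and L: "\<And>a. a < N \<Longrightarrow> \<bar>L a\<bar> \<le> int K"
  shows "rank_le (X ^\<^sub>m i) (row_excess N i (map (\<lambda>j. card {a. a < N \<and> L a = j}) [- int K..int K]))"
proof -
  have "proj_mat N (\<lambda>a. int K - int (Suc (2 * K)) < L a) = (1\<^sub>m N :: 'a mat)"
  proof (rule eq_matI)
    fix a b assume ab: "a < dim_row (1\<^sub>m N :: 'a mat)" "b < dim_col (1\<^sub>m N :: 'a mat)"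
    hence "- int K - 1 < L a" using L[of a] by simp
    thus "proj_mat N (\<lambda>a. int K - int (Suc (2 * K)) < L a) $$ (a,b) = (1\<^sub>m N :: 'a mat) $$ (a,b)"
      using ab by (simp add: proj_mat_def)
  qed (auto simp: proj_mat_def)
  moreover have "X ^\<^sub>m i * 1\<^sub>m N = X ^\<^sub>m i" by (rule right_mult_one_mat[OF pow_carrier_mat[OF X]])
  moreover have "int K - int (Suc (2 * K)) + 1 = - int K" by simp
  moreover have "L a \<le> int K" if "a < N" for a using L[OF that] by simp
  ultimately show ?thesis using rank_le_pow_proj[where L = L, OF X strict, where K = "int K" and i = i and m = "Suc (2 * K)"] by simp
qed

section \<open>Chains of a nilpotent element\<close>

text \<open>Vectors are functions on indices below \<open>N\<close>; the involution \<open>\<sigma>\<close> pairs the isotropic basis vectors.\<close>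

locale graded_form =
  fixes N :: nat and \<sigma> :: "nat \<Rightarrow> nat" and L :: "nat \<Rightarrow> int"
  assumes \<sigma>_less: "a < N \<Longrightarrow> \<sigma> a < N"
    and \<sigma>_\<sigma>: "a < N \<Longrightarrow> \<sigma> (\<sigma> a) = a"
    and L_\<sigma>: "a < N \<Longrightarrow> L (\<sigma> a) = - L a"
begin

definition bform :: "(nat \<Rightarrow> complex) \<Rightarrow> (nat \<Rightarrow> complex) \<Rightarrow> complex" where
  "bform v w = (\<Sum>a<N. v a * w (\<sigma> a))"

definition unit :: "nat \<Rightarrow> nat \<Rightarrow> complex" where
  "unit a = (\<lambda>z. if z = a then 1 else 0)"

lemma unit_simps [simp]: "unit a a = 1" "z \<noteq> a \<Longrightarrow> unit a z = 0"
  by (auto simp: unit_def)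

lemma bform_commute: "bform v w = bform w v"
proof -
  have "bij_betw \<sigma> {..<N} {..<N}"
    by (rule bij_betwI[of _ _ _ \<sigma>]) (auto simp: \<sigma>_less \<sigma>_\<sigma>)
  hence "(\<Sum>a<N. w (\<sigma> a) * v (\<sigma> (\<sigma> a))) = (\<Sum>a<N. w a * v (\<sigma> a))"
    by (rule sum.reindex_bij_betw)
  moreover have "bform v w = (\<Sum>a<N. w (\<sigma> a) * v (\<sigma> (\<sigma> a)))"
    unfolding bform_def by (rule sum.cong) (simp_all add: \<sigma>_\<sigma>)
  ultimately show ?thesis by (simp add: bform_def)
qed

lemma bform_unit_left: "a < N \<Longrightarrow> bform (unit a) w = w (\<sigma> a)"
  unfolding bform_def unit_def by (subst sum.mono_neutral_cong_right[of _ "{a}" _ "\<lambda>_. w (\<sigma> a)"]) auto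

lemma bform_unit_right: "a < N \<Longrightarrow> bform v (unit a) = v (\<sigma> a)"
  by (simp add: bform_commute[of v] bform_unit_left)

lemma bform_add_left: "bform (\<lambda>z. u z + v z) w = bform u w + bform v w"
  by (simp add: bform_def sum.distrib algebra_simps)

lemma bform_diff_left: "bform (\<lambda>z. u z - v z) w = bform u w - bform v w"
  by (simp add: bform_def sum_subtractf algebra_simps)

definition scale :: "complex \<Rightarrow> (nat \<Rightarrow> complex) \<Rightarrow> nat \<Rightarrow> complex" where
  "scale k v = (\<lambda>z. k * v z)"

lemma bform_scale_left: "bform (scale k v) w = k * bform v w"
  by (simp add: bform_def scale_def sum_distrib_left algebra_simps)

lemma bform_sum_left: "bform (\<lambda>z. \<Sum>c\<in>C. f c z) w = (\<Sum>c\<in>C. bform (f c) w)"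
  unfolding bform_def by (subst sum.swap) (simp add: sum_distrib_right)

lemma bform_zero_left [simp]: "bform (\<lambda>_. 0) w = 0"
  by (simp add: bform_def)

lemma bform_add_right: "bform w (\<lambda>z. u z + v z) = bform w u + bform w v"
  by (simp add: bform_commute[of w] bform_add_left)

lemma bform_diff_right: "bform w (\<lambda>z. u z - v z) = bform w u - bform w v"
  by (simp add: bform_commute[of w] bform_diff_left)

lemma bform_scale_right: "bform w (scale k v) = k * bform w v"
  by (simp add: bform_commute[of w] bform_scale_left)

lemma bform_zero_right [simp]: "bform w (\<lambda>_. 0) = 0"
  by (simp add: bform_def)

end

text \<open>The chain number \<open>c\<close> has length \<open>g c\<close> and is dual to the chain \<open>\<delta> c\<close>; levels of absolute value
  at most \<open>l\<close> have been used.\<close>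

locale chain_system = graded_form +
  fixes l :: int and X :: "(nat \<Rightarrow> complex) \<Rightarrow> nat \<Rightarrow> complex" and x :: "nat \<Rightarrow> nat \<Rightarrow> nat \<Rightarrow> complex"
    and g \<delta> :: "nat \<Rightarrow> nat" and s :: "nat \<Rightarrow> complex"
  assumes skew: "bform (X v) w = - bform v (X w)"
    and supp: "X v a \<noteq> 0 \<Longrightarrow> a < N \<and> \<bar>L a\<bar> \<le> l"
    and strict: "a < N \<Longrightarrow> b < N \<Longrightarrow> X (unit b) a \<noteq> 0 \<Longrightarrow> L b < L a"
    and chain_supp: "i < g c \<Longrightarrow> x c i z \<noteq> 0 \<Longrightarrow> z < N \<and> \<bar>L z\<bar> \<le> l"
    and dual_dual: "\<delta> (\<delta> c) = c" and g_dual: "g (\<delta> c) = g c"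
    and s_nonzero: "s c \<noteq> 0" and s_dual: "s (\<delta> c) = - ((-1) ^ g c * s c)"
    and chain: "i < g c \<Longrightarrow> X (x c i) = (if Suc i < g c then x c (Suc i) else (\<lambda>_. 0))"
    and gram: "i < g c \<Longrightarrow> j < g d \<Longrightarrow>
        bform (x c i) (x d j) = (if d = \<delta> c \<and> Suc (i + j) = g c then (-1) ^ i * s c else 0)"
begin

text \<open>Linearity of X comes out of skewness: a coordinate of X v is a value of the form, X v a
  = - \<open>bform v (X (unit (\<sigma> a)))\<close>, which is linear in v.\<close>

lemma X_eq_sum:
  assumes "a < N"
  shows "X v a = (\<Sum>b<N. X (unit b) a * v b)"
proof -
  have 1: "X u a = - bform u (X (unit (\<sigma> a)))" for u
    using bform_unit_right[OF \<sigma>_less[OF assms], of "X u"] assms skew[of u] by (simp add: \<sigma>_\<sigma>)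
  have "X v a = (\<Sum>b<N. - (v b * X (unit (\<sigma> a)) (\<sigma> b)))"
    unfolding 1[of v] bform_def by (simp add: sum_negf)
  also have "\<dots> = (\<Sum>b<N. X (unit b) a * v b)"
  proof (rule sum.cong)
    fix b assume "b \<in> {..<N}"
    hence "X (unit b) a = - X (unit (\<sigma> a)) (\<sigma> b)" using 1[of "unit b"] by (simp add: bform_unit_left)
    thus "- (v b * X (unit (\<sigma> a)) (\<sigma> b)) = X (unit b) a * v b" by simp
  qed simp
  finally show ?thesis .
qed


lemma X_add: "X (\<lambda>z. u z + v z) = (\<lambda>z. X u z + X v z)"
proof
  fix a show "X (\<lambda>z. u z + v z) a = X u a + X v a"
  proof (cases "a < N")
    case True
    show ?thesis unfolding X_eq_sum[OF True, of u] X_eq_sum[OF True, of v] X_eq_sum[OF True, of "\<lambda>z. u z + v z"]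
      by (simp add: algebra_simps sum.distrib)
  next
    case False
    hence "X w a = 0" for w using supp by blast
    thus ?thesis by simp
  qed
qed

lemma X_scale: "X (scale k v) = scale k (X v)"
proof
  fix a show "X (scale k v) a = scale k (X v) a"
  proof (cases "a < N")
    case True
    show ?thesis unfolding X_eq_sum[OF True, of "scale k v"]
      by (simp add: X_eq_sum[OF True, of v] scale_def algebra_simps sum_distrib_left)
  next
    case False
    hence "X w a = 0" for w using supp by blast
    thus ?thesis by (simp add: scale_def)
  qed
qed

lemma X_diff: "X (\<lambda>z. u z - v z) = (\<lambda>z. X u z - X v z)"
  using X_add[of u "scale (- 1) v"] X_scale[of "- 1" v] by (simp add: scale_def)

text \<open>For odd length the sign rule gives \<open>s (\<delta> c0)\<close> = \<open>s c0\<close>.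
  Hence the cross terms cancel when the sum of the two chains is paired with their difference, and
  they add up to \<plusminus> 2 * \<open>s c0\<close> when either is paired with itself. Odd length
  is forced: for \<open>\<delta> c = c\<close> the rule \<open>s_dual\<close> with nonzero
  \<open>s c\<close> excludes even length.\<close>

lemma chain_system_convert:
  assumes ne: "\<delta> c0 \<noteq> c0" and odd: "odd (g c0)"
  defines "d0 \<equiv> \<delta> c0"
  shows "chain_system N \<sigma> L l X
     (\<lambda>c i. if c = c0 then (\<lambda>z. x c0 i z + x d0 i z) else if c = d0 then (\<lambda>z. x c0 i z - x d0 i z) else x c i)
     g (\<delta>(c0 := c0, d0 := d0)) (s(c0 := 2 * s c0, d0 := - 2 * s c0))"
    (is "chain_system N \<sigma> L l X ?x g ?\<delta> ?s")
proof -
  have g0: "g d0 = g c0" "s d0 = s c0" "\<delta> d0 = c0" "c0 \<noteq> d0" "\<delta> c0 = d0"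
    using dual_dual[of c0] g_dual[of c0] s_dual[of c0] odd ne by (auto simp: d0_def)
  have other: "\<delta> c \<noteq> c0" "\<delta> c \<noteq> d0" if "c \<noteq> c0" "c \<noteq> d0" for c
    using that dual_dual g0 by metis+
  show ?thesis
  proof unfold_locales
    show "bform (X v) w = - bform v (X w)" for v w by (rule skew)
    show "X v a \<noteq> 0 \<Longrightarrow> a < N \<and> \<bar>L a\<bar> \<le> l" for v a by (rule supp)
    show "a < N \<Longrightarrow> b < N \<Longrightarrow> X (unit b) a \<noteq> 0 \<Longrightarrow> L b < L a" for a b by (rule strict)
    show "z < N \<and> \<bar>L z\<bar> \<le> l" if "i < g c" "?x c i z \<noteq> 0" for c i z
    proof -
      have "(x c i z \<noteq> 0 \<and> i < g c) \<or> (x c0 i z \<noteq> 0 \<and> i < g c0) \<or> (x d0 i z \<noteq> 0 \<and> i < g d0)"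
        using that g0 by (auto split: if_splits)
      thus ?thesis using chain_supp by blast
    qed
    show "?\<delta> (?\<delta> c) = c" "g (?\<delta> c) = g c" "?s c \<noteq> 0" "?s (?\<delta> c) = - ((-1) ^ g c * ?s c)" for c
      using dual_dual g_dual s_nonzero s_dual g0 odd other by auto
    show "X (?x c i) = (if Suc i < g c then ?x c (Suc i) else (\<lambda>_. 0))" if "i < g c" for c i
      using chain[of i] that g0 by (auto simp: X_add X_diff)
    show "bform (?x c i) (?x d j) = (if d = ?\<delta> c \<and> Suc (i + j) = g c then (-1) ^ i * ?s c else 0)"
      if ij: "i < g c" "j < g d" for c d i j
    proof -
      consider "c = c0" | "c = d0" | "c \<noteq> c0" "c \<noteq> d0" by blast
      thus "bform (?x c i) (?x d j) = (if d = ?\<delta> c \<and> Suc (i + j) = g c then (-1) ^ i * ?s c else 0)"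
      proof cases
        case 1
        consider "d = c0" | "d = d0" | "d \<noteq> c0" "d \<noteq> d0" by blast
        then show ?thesis using 1 ij g0
          by cases (auto simp: bform_add_left bform_diff_left bform_add_right bform_diff_right gram)
      next
        case 2
        consider "d = c0" | "d = d0" | "d \<noteq> c0" "d \<noteq> d0" by blast
        then show ?thesis using 2 ij g0
          by cases (auto simp: bform_add_left bform_diff_left bform_add_right bform_diff_right gram)
      next
        case 3
        then show ?thesis using ij g0 other[OF 3]
          by (auto simp: bform_add_left bform_diff_left bform_add_right bform_diff_right gram)
      qed
    qed
  qed
qed

end

text \<open>The vectors of index \<open>e c\<close> lie on the new top level l + 1, their duals on
  -(l + 1); \<open>l_nonneg\<close> keeps the two apart. The chains numbered below b get a new start
  on the bottom level, and skewness then makes their duals get a new end on the top level.\<close>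

locale chain_extension = chain_system +
  fixes e :: "nat \<Rightarrow> nat" and b :: nat
  assumes l_nonneg: "0 \<le> l" and inj_e: "inj_on e {..<b}"
    and e_less: "c < b \<Longrightarrow> e c < N" and L_e: "c < b \<Longrightarrow> L (e c) = l + 1"
begin

abbreviation "E c \<equiv> unit (e c)"
abbreviation "F c \<equiv> unit (\<sigma> (e c))"

text \<open>The new starting vector of the chain \<open>c < b\<close> is \<open>F c\<close>, and \<open>succ_F c\<close> its successor. The factor 1/2
  is due to the fact that for a pair of empty dual chains both members contribute to \<open>X'\<close>.\<close>

definition succ_F :: "nat \<Rightarrow> nat \<Rightarrow> complex" where
  "succ_F c = (if 0 < g c then x c 0 else if \<delta> c < b then scale (- (s (\<delta> c) / 2)) (E (\<delta> c)) else (\<lambda>_. 0))"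

text \<open>The skew operators added to X are the elements of so that correspond to the bivectors E
  c \<and> \<open>succ_F c\<close>. Their first term sends \<open>F c\<close> towards its successor;
  the second is forced by skewness and prolongs the dual chain at its end by a multiple of E
  c.\<close>

definition X' :: "(nat \<Rightarrow> complex) \<Rightarrow> nat \<Rightarrow> complex" where
  "X' v = (\<lambda>z. X v z + (\<Sum>c<b. bform (E c) v * succ_F c z - bform (succ_F c) v * E c z))"

text \<open>A new start shifts the old positions by one. The scalar of the new end is dictated by
  \<open>X'\<close>: it is the image of the last old vector, or of the new start if the chain was
  empty.\<close>

definition x' :: "nat \<Rightarrow> nat \<Rightarrow> nat \<Rightarrow> complex" where
  "x' c i = (if c < b \<and> i = 0 then F c
     else let k = (if c < b then i - 1 else i)
          in if k < g c then x c k else scale (- s (\<delta> c)) (E (\<delta> c)))"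

definition g' :: "nat \<Rightarrow> nat" where
  "g' c = g c + (if c < b then 1 else 0) + (if \<delta> c < b then 1 else 0)"

text \<open>The change of sign compensates for the shift of the exponent in (-1)^i caused by a new
  start.\<close>

definition s' :: "nat \<Rightarrow> complex" where
  "s' c = (if c < b then - s c else s c)"

lemma \<sigma>e_less: "c < b \<Longrightarrow> \<sigma> (e c) < N" and L_\<sigma>e: "c < b \<Longrightarrow> L (\<sigma> (e c)) = - (l + 1)"
  and \<sigma>\<sigma>e: "c < b \<Longrightarrow> \<sigma> (\<sigma> (e c)) = e c"
  using e_less L_e \<sigma>_less \<sigma>_\<sigma> L_\<sigma> by auto

lemma e_eq_iff: "c < b \<Longrightarrow> d < b \<Longrightarrow> e c = e d \<longleftrightarrow> c = d"
  using inj_e by (auto simp: inj_on_def)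

lemma \<sigma>e_eq_iff: "c < b \<Longrightarrow> d < b \<Longrightarrow> \<sigma> (e c) = \<sigma> (e d) \<longleftrightarrow> c = d"
  by (metis e_eq_iff \<sigma>\<sigma>e)

lemma e_neq_\<sigma>e: "c < b \<Longrightarrow> d < b \<Longrightarrow> e c \<noteq> \<sigma> (e d)"
proof
  assume "c < b" "d < b" "e c = \<sigma> (e d)"
  thus False using L_e[of c] L_\<sigma>e[of d] l_nonneg by simp
qed

lemma x_outer: "i < g c \<Longrightarrow> l < \<bar>L z\<bar> \<Longrightarrow> x c i z = 0"
  using chain_supp by (metis linorder_not_le)

lemma x_e: "i < g c \<Longrightarrow> d < b \<Longrightarrow> x c i (e d) = 0" and x_\<sigma>e: "i < g c \<Longrightarrow> d < b \<Longrightarrow> x c i (\<sigma> (e d)) = 0"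
  using L_e L_\<sigma>e l_nonneg by (auto intro!: x_outer)

lemma bform_E_F: "c < b \<Longrightarrow> d < b \<Longrightarrow> bform (E c) (F d) = (if c = d then 1 else 0)"
  by (subst bform_unit_left) (auto simp: e_less unit_def \<sigma>e_eq_iff)

lemma bform_F_E: "c < b \<Longrightarrow> d < b \<Longrightarrow> bform (F c) (E d) = (if c = d then 1 else 0)"
  by (subst bform_commute) (auto simp: bform_E_F)

lemma bform_E_E: "c < b \<Longrightarrow> d < b \<Longrightarrow> bform (E c) (E d) = 0"
  using e_neq_\<sigma>e[of d c] by (subst bform_unit_left) (auto simp: e_less unit_def)

lemma bform_F_F: "c < b \<Longrightarrow> d < b \<Longrightarrow> bform (F c) (F d) = 0"
  using e_neq_\<sigma>e[of c d] by (subst bform_unit_left) (auto simp: \<sigma>e_less \<sigma>\<sigma>e unit_def)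

lemma bform_E_x: "c < b \<Longrightarrow> i < g d \<Longrightarrow> bform (E c) (x d i) = 0"
  by (simp add: bform_unit_left e_less x_\<sigma>e)

lemma bform_F_x: "c < b \<Longrightarrow> i < g d \<Longrightarrow> bform (F c) (x d i) = 0"
  by (simp add: bform_unit_left \<sigma>e_less \<sigma>\<sigma>e x_e)

lemma bform_x_E: "c < b \<Longrightarrow> i < g d \<Longrightarrow> bform (x d i) (E c) = 0"
  by (simp add: bform_commute[of "x d i"] bform_E_x)

lemma bform_x_F: "c < b \<Longrightarrow> i < g d \<Longrightarrow> bform (x d i) (F c) = 0"
  by (simp add: bform_commute[of "x d i"] bform_F_x)

lemmas bform_basis = bform_E_F bform_F_E bform_E_E bform_F_F bform_E_x bform_F_x bform_x_E bform_x_F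

text \<open>The assumption \<open>supp\<close> only bounds the image of X; skewness turns it into a
  statement about the kernel, as \<sigma> preserves the absolute value of the level.\<close>

lemma X_unit_outer:
  assumes z: "z < N" "l < \<bar>L z\<bar>"
  shows "X (unit z) = (\<lambda>_. 0)"
proof
  fix a show "X (unit z) a = 0"
  proof (cases "a < N")
    case True
    have "X (unit z) a = bform (X (unit z)) (unit (\<sigma> a))"
      using True by (simp add: bform_unit_right \<sigma>_less \<sigma>_\<sigma>)
    also have "\<dots> = - X (unit (\<sigma> a)) (\<sigma> z)" using z by (simp add: skew bform_unit_left)
    also have "X (unit (\<sigma> a)) (\<sigma> z) = 0"
    proof (rule ccontr)
      assume "X (unit (\<sigma> a)) (\<sigma> z) \<noteq> 0"
      from supp[OF this] show False using z by (simp add: L_\<sigma>)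
    qed
    finally show ?thesis by simp
  qed (use supp in blast)
qed

lemma X_E: "c < b \<Longrightarrow> X (E c) = (\<lambda>_. 0)" and X_F: "c < b \<Longrightarrow> X (F c) = (\<lambda>_. 0)"
  using L_e L_\<sigma>e l_nonneg by (auto intro!: X_unit_outer e_less \<sigma>e_less)

lemma s_dual_empty: "g c = 0 \<Longrightarrow> s (\<delta> c) = - s c"
  using s_dual[of c] by simp

lemma succ_F_cases:
  assumes "succ_F c z \<noteq> 0"
  shows "z < N \<and> (\<bar>L z\<bar> \<le> l \<or> \<delta> c < b \<and> z = e (\<delta> c))"
  using assms chain_supp[of 0 c z] e_less[of "\<delta> c"] by (auto simp: succ_F_def scale_def unit_def split: if_splits)

lemma bform_succ_F_F:
  assumes "c < b" "d < b"
  shows "bform (succ_F c) (F d) = (if g c = 0 \<and> \<delta> c = d then - (s d / 2) else 0)"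
  using assms by (auto simp: succ_F_def bform_scale_left bform_basis)

lemma bform_succ_F_E: "c < b \<Longrightarrow> d < b \<Longrightarrow> bform (succ_F c) (E d) = 0"
  by (auto simp: succ_F_def bform_scale_left bform_basis)

lemma bform_succ_F_x:
  assumes "c < b" "k < g d"
  shows "bform (succ_F c) (x d k) = (if d = \<delta> c \<and> Suc k = g d then s c else 0)"
  using assms g_dual[of c] by (auto simp: succ_F_def bform_scale_left bform_basis gram)

lemma X'_F:
  assumes d: "d < b"
  shows "X' (F d) = (if 0 < g d then x d 0 else if \<delta> d < b then scale (- s (\<delta> d)) (E (\<delta> d)) else (\<lambda>_. 0))"
proof
  fix z
  have "(\<Sum>c<b. bform (E c) (F d) * succ_F c z) = (\<Sum>c<b. if c = d then succ_F c z else 0)"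
    using d by (intro sum.cong) (auto simp: bform_basis)
  also have "\<dots> = succ_F d z" using d by simp
  finally have 1: "(\<Sum>c<b. bform (E c) (F d) * succ_F c z) = succ_F d z" .
  \<comment> \<open>For an empty dual pair with both numbers below b, the summand c = d gave one
    half of the successor of \<open>F d\<close>; the summand c = \<open>\<delta> d\<close> gives the
    other half, since \<open>s (\<delta> d)\<close> = - \<open>s d\<close>.\<close>
  have "(\<Sum>c<b. bform (succ_F c) (F d) * E c z) =
      (\<Sum>c<b. if c = \<delta> d then (if g d = 0 then - (s d / 2) * E (\<delta> d) z else 0) else 0)"
    using d dual_dual g_dual by (intro sum.cong) (auto simp: bform_succ_F_F)
  also have "\<dots> = (if g d = 0 \<and> \<delta> d < b then - (s d / 2) * E (\<delta> d) z else 0)" by simp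
  finally have 2: "(\<Sum>c<b. bform (succ_F c) (F d) * E c z) =
    (if g d = 0 \<and> \<delta> d < b then - (s d / 2) * E (\<delta> d) z else 0)" .
  show "X' (F d) z = (if 0 < g d then x d 0 else if \<delta> d < b then scale (- s (\<delta> d)) (E (\<delta> d)) else (\<lambda>_. 0)) z"
    unfolding X'_def sum_subtractf 1 2 using d s_dual_empty[of d] by (auto simp: X_F succ_F_def scale_def)
qed

lemma X'_x:
  assumes k: "k < g d"
  shows "X' (x d k) = (if Suc k < g d then x d (Suc k) else if \<delta> d < b then scale (- s (\<delta> d)) (E (\<delta> d)) else (\<lambda>_. 0))"
proof
  fix z
  have "(\<Sum>c<b. bform (E c) (x d k) * succ_F c z - bform (succ_F c) (x d k) * E c z) =
      (\<Sum>c<b. if c = \<delta> d then (if Suc k = g d then - s (\<delta> d) * E (\<delta> d) z else 0) else 0)"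
    using k dual_dual by (intro sum.cong) (auto simp: bform_basis bform_succ_F_x)
  also have "\<dots> = (if \<delta> d < b \<and> Suc k = g d then - s (\<delta> d) * E (\<delta> d) z else 0)" by simp
  finally show "X' (x d k) z = (if Suc k < g d then x d (Suc k) else if \<delta> d < b then scale (- s (\<delta> d)) (E (\<delta> d)) else (\<lambda>_. 0)) z"
    unfolding X'_def using k chain[OF k] by (auto simp: scale_def)
qed

lemma X'_scale_E:
  assumes d: "d < b"
  shows "X' (scale k (E d)) = (\<lambda>_. 0)"
  unfolding X'_def using d by (simp add: X_E X_scale scale_def[of k "\<lambda>_. 0"] bform_scale_right bform_basis bform_succ_F_E)

lemma skew': "bform (X' v) w = - bform v (X' w)"
proof -
  have l: "bform (X' v) w = bform (X v) w + (\<Sum>c<b. bform (E c) v * bform (succ_F c) w - bform (succ_F c) v * bform (E c) w)" for v w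
  proof -
    have "bform (\<lambda>z. bform (E c) v * succ_F c z - bform (succ_F c) v * E c z) w =
        bform (E c) v * bform (succ_F c) w - bform (succ_F c) v * bform (E c) w" for c
      using bform_diff_left[of "scale (bform (E c) v) (succ_F c)" "scale (bform (succ_F c) v) (E c)" w]
      by (simp add: bform_scale_left[unfolded scale_def] scale_def)
    thus ?thesis unfolding X'_def bform_add_left bform_sum_left by simp
  qed
  have "bform v (X' w) = bform v (X w) + (\<Sum>c<b. bform (E c) w * bform (succ_F c) v - bform (succ_F c) w * bform (E c) v)"
    using l[of w v] bform_commute[of v] by simp
  also have "\<dots> = - bform (X v) w - (\<Sum>c<b. bform (E c) v * bform (succ_F c) w - bform (succ_F c) v * bform (E c) w)"
    unfolding skew sum_negf[symmetric] by (simp add: sum_subtractf algebra_simps)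
  finally show ?thesis unfolding l by simp
qed

lemma supp':
  assumes "X' v a \<noteq> 0"
  shows "a < N \<and> \<bar>L a\<bar> \<le> l + 1"
proof (cases "X v a = 0")
  case False
  then show ?thesis using supp[of v a] by simp
next
  case True
  hence "(\<Sum>c<b. bform (E c) v * succ_F c a - bform (succ_F c) v * E c a) \<noteq> 0" using assms by (simp add: X'_def)
  then obtain c where c: "c < b" "bform (E c) v * succ_F c a - bform (succ_F c) v * E c a \<noteq> 0"
    by (meson sum.not_neutral_contains_not_neutral lessThan_iff)
  hence "succ_F c a \<noteq> 0 \<or> E c a \<noteq> 0" by auto
  thus ?thesis
  proof
    assume "succ_F c a \<noteq> 0"
    from succ_F_cases[OF this] show ?thesis using L_e l_nonneg by auto
  next
    assume "E c a \<noteq> 0"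
    hence "a = e c" by (auto simp: unit_def split: if_splits)
    thus ?thesis using L_e[OF c(1)] e_less[OF c(1)] l_nonneg by simp
  qed
qed

text \<open>Every new entry starts on the bottom level -(l + 1) or ends on the top level l + 1, and
  its other index is not on the same level: successors avoid the bottom.\<close>

lemma strict':
  assumes a: "a < N" and z: "z < N" and "X' (unit z) a \<noteq> 0"
  shows "L z < L a"
proof (cases "X (unit z) a = 0")
  case False
  then show ?thesis using strict[OF a z] by simp
next
  case True
  hence "(\<Sum>c<b. bform (E c) (unit z) * succ_F c a - bform (succ_F c) (unit z) * E c a) \<noteq> 0"
    using assms by (simp add: X'_def)
  then obtain c where c: "c < b" "bform (E c) (unit z) * succ_F c a - bform (succ_F c) (unit z) * E c a \<noteq> 0"
    by (meson sum.not_neutral_contains_not_neutral lessThan_iff)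
  hence "E c (\<sigma> z) \<noteq> 0 \<and> succ_F c a \<noteq> 0 \<or> succ_F c (\<sigma> z) \<noteq> 0 \<and> E c a \<noteq> 0"
    using z by (auto simp: bform_unit_right)
  thus ?thesis
  proof
    assume *: "E c (\<sigma> z) \<noteq> 0 \<and> succ_F c a \<noteq> 0"
    hence "\<sigma> z = e c" by (auto simp: unit_def split: if_splits)
    hence "L z = - (l + 1)" using L_\<sigma>[OF z] L_e[OF c(1)] by simp
    moreover have "- (l + 1) < L a" using succ_F_cases[of c a] * L_e[of "\<delta> c"] l_nonneg by auto
    ultimately show ?thesis by simp
  next
    assume *: "succ_F c (\<sigma> z) \<noteq> 0 \<and> E c a \<noteq> 0"
    hence "a = e c" by (auto simp: unit_def split: if_splits)
    hence "L a = l + 1" using L_e[OF c(1)] by simp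
    moreover have "- (l + 1) < L (\<sigma> z)" using succ_F_cases[of c "\<sigma> z"] * L_e[of "\<delta> c"] l_nonneg by auto
    ultimately show ?thesis using L_\<sigma>[OF z] by simp
  qed
qed

lemma x'_supp:
  assumes "i < g' c" "x' c i z \<noteq> 0"
  shows "z < N \<and> \<bar>L z\<bar> \<le> l + 1"
proof -
  consider "c < b" "z = \<sigma> (e c)" | k where "k < g c" "x c k z \<noteq> 0" | "\<delta> c < b" "z = e (\<delta> c)"
    using assms by (auto simp: x'_def g'_def Let_def scale_def unit_def split: if_splits)
  thus ?thesis
  proof cases
    case 1
    then show ?thesis using \<sigma>e_less L_\<sigma>e l_nonneg by simp
  next
    case 2
    then show ?thesis using chain_supp[of k c z] by simp
  next
    case 3
    then show ?thesis using e_less L_e l_nonneg by simp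
  qed
qed

lemma x'_cases:
  assumes "i < g' c"
  obtains (start) "c < b" "i = 0" "x' c i = F c"
    | (old) k where "k < g c" "i = k + (if c < b then 1 else 0)" "x' c i = x c k"
    | (end_) "\<delta> c < b" "i = g c + (if c < b then 1 else 0)" "x' c i = scale (- s (\<delta> c)) (E (\<delta> c))"
proof -
  define q where "q = (if c < b then 1 else 0 :: nat)"
  consider "i < q" | "q \<le> i" "i - q < g c" | "q \<le> i" "\<not> i - q < g c" by linarith
  thus ?thesis
  proof cases
    case 1
    thus ?thesis by (intro start) (auto simp: q_def x'_def split: if_splits)
  next
    case 2
    thus ?thesis by (intro old[of "i - q"]) (auto simp: q_def x'_def)
  next
    case 3
    hence "\<delta> c < b" "i = g c + q" using assms by (auto simp: q_def g'_def split: if_splits)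
    thus ?thesis by (intro end_) (auto simp: q_def x'_def)
  qed
qed

lemma chain':
  assumes "i < g' c"
  shows "X' (x' c i) = (if Suc i < g' c then x' c (Suc i) else (\<lambda>_. 0))"
proof -
  define q where "q = (if c < b then 1 else 0 :: nat)"
  show ?thesis using assms
  proof (cases rule: x'_cases)
    case start
    then show ?thesis by (auto simp: x'_def X'_F g'_def)
  next
    case (old k)
    note 2 = this
    have "x' c (Suc i) = (if Suc k < g c then x c (Suc k) else scale (- s (\<delta> c)) (E (\<delta> c)))"
      using 2 by (auto simp: x'_def q_def)
    moreover have "Suc i < g' c \<longleftrightarrow> Suc k < g c \<or> \<delta> c < b" using 2 by (auto simp: g'_def q_def)
    ultimately show ?thesis using X'_x[OF 2(1)] 2(3) by auto
  next
    case end_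
    then have "\<not> Suc i < g' c" by (auto simp: g'_def)
    thus ?thesis using X'_scale_E[OF end_(1), of "- s (\<delta> c)"] end_(3) by simp
  qed
qed

text \<open>Of the nine combinations only start with end, old with old, and end with start can be
  nonzero, since \<open>F c\<close> pairs only with E c, the direction of the end of the chain
  \<open>\<delta> c\<close>. Its pairing with that end is - \<open>s c\<close>, which is the new
  constant.\<close>

lemma gram':
  assumes ij: "i < g' c" "j < g' d"
  shows "bform (x' c i) (x' d j) = (if d = \<delta> c \<and> Suc (i + j) = g' c then (-1) ^ i * s' c else 0)"
  using ij(1)
proof (cases rule: x'_cases)
  case start
  note c = this
  show ?thesis using ij(2)
  proof (cases rule: x'_cases)
    case start
    then show ?thesis using c by (auto simp: bform_basis g'_def)
  next
    case (old k)
    then show ?thesis using c g_dual[of c] by (auto simp: bform_basis g'_def dual_dual)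
  next
    case end_
    then show ?thesis using c g_dual[of c] dual_dual
      by (auto simp: bform_scale_right bform_basis g'_def s'_def)
  qed
next
  case (old k)
  note c = this
  show ?thesis using ij(2)
  proof (cases rule: x'_cases)
    case start
    then show ?thesis using c g_dual[of c] by (auto simp: bform_basis g'_def dual_dual)
  next
    case (old m)
    then show ?thesis using c g_dual[of c] by (auto simp: gram g'_def s'_def dual_dual)
  next
    case end_
    then show ?thesis using c g_dual[of c] by (auto simp: bform_scale_right bform_basis g'_def dual_dual)
  qed
next
  case end_
  note c = this
  show ?thesis using ij(2)
  proof (cases rule: x'_cases)
    case start
    then show ?thesis using c g_dual[of c] dual_dual s_dual[of c]
      by (auto simp: bform_scale_left bform_basis g'_def s'_def)
  next
    case (old m)
    then show ?thesis using c g_dual[of c] by (auto simp: bform_scale_left bform_basis g'_def dual_dual)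
  next
    case end_
    then show ?thesis using c g_dual[of c]
      by (auto simp: bform_scale_left bform_scale_right bform_basis g'_def dual_dual)
  qed
qed

lemma chain_system_extend: "chain_system N \<sigma> L (l + 1) X' x' g' \<delta> s'"
proof unfold_locales
  show "g' (\<delta> c) = g' c" for c using g_dual[of c] dual_dual[of c] by (simp add: g'_def)
  show "s' (\<delta> c) = - ((-1) ^ g' c * s' c)" for c using s_dual[of c] by (simp add: g'_def s'_def)
  show "s' c \<noteq> 0" for c using s_nonzero by (simp add: s'_def)
qed (rule skew' supp' strict' x'_supp dual_dual chain' gram'; assumption)+

end

section \<open>Row lengths of Z-diagrams and the duality of their rows\<close>

definition partner :: "nat \<Rightarrow> nat" where
  "partner c = (if even c then Suc c else c - 1)"

text \<open>The row r, counted from 0, of the Z-diagram: the column of length 2 * a0 occurs once,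
  every other column twice. Thus the first 2 * a0 rows are odd and the others even.\<close>

definition row_length :: "nat \<Rightarrow> nat list \<Rightarrow> nat \<Rightarrow> nat" where
  "row_length a0 bs r = (if r < 2 * a0 then 1 else 0) + 2 * col_count bs r"

text \<open>Applied to row lengths p, this is the duality of chains of length
  \<open>collapse_row a0 p\<close>: the first 2 * a0 rows and the pairs changed by the collapse have
  odd length and are self-dual; two equal even rows are dual to each other.\<close>

definition dual_row :: "nat \<Rightarrow> (nat \<Rightarrow> nat) \<Rightarrow> nat \<Rightarrow> nat" where
  "dual_row a0 p c = (if c < 2 * a0 \<or> p c \<noteq> p (partner c) then c else partner c)"

lemma partner_less [simp]: "partner c < 2 * a \<longleftrightarrow> c < 2 * a"
  by (auto simp: partner_def elim!: oddE)

lemma partner_partner [simp]: "partner (partner c) = c"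
  by (auto simp: partner_def)

lemma even_partner [simp]: "even (partner c) \<longleftrightarrow> odd c"
  by (auto simp: partner_def)

lemma row_pair:
  "collapse_row a0 p (2 * t) = (if t < a0 \<or> p (2 * t) = p (Suc (2 * t)) then p (2 * t) else p (2 * t) - 1)"
  "collapse_row a0 p (Suc (2 * t)) = (if t < a0 \<or> p (2 * t) = p (Suc (2 * t)) then p (Suc (2 * t)) else p (Suc (2 * t)) + 1)"
  "dual_row a0 p (2 * t) = (if t < a0 \<or> p (2 * t) \<noteq> p (Suc (2 * t)) then 2 * t else Suc (2 * t))"
  "dual_row a0 p (Suc (2 * t)) = (if t < a0 \<or> p (2 * t) \<noteq> p (Suc (2 * t)) then Suc (2 * t) else 2 * t)"
proof -
  have "Suc (2 * t) < 2 * a0 \<longleftrightarrow> t < a0" by presburger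
  thus "collapse_row a0 p (2 * t) = (if t < a0 \<or> p (2 * t) = p (Suc (2 * t)) then p (2 * t) else p (2 * t) - 1)"
    "collapse_row a0 p (Suc (2 * t)) = (if t < a0 \<or> p (2 * t) = p (Suc (2 * t)) then p (Suc (2 * t)) else p (Suc (2 * t)) + 1)"
    "dual_row a0 p (2 * t) = (if t < a0 \<or> p (2 * t) \<noteq> p (Suc (2 * t)) then 2 * t else Suc (2 * t))"
    "dual_row a0 p (Suc (2 * t)) = (if t < a0 \<or> p (2 * t) \<noteq> p (Suc (2 * t)) then Suc (2 * t) else 2 * t)"
    by (simp_all add: collapse_row_def dual_row_def partner_def eq_commute[of "p (Suc (2 * t))"])
qed

lemma row_length_antimono: "antimono (row_length a0 bs)"
proof (rule antimonoI)
  fix x y :: nat assume "x \<le> y"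
  thus "row_length a0 bs y \<le> row_length a0 bs x"
    using antimonoD[OF col_count_antimono, of x y bs] by (auto simp: row_length_def)
qed

lemma row_length_Cons: "row_length a0 (b # bs) r = (if r < b then 2 else 0) + row_length a0 bs r"
  by (simp add: row_length_def)

text \<open>Adjoining two columns of length b: the pair of chains cut by the end of the columns, if any, is
  (b - 1, b) with b odd.\<close>

lemma collapse_row_Cons:
  fixes a0 b bs
  defines "p \<equiv> row_length a0 bs" and "p' \<equiv> row_length a0 (b # bs)"
  shows "collapse_row a0 p' c = collapse_row a0 p c + (if c < b then 1 else 0) + (if dual_row a0 p c < b then 1 else 0)"
    and "dual_row a0 p' c = (if odd b \<and> 2 * a0 < b \<and> p (b - 1) = p b \<and> (c = b - 1 \<or> c = b) then c else dual_row a0 p c)"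
proof -
  define t where "t = c div 2"
  have c: "c = 2 * t \<or> c = Suc (2 * t)" by (auto simp: t_def)
  have le: "p (Suc (2 * t)) \<le> p (2 * t)" unfolding p_def by (rule antimonoD[OF row_length_antimono]) simp
  have p': "p' r = (if r < b then 2 else 0) + p r" for r by (simp add: p_def p'_def row_length_Cons)
  show "collapse_row a0 p' c = collapse_row a0 p c + (if c < b then 1 else 0) + (if dual_row a0 p c < b then 1 else 0)"
  proof -
    \<comment> \<open>Only in the middle case do the new columns end between the two rows. An equal
      pair (a, a) below the first 2 * a0 rows then becomes (a + 2, a), with collapse (a + 1, a + 1):
      one chain gains a start, the other an end.\<close>
    consider "b \<le> 2 * t" | "b = Suc (2 * t)" | "Suc (2 * t) < b" by linarith
    thus ?thesis
    proof cases
      case 1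
      hence "p' (2 * t) = p (2 * t)" "p' (Suc (2 * t)) = p (Suc (2 * t))" using p' by auto
      thus ?thesis using c 1 by (elim disjE) (simp_all add: row_pair)
    next
      case 2
      hence "p' (2 * t) = p (2 * t) + 2" "p' (Suc (2 * t)) = p (Suc (2 * t))" using p' by auto
      thus ?thesis using c 2 le by (elim disjE) (simp_all add: row_pair)
    next
      case 3
      hence "p' (2 * t) = p (2 * t) + 2" "p' (Suc (2 * t)) = p (Suc (2 * t)) + 2" using p' by auto
      thus ?thesis using c 3 le by (elim disjE) (simp_all add: row_pair)
    qed
  qed
  show "dual_row a0 p' c = (if odd b \<and> 2 * a0 < b \<and> p (b - 1) = p b \<and> (c = b - 1 \<or> c = b) then c else dual_row a0 p c)"
  proof -
    consider "b \<le> 2 * t" | "b = Suc (2 * t)" | "Suc (2 * t) < b" by linarith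
    thus ?thesis
    proof cases
      case 1
      hence "p' (2 * t) = p (2 * t)" "p' (Suc (2 * t)) = p (Suc (2 * t))" using p' by auto
      moreover have "b < 2 * t" if "odd b" using 1 that by (cases "b = 2 * t") auto
      hence "\<not> (odd b \<and> (c = b - 1 \<or> c = b))" using c by linarith
      ultimately show ?thesis using c by (elim disjE) (simp_all add: row_pair)
    next
      case 2
      hence "p' (2 * t) = p (2 * t) + 2" "p' (Suc (2 * t)) = p (Suc (2 * t))" using p' by auto
      thus ?thesis using c 2 le by (elim disjE) (auto simp: row_pair)
    next
      case 3
      hence "p' (2 * t) = p (2 * t) + 2" "p' (Suc (2 * t)) = p (Suc (2 * t)) + 2" using p' by auto
      moreover have "Suc (2 * t) < b - 1" if "odd b" using 3 that by (cases "b = Suc (Suc (2 * t))") auto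
      hence "\<not> (odd b \<and> (c = b - 1 \<or> c = b))" using c 3 by linarith
      ultimately show ?thesis using c by (elim disjE) (simp_all add: row_pair)
    qed
  qed
qed

section \<open>Construction of chain systems from the inside outwards\<close>

context graded_form
begin

text \<open>On level 0 the element is 0 and each chain is a single vector dual to itself. The given
  basis vectors are isotropic, so the sums and differences of dual ones are taken, with norms 2 and
  -2. All other chains are empty; their constants 1 and -1 satisfy the sign rule for dual pairs of
  length 0.\<close>

lemma chain_system_base:
  assumes e: "inj_on e {..<a0}" and eN: "\<And>c. c < a0 \<Longrightarrow> e c < N" and e0: "\<And>c. c < a0 \<Longrightarrow> L (e c) = 0"
    and ne: "\<And>c d. c < a0 \<Longrightarrow> d < a0 \<Longrightarrow> e c \<noteq> \<sigma> (e d)"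
  shows "\<exists>X x s. chain_system N \<sigma> L 0 X x (collapse_row a0 (row_length a0 [])) (dual_row a0 (row_length a0 [])) s"
proof -
  let ?E = "\<lambda>c. unit (e (c div 2))" and ?F = "\<lambda>c. unit (\<sigma> (e (c div 2)))"
  define x where "x c i = (if even c then (\<lambda>z. ?E c z + ?F c z) else (\<lambda>z. ?E c z - ?F c z))" for c i :: nat
  define g where "g c = (if c < 2 * a0 then 1 else 0 :: nat)" for c
  define \<delta> where "\<delta> c = (if c < 2 * a0 then c else partner c)" for c
  define s where "s c = (if c < 2 * a0 then (if even c then 2 else - 2) else (if even c then 1 else - 1 :: complex))" for c
  have EE: "bform (?E c) (?E d) = 0" "bform (?F c) (?F d) = 0"
    "bform (?E c) (?F d) = (if c div 2 = d div 2 then 1 else 0)"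
    "bform (?F c) (?E d) = (if c div 2 = d div 2 then 1 else 0)" if "c < 2 * a0" "d < 2 * a0" for c d
  proof -
    have m: "c div 2 < a0" "d div 2 < a0" using that by auto
    note eq = inj_on_eq_iff[OF e] 
    show "bform (?E c) (?E d) = 0" using ne[OF m(2,1)] eN[OF m(1)] by (subst bform_unit_left) (auto simp: unit_def)
    show "bform (?F c) (?F d) = 0" using ne[OF m(1,2)] eN[OF m(1)]
      by (subst bform_unit_left) (auto simp: unit_def \<sigma>_less \<sigma>_\<sigma>)
    have "\<sigma> (e (c div 2)) = \<sigma> (e (d div 2)) \<longleftrightarrow> e (c div 2) = e (d div 2)" using \<sigma>_\<sigma> eN m by metis
    thus 1: "bform (?E c) (?F d) = (if c div 2 = d div 2 then 1 else 0)"
      using eN[OF m(1)] eq[of "c div 2" "d div 2"] m by (subst bform_unit_left) (auto simp: unit_def)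
    show "bform (?F c) (?E d) = (if c div 2 = d div 2 then 1 else 0)"
      using eN[OF m(1)] eq[of "c div 2" "d div 2"] m
      by (subst bform_unit_left) (auto simp: unit_def \<sigma>_less \<sigma>_\<sigma>)
  qed
  have div_eq: "c = d" if "c div 2 = d div 2" "even c = even d" for c d :: nat
    using that by presburger
  have "chain_system N \<sigma> L 0 (\<lambda>_ _. 0) x g \<delta> s"
  proof unfold_locales
    show "z < N \<and> \<bar>L z\<bar> \<le> 0" if "i < g c" "x c i z \<noteq> 0" for c i z
    proof -
      have "c div 2 < a0" using that by (auto simp: g_def split: if_splits)
      moreover have "z = e (c div 2) \<or> z = \<sigma> (e (c div 2))" using that by (auto simp: x_def unit_def split: if_splits)
      ultimately show ?thesis using eN e0 \<sigma>_less L_\<sigma> by fastforce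
    qed
    show "\<delta> (\<delta> c) = c" for c by (simp add: \<delta>_def)
    show "g (\<delta> c) = g c" for c by (simp add: \<delta>_def g_def)
    show "s c \<noteq> 0" for c by (simp add: s_def)
    show "s (\<delta> c) = - ((-1) ^ g c * s c)" for c by (simp add: \<delta>_def g_def s_def)
    show "bform (x c i) (x d j) = (if d = \<delta> c \<and> Suc (i + j) = g c then (-1) ^ i * s c else 0)"
      if "i < g c" "j < g d" for c d i j
    proof -
      have "c < 2 * a0" "d < 2 * a0" "i = 0" "j = 0" using that by (auto simp: g_def split: if_splits)
      thus ?thesis using div_eq[of c d]
        by (cases "even c"; cases "even d")
          (auto simp: x_def g_def \<delta>_def s_def bform_add_left bform_add_right bform_diff_left bform_diff_right EE)
    qed
  qed (auto simp: g_def)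
  moreover have "g = collapse_row a0 (row_length a0 [])"
  proof
    fix c :: nat
    define t where "t = c div 2"
    have "c = 2 * t \<or> c = Suc (2 * t)" by (auto simp: t_def)
    moreover have "Suc (2 * t) < 2 * a0 \<longleftrightarrow> t < a0" by presburger
    ultimately show "g c = collapse_row a0 (row_length a0 []) c"
      by (elim disjE) (simp_all add: g_def row_pair row_length_def)
  qed
  moreover have "\<delta> = dual_row a0 (row_length a0 [])"
    by (simp add: \<delta>_def dual_row_def row_length_def fun_eq_iff)
  ultimately show ?thesis by blast
qed

text \<open>The extension by one level keeps the old duality, whereas \<open>dual_row\<close>
  changes at a pair of equal even rows cut by the new columns. That pair has become odd, so
  \<open>chain_system_convert\<close> applies to it.\<close>

lemma chain_system_step:
  assumes cs: "chain_system N \<sigma> L (int l) X x (collapse_row a0 (row_length a0 bs)) (dual_row a0 (row_length a0 bs)) s"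
  defines "b \<equiv> card {a. a < N \<and> L a = int (Suc l)}"
  shows "\<exists>X x s. chain_system N \<sigma> L (int (Suc l)) X x
     (collapse_row a0 (row_length a0 (b # bs))) (dual_row a0 (row_length a0 (b # bs))) s"
proof -
  let ?p = "row_length a0 bs" and ?p' = "row_length a0 (b # bs)"
  let ?\<delta> = "dual_row a0 ?p"
  obtain e where e: "bij_betw e {0..<b} {a. a < N \<and> L a = int (Suc l)}"
    unfolding b_def using ex_bij_betw_nat_finite[of "{a. a < N \<and> L a = int (Suc l)}"] by auto
  interpret chain_system N \<sigma> L "int l" X x "collapse_row a0 ?p" ?\<delta> s by (rule cs)
  interpret chain_extension N \<sigma> L "int l" X x "collapse_row a0 ?p" ?\<delta> s e b
  proof unfold_locales
    show "inj_on e {..<b}" using e by (auto simp: bij_betw_def lessThan_atLeast0)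
    show "e c < N" "L (e c) = int l + 1" if "c < b" for c
      using bij_betwE[OF e, rule_format, of c] that by auto
  qed simp
  have g': "g' = collapse_row a0 ?p'"
    unfolding g'_def fun_eq_iff using collapse_row_Cons(1)[of a0 b bs] by simp
  have l: "int l + 1 = int (Suc l)" by simp
  note ext = chain_system_extend[unfolded l g']
  show ?thesis
  proof (cases "odd b \<and> 2 * a0 < b \<and> ?p (b - 1) = ?p b")
    case False
    hence "dual_row a0 ?p' = ?\<delta>" using collapse_row_Cons(2)[of a0 b bs] by (auto simp: fun_eq_iff)
    thus ?thesis using ext by metis
  next
    case True
    interpret ext: chain_system N \<sigma> L "int (Suc l)" X' x' "collapse_row a0 ?p'" ?\<delta> s' by (rule ext)
    define c0 where "c0 = b - 1"
    have c0: "even c0" "b = Suc c0" "2 * a0 \<le> c0" "?p c0 = ?p (Suc c0)"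
      using True by (auto simp: c0_def)
    have d0: "?\<delta> c0 = Suc c0" using c0 by (auto simp: dual_row_def partner_def)
    have "odd (collapse_row a0 ?p' c0)"
      using c0 unfolding collapse_row_def by (simp add: row_length_Cons) (simp add: row_length_def)
    from ext.chain_system_convert[OF _ this] d0
    have "\<exists>x s. chain_system N \<sigma> L (int (Suc l)) X' x (collapse_row a0 ?p') (?\<delta>(c0 := c0, Suc c0 := Suc c0)) s"
      by auto
    moreover have "?\<delta>(c0 := c0, Suc c0 := Suc c0) = dual_row a0 ?p'"
      using collapse_row_Cons(2)[of a0 b bs] True c0 by (auto simp: fun_eq_iff)
    ultimately show ?thesis by metis
  qed
qed

lemma chain_system_exists:
  assumes "inj_on e {..<a0}" "\<And>c. c < a0 \<Longrightarrow> e c < N" "\<And>c. c < a0 \<Longrightarrow> L (e c) = 0"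
    and "\<And>c d. c < a0 \<Longrightarrow> d < a0 \<Longrightarrow> e c \<noteq> \<sigma> (e d)"
  defines "bs \<equiv> \<lambda>l. map (\<lambda>j. card {a. a < N \<and> L a = int j}) (rev [1..<Suc l])"
  shows "\<exists>X x s. chain_system N \<sigma> L (int l) X x
     (collapse_row a0 (row_length a0 (bs l))) (dual_row a0 (row_length a0 (bs l))) s"
proof (induction l)
  case 0
  then show ?case using chain_system_base[OF assms(1-4)] by (simp add: bs_def)
next
  case (Suc l)
  then obtain X x s where "chain_system N \<sigma> L (int l) X x
     (collapse_row a0 (row_length a0 (bs l))) (dual_row a0 (row_length a0 (bs l))) s" by blast
  from chain_system_step[OF this] show ?case by (simp add: bs_def)
qed

end

section \<open>Ranks of powers read off from the chains\<close>

context chain_system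
begin

definition X_mat :: "complex mat" where
  "X_mat = mat N N (\<lambda>(a,b). X (unit b) a)"

lemma X_mat_carrier: "X_mat \<in> carrier_mat N N"
  by (simp add: X_mat_def)

lemma X_mat_mult: "X_mat * mat N r (\<lambda>(a,q). V q a) = mat N r (\<lambda>(a,q). X (V q) a)"
proof (rule eq_matI)
  fix a q assume "a < dim_row (mat N r (\<lambda>(a,q). X (V q) a))" "q < dim_col (mat N r (\<lambda>(a,q). X (V q) a))"
  hence aq: "a < N" "q < r" by auto
  hence "(X_mat * mat N r (\<lambda>(a,q). V q a)) $$ (a,q) = (\<Sum>k = 0..<N. X_mat $$ (a,k) * mat N r (\<lambda>(a,q). V q a) $$ (k,q))"
    by (intro mult_mat_index) (auto simp: X_mat_def)
  also have "\<dots> = (\<Sum>k<N. X (unit k) a * V q k)"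
    using aq by (intro sum.cong) (auto simp: X_mat_def)
  also have "\<dots> = X (V q) a" by (rule X_eq_sum[OF aq(1), symmetric])
  finally show "(X_mat * mat N r (\<lambda>(a,q). V q a)) $$ (a,q) = mat N r (\<lambda>(a,q). X (V q) a) $$ (a,q)"
    using aq by simp
qed (auto simp: X_mat_def)

lemma X_mat_pow_mult: "X_mat ^\<^sub>m i * mat N r (\<lambda>(a,q). V q a) = mat N r (\<lambda>(a,q). (X ^^ i) (V q) a)"
proof (induction i arbitrary: V)
  case 0
  then show ?case by (simp add: X_mat_def)
next
  case (Suc i)
  have "X_mat ^\<^sub>m Suc i * mat N r (\<lambda>(a,q). V q a) = X_mat ^\<^sub>m i * (X_mat * mat N r (\<lambda>(a,q). V q a))"
    using assoc_mult_mat[OF pow_carrier_mat[OF X_mat_carrier] X_mat_carrier, of "mat N r (\<lambda>(a,q). V q a)" r i] by simp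
  also have "\<dots> = mat N r (\<lambda>(a,q). (X ^^ i) (X (V q)) a)" unfolding X_mat_mult by (rule Suc)
  finally show ?case by (simp add: funpow_swap1)
qed

lemma X_funpow_chain: "j + i < g c \<Longrightarrow> (X ^^ i) (x c j) = x c (j + i)"
  by (induction i) (auto simp: chain)

text \<open>\<open>X_mat ^\<^sub>m i\<close> is tested on the chain vectors that survive i steps,
  and the images are paired with their partners in the dual chains. The resulting matrix is diagonal
  with entries \<plusminus> \<open>s c\<close>.\<close>

lemma rank_ge_X_mat_pow: "rank_ge (X_mat ^\<^sub>m i) (\<Sum>c<M. g c - i)"
proof -
  define I where "I = (SIGMA c : {..<M}. {..<g c - i})"
  define r where "r = (\<Sum>c<M. g c - i)"
  have "card I = r" by (simp add: I_def r_def)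
  then obtain h where h: "bij_betw h {0..<r} I"
    using ex_bij_betw_nat_finite[of I] by (auto simp: I_def)
  define V where "V q = x (fst (h q)) (snd (h q))" for q
  \<comment> \<open>The position is the one that satisfies the index condition of
    \<open>gram\<close> against the image at position \<open>snd (h q) + i\<close>. In
    \<open>?P\<close> the argument \<open>\<sigma> a\<close> makes multiplication by a row an
    application of the form.\<close>
  define W where "W q = x (\<delta> (fst (h q))) (g (fst (h q)) - 1 - (snd (h q) + i))" for q
  let ?Q = "mat N r (\<lambda>(a,q). V q a)" and ?P = "mat r N (\<lambda>(q,a). W q (\<sigma> a))"
  have hI: "snd (h q) + i < g (fst (h q))" if "q < r" for q
  proof -
    have "h q \<in> I" using bij_betwE[OF h] that by auto
    thus ?thesis by (auto simp: I_def)
  qed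
  have entry: "(?P * (X_mat ^\<^sub>m i * ?Q)) $$ (p,q) = (if p = q then (-1) ^ (snd (h q) + i) * s (fst (h q)) else 0)"
    if pq: "p < r" "q < r" for p q
  proof -
    obtain c j c' j' where hc: "h q = (c,j)" "h p = (c',j')" by fastforce
    have lt: "j + i < g c" "j' + i < g c'" using hI[OF pq(2)] hI[OF pq(1)] hc by auto
    have "(?P * (X_mat ^\<^sub>m i * ?Q)) $$ (p,q) = (\<Sum>a = 0..<N. ?P $$ (p,a) * (X_mat ^\<^sub>m i * ?Q) $$ (a,q))"
      using pq pow_carrier_mat[OF X_mat_carrier, of i] by (intro mult_mat_index) auto
    also have "\<dots> = (\<Sum>a<N. (X ^^ i) (V q) a * W p (\<sigma> a))"
      using pq by (intro sum.cong) (auto simp: X_mat_pow_mult)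
    also have "\<dots> = bform (x c (j + i)) (x (\<delta> c') (g c' - 1 - (j' + i)))"
      using lt by (simp add: bform_def V_def W_def hc X_funpow_chain)
    also have "\<dots> = (if \<delta> c' = \<delta> c \<and> Suc ((j + i) + (g c' - 1 - (j' + i))) = g c then (-1) ^ (j + i) * s c else 0)"
      using lt g_dual[of c'] by (intro gram) auto
    also have "\<delta> c' = \<delta> c \<and> Suc ((j + i) + (g c' - 1 - (j' + i))) = g c \<longleftrightarrow> c' = c \<and> j' = j"
      using lt dual_dual[of c] dual_dual[of c'] by auto
    also have "\<dots> \<longleftrightarrow> p = q"
      using hc inj_on_eq_iff[OF bij_betw_imp_inj_on[OF h], of p q] pq by auto
    finally show ?thesis by (simp add: hc)
  qed
  let ?D = "?P * (X_mat ^\<^sub>m i * ?Q)"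
  have D: "?D \<in> carrier_mat r r" using pow_carrier_mat[OF X_mat_carrier, of i] by auto
  have "det ?D = prod_list (diag_mat ?D)"
    by (rule det_upper_triangular[OF _ D]) (use D in \<open>auto simp del: index_mult_mat simp: entry upper_triangular_def\<close>)
  also have "\<dots> \<noteq> 0"
    using D s_nonzero by (auto simp del: index_mult_mat simp: diag_mat_def entry prod_list_zero_iff)
  finally have "det (?P * X_mat ^\<^sub>m i * ?Q) \<noteq> 0"
    using assoc_mult_mat[of ?P r N "X_mat ^\<^sub>m i" N ?Q r] pow_carrier_mat[OF X_mat_carrier, of i] by simp
  thus ?thesis unfolding r_def[symmetric]
    by (intro rank_geI[of ?P r N ?Q N]) (auto intro: pow_carrier_mat X_mat_carrier)
qed

end

section \<open>Jordan types of nilpotent matrices\<close>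

lemma block_diag_commute:
  fixes A D :: "'a :: comm_ring_1 mat"
  assumes A: "A \<in> carrier_mat n n" and D: "D \<in> carrier_mat m m"
  shows "similar_mat (four_block_mat A (0\<^sub>m n m) (0\<^sub>m m n) D) (four_block_mat D (0\<^sub>m m n) (0\<^sub>m n m) A)"
proof (rule similar_matI)
  let ?P = "four_block_mat (0\<^sub>m n m) (1\<^sub>m n) (1\<^sub>m m) (0\<^sub>m m n) :: 'a mat"
  let ?Q = "four_block_mat (0\<^sub>m m n) (1\<^sub>m m) (1\<^sub>m n) (0\<^sub>m n m) :: 'a mat"
  let ?A = "four_block_mat A (0\<^sub>m n m) (0\<^sub>m m n) D" and ?D = "four_block_mat D (0\<^sub>m m n) (0\<^sub>m n m) A"
  show "{?A, ?D, ?P, ?Q} \<subseteq> carrier_mat (n + m) (n + m)"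
    using A D by (auto simp: add.commute)
  have "?P * ?Q = four_block_mat (1\<^sub>m n) (0\<^sub>m n m) (0\<^sub>m m n) (1\<^sub>m m)"
    by (subst mult_four_block_mat[of _ n m _ n _ m _ _ n _ m]) auto
  thus "?P * ?Q = 1\<^sub>m (n + m)" by (simp add: four_block_one_mat)
  have "?Q * ?P = four_block_mat (1\<^sub>m m) (0\<^sub>m m n) (0\<^sub>m n m) (1\<^sub>m n)"
    by (subst mult_four_block_mat[of _ m n _ m _ n _ _ m _ n]) auto
  thus "?Q * ?P = 1\<^sub>m (n + m)" by (simp add: four_block_one_mat add.commute)
  have "?P * ?D = four_block_mat (0\<^sub>m n m) A D (0\<^sub>m m n)"
    using A D by (subst mult_four_block_mat[of _ n m _ n _ m _ _ m _ n]) auto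
  moreover have "four_block_mat (0\<^sub>m n m) A D (0\<^sub>m m n) * ?Q = ?A"
    using A D by (subst mult_four_block_mat[of _ n m _ n _ m _ _ n _ m]) auto
  ultimately show "?A = ?P * ?D * ?Q" by simp
qed

lemma jordan_matrix_Cons_nil: "jordan_matrix (map (\<lambda>r. (r, 0 :: complex)) (x # d)) =
     four_block_mat (jordan_block x 0) (0\<^sub>m x (sum_list d)) (0\<^sub>m (sum_list d) x) (jordan_matrix (map (\<lambda>r. (r, 0)) d))"
  by (simp add: jordan_matrix_Cons comp_def)

lemma jordan_matrix_append_nil: "jordan_matrix (map (\<lambda>r. (r, 0 :: complex)) (xs @ ys)) =
     four_block_mat (jordan_matrix (map (\<lambda>r. (r, 0)) xs)) (0\<^sub>m (sum_list xs) (sum_list ys))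
       (0\<^sub>m (sum_list ys) (sum_list xs)) (jordan_matrix (map (\<lambda>r. (r, 0)) ys))"
  using jordan_matrix_dim[of "map (\<lambda>r. (r, 0 :: complex)) xs"] jordan_matrix_dim[of "map (\<lambda>r. (r, 0 :: complex)) ys"]
  unfolding jordan_matrix_def map_append diag_block_mat_append Let_def by (simp add: comp_def)

text \<open>A Jordan form comes with its blocks in some order, whereas a partition lists them in
  descending order.\<close>

lemma similar_jordan_matrix_perm:
  assumes "mset xs = mset ys"
  shows "similar_mat (jordan_matrix (map (\<lambda>r. (r, 0 :: complex)) xs)) (jordan_matrix (map (\<lambda>r. (r, 0)) ys))"
  using assms
proof (induction xs arbitrary: ys)
  case Nil
  then show ?case by (auto intro!: similar_mat_refl[of _ 0] simp: jordan_matrix_def)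
next
  case (Cons x xs)
  let ?J = "\<lambda>d. jordan_matrix (map (\<lambda>r. (r, 0 :: complex)) d)"
  have "x \<in> set ys" using Cons.prems by (metis list.set_intros(1) set_mset_mset)
  then obtain us vs where ys: "ys = us @ x # vs" by (auto simp: in_set_conv_decomp)
  have xs: "mset xs = mset (us @ vs)" using Cons.prems by (simp add: ys)
  hence len: "sum_list xs = sum_list (us @ vs)" by (metis sum_mset_sum_list)
  have 1: "similar_mat (?J (x # xs)) (?J (x # us @ vs))"
    unfolding jordan_matrix_Cons_nil len
    using Cons.IH[OF xs] nilpotent_jordan_matrix_carrier[of xs] nilpotent_jordan_matrix_carrier[of "us @ vs"] len
    by (intro similar_mat_four_block_0_0) (auto intro: similar_mat_refl[OF jordan_block_carrier])
  have "similar_mat (?J ([x] @ us)) (?J (us @ [x]))"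
    unfolding jordan_matrix_append_nil by (rule block_diag_commute) (rule nilpotent_jordan_matrix_carrier)+
  moreover have "sum_list (us @ [x]) = sum_list ([x] @ us)" by simp
  ultimately have "similar_mat (?J (([x] @ us) @ vs)) (?J ((us @ [x]) @ vs))"
    unfolding jordan_matrix_append_nil[of _ vs]
    by (metis similar_mat_four_block_0_0 similar_mat_refl nilpotent_jordan_matrix_carrier)
  thus ?case using similar_mat_trans[OF 1] by (simp add: ys)
qed

lemma nilpotent_jordan_type:
  fixes X :: "complex mat"
  assumes X: "X \<in> carrier_mat m m" and nil: "X ^\<^sub>m r = 0\<^sub>m m m"
  obtains d where "is_partition m d" "jordan_nf X (map (\<lambda>r. (r, 0)) d)"
proof -
  obtain as where "char_poly X = (\<Prod>a\<leftarrow>as. [:- a, 1:])" using char_poly_factorized[OF X] by blast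
  from jordan_nf_exists[OF X this] obtain n_as where jnf: "jordan_nf X n_as" by blast
  have zero: "a = 0" if na: "(k, a) \<in> set n_as" for k a
  proof -
    have "k \<noteq> 0" using jnf na unfolding jordan_nf_def by force
    have "poly (char_poly X) a = 0"
      using na \<open>k \<noteq> 0\<close> unfolding jordan_nf_char_poly[OF jnf]
      by (force simp: poly_prod_list prod_list_zero_iff)
    hence "eigenvalue X a" by (simp add: eigenvalue_root_char_poly[OF X])
    then obtain v where v: "eigenvector X v a" by (auto simp: eigenvalue_def)
    have "X ^\<^sub>m r *\<^sub>v v = a ^ r \<cdot>\<^sub>v v" by (rule eigenvector_pow[OF X v])
    moreover have "v \<in> carrier_vec m" "v \<noteq> 0\<^sub>v m" using v X by (auto simp: eigenvector_def)
    moreover from this have "0\<^sub>m m m *\<^sub>v v = 0\<^sub>v m" by (intro eq_vecI) (auto simp: scalar_prod_def)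
    ultimately have "a ^ r \<cdot>\<^sub>v v = 0\<^sub>v m" by (simp add: nil)
    moreover from \<open>v \<in> carrier_vec m\<close> \<open>v \<noteq> 0\<^sub>v m\<close> obtain i where "i < m" "v $ i \<noteq> 0"
      by (metis carrier_vecD eq_vecI index_zero_vec(1) index_zero_vec(2))
    ultimately have "a ^ r * v $ i = 0" using \<open>v \<in> carrier_vec m\<close>
      by (metis carrier_vecD index_smult_vec(1) index_zero_vec(1))
    thus "a = 0" using \<open>v $ i \<noteq> 0\<close> by simp
  qed
  let ?e = "map fst n_as"
  have n_as: "n_as = map (\<lambda>r. (r, 0)) ?e"
  proof -
    have "map (\<lambda>z. (fst z, 0)) n_as = n_as" by (rule map_idI) (auto dest: zero)
    thus ?thesis by (simp add: comp_def)
  qed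
  define d where "d = rev (sort ?e)"
  have md: "mset d = mset ?e" by (simp add: d_def)
  have "sorted_wrt (\<ge>) d" unfolding d_def sorted_wrt_rev by simp
  moreover have z: "0 \<notin> set d" using jnf by (simp add: d_def jordan_nf_def)
  moreover have "sum_list d = m"
  proof -
    have sim: "similar_mat X (jordan_matrix n_as)" using jnf by (simp add: jordan_nf_def)
    obtain k where "X \<in> carrier_mat k k" "jordan_matrix n_as \<in> carrier_mat k k"
      using similar_matD[OF sim] by blast
    hence "dim_row X = dim_row (jordan_matrix n_as)" by (metis carrier_matD(1))
    hence "m = sum_list ?e" using X by simp
    also have "\<dots> = sum_list d" using md by (metis sum_mset_sum_list)
    finally show ?thesis ..
  qed
  ultimately have "is_partition m d" by (simp add: is_partition_def)
  moreover have "jordan_nf X (map (\<lambda>r. (r, 0)) d)"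
  proof -
    have "similar_mat X (jordan_matrix (map (\<lambda>r. (r, 0)) ?e))" using jnf n_as by (simp add: jordan_nf_def)
    from similar_mat_trans[OF this similar_jordan_matrix_perm[OF md[symmetric]]]
    show ?thesis using z by (auto simp: jordan_nf_def)
  qed
  ultimately show ?thesis by (rule that)
qed

section \<open>Semicontinuity of the rank\<close>

lemma continuous_map_mult:
  fixes f g :: "'a \<Rightarrow> 'b :: real_normed_algebra"
  assumes "continuous_map T euclidean f" "continuous_map T euclidean g"
  shows "continuous_map T euclidean (\<lambda>x. f x * g x)"
  using assms by (simp add: continuous_map_atin tendsto_mult)

lemma continuous_map_prod_field:
  fixes f :: "'a \<Rightarrow> 'i \<Rightarrow> 'b :: real_normed_field"
  assumes "\<And>i. i \<in> I \<Longrightarrow> continuous_map T euclidean (\<lambda>x. f x i)"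
  shows "continuous_map T euclidean (\<lambda>x. prod (f x) I)"
  using assms by (simp add: continuous_map_atin tendsto_prod)

lemma continuous_map_entry:
  assumes "i < m" "j < m"
  shows "continuous_map (mat_topology m) euclidean (\<lambda>A. A $$ (i,j))"
proof -
  let ?f = "\<lambda>A :: complex mat. restrict (\<lambda>ij. A $$ ij) ({..<m} \<times> {..<m})"
  have "continuous_map (product_topology (\<lambda>_. euclidean) ({..<m} \<times> {..<m})) euclidean (\<lambda>x. x (i,j))"
    using assms by (intro continuous_map_product_projection) auto
  from continuous_map_pullback[OF this, of "carrier_mat m m" ?f]
  show ?thesis using assms unfolding mat_topology_def by (simp add: comp_def)
qed

lemma topspace_mat_topology: "topspace (mat_topology m) = carrier_mat m m"
  unfolding mat_topology_def topspace_pullback_topology by auto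

definition continuous_mat :: "'x topology \<Rightarrow> ('x \<Rightarrow> complex mat) \<Rightarrow> nat \<Rightarrow> nat \<Rightarrow> bool" where
  "continuous_mat T F r c \<longleftrightarrow> (\<forall>x \<in> topspace T. F x \<in> carrier_mat r c) \<and>
     (\<forall>i<r. \<forall>j<c. continuous_map T euclidean (\<lambda>x. F x $$ (i,j)))"

lemma continuous_mat_const: "A \<in> carrier_mat r c \<Longrightarrow> continuous_mat T (\<lambda>_. A) r c"
  by (simp add: continuous_mat_def)

lemma continuous_mat_mult:
  assumes "continuous_mat T F r k" "continuous_mat T G k c"
  shows "continuous_mat T (\<lambda>x. F x * G x) r c"
  unfolding continuous_mat_def
proof (intro conjI ballI allI impI)
  show "F x * G x \<in> carrier_mat r c" if "x \<in> topspace T" for x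
    using that assms by (auto simp: continuous_mat_def)
  fix i j assume ij: "i < r" "j < c"
  have "continuous_map T euclidean (\<lambda>x. \<Sum>l = 0..<k. F x $$ (i,l) * G x $$ (l,j))"
    using assms ij by (intro continuous_map_sum continuous_map_mult) (auto simp: continuous_mat_def)
  moreover have "(F x * G x) $$ (i,j) = (\<Sum>l = 0..<k. F x $$ (i,l) * G x $$ (l,j))" if "x \<in> topspace T" for x
    using that assms ij by (intro mult_mat_index) (auto simp: continuous_mat_def)
  ultimately show "continuous_map T euclidean (\<lambda>x. (F x * G x) $$ (i,j))"
    by (rule continuous_map_eq[OF _ sym])
qed

lemma continuous_mat_pow:
  assumes "continuous_mat T F r r"
  shows "continuous_mat T (\<lambda>x. F x ^\<^sub>m i) r r"
proof (induction i)
  case 0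
  have "continuous_mat T (\<lambda>x. 1\<^sub>m r) r r" by (rule continuous_mat_const) simp
  moreover have "F x ^\<^sub>m 0 = 1\<^sub>m r" if "x \<in> topspace T" for x
    using assms that by (auto simp: continuous_mat_def)
  moreover have "continuous_map T euclidean (\<lambda>x. (F x ^\<^sub>m 0) $$ (i, j))" if "i < r" "j < r" for i j
    by (rule continuous_map_eq[of _ _ "\<lambda>x. 1\<^sub>m r $$ (i, j)"]) (simp_all add: calculation(2) del: pow_mat.simps)
  ultimately show ?case unfolding continuous_mat_def by simp
next
  case (Suc i)
  show ?case using continuous_mat_mult[OF Suc assms] by simp
qed

lemma continuous_map_det:
  assumes "continuous_mat T F r r"
  shows "continuous_map T euclidean (\<lambda>x. det (F x))"
proof (rule continuous_map_eq)
  show "continuous_map T euclidean (\<lambda>x. \<Sum>p \<in> {p. p permutes {0..<r}}. signof p * (\<Prod>i = 0..<r. F x $$ (i, p i)))"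
  proof (intro continuous_map_sum continuous_map_mult continuous_map_prod_field)
    show "continuous_map T euclidean (\<lambda>x. F x $$ (i, p i))" if "p \<in> {p. p permutes {0..<r}}" "i \<in> {0..<r}" for p i
    proof -
      have "p i < r" using that permutes_in_image[of p "{0..<r}" i] by auto
      thus ?thesis using assms that by (auto simp: continuous_mat_def)
    qed
  qed (auto simp: finite_permutations)
  show "(\<Sum>p \<in> {p. p permutes {0..<r}}. signof p * (\<Prod>i = 0..<r. F x $$ (i, p i))) = det (F x)"
    if "x \<in> topspace T" for x
    using assms that by (subst det_def') (auto simp: continuous_mat_def)
qed

text \<open>For fixed P and Q the determinant is a continuous function of Y, so its nonvanishing
  defines a neighbourhood of X0, which meets S.\<close>

lemma rank_ge_near:
  assumes cl: "X0 \<in> subtopology (mat_topology m) u closure_of S"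
    and rank: "rank_ge (X0 ^\<^sub>m i) r"
  shows "\<exists>Y \<in> S. Y \<in> u \<and> rank_ge (Y ^\<^sub>m i) r"
proof -
  let ?T = "subtopology (mat_topology m) u"
  have X0: "X0 \<in> topspace ?T" using cl by (simp add: in_closure_of)
  hence X0c: "X0 \<in> carrier_mat m m" by (simp add: topspace_mat_topology)
  note X0i = pow_carrier_mat[OF X0c, of i]
  obtain P Q where P: "P \<in> carrier_mat r m" and Q: "Q \<in> carrier_mat m r" and d: "det (P * X0 ^\<^sub>m i * Q) \<noteq> 0"
    using rank X0i unfolding rank_ge_def carrier_matD[OF X0i] by blast
  have "continuous_mat (mat_topology m) (\<lambda>Y. Y) m m"
    by (simp add: continuous_mat_def topspace_mat_topology continuous_map_entry)
  hence "continuous_mat (mat_topology m) (\<lambda>Y. P * Y ^\<^sub>m i * Q) r r"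
    by (intro continuous_mat_mult[where k = m] continuous_mat_pow continuous_mat_const P Q)
  hence "continuous_map ?T euclidean (\<lambda>Y. det (P * Y ^\<^sub>m i * Q))"
    by (intro continuous_map_from_subtopology continuous_map_det)
  hence "openin ?T {Y \<in> topspace ?T. det (P * Y ^\<^sub>m i * Q) \<in> - {0}}" (is "openin ?T ?U")
    by (rule openin_continuous_map_preimage) auto
  moreover have "X0 \<in> ?U" using X0 d by simp
  ultimately have "\<exists>Y. Y \<in> S \<and> Y \<in> ?U"
    using cl[unfolded in_closure_of, THEN conjunct2, THEN spec[of _ ?U]] by (rule_tac mp) simp_all
  then obtain Y where "Y \<in> S" "Y \<in> ?U" by (elim exE conjE)
  hence Y: "Y \<in> S" "Y \<in> topspace ?T" "det (P * Y ^\<^sub>m i * Q) \<noteq> 0" by simp_all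
  hence Yc: "Y \<in> carrier_mat m m" "Y \<in> u" by (auto simp: topspace_mat_topology)
  have "rank_ge (Y ^\<^sub>m i) r" by (rule rank_geI[OF P Q pow_carrier_mat[OF Yc(1)] Y(3)])
  thus ?thesis using Y Yc by blast
qed

section \<open>Matrix entries of the orthogonal Lie algebra\<close>

definition dual_index :: "nat \<Rightarrow> nat \<Rightarrow> nat" where
  "dual_index n a = (if a < n then a + n else a - n)"

lemma dual_index_less: "a < 2 * n \<Longrightarrow> dual_index n a < 2 * n"
  and dual_index_dual_index: "a < 2 * n \<Longrightarrow> dual_index n (dual_index n a) = a"
  by (auto simp: dual_index_def)

lemma so_form_index:
  "a < 2 * n \<Longrightarrow> b < 2 * n \<Longrightarrow> so_form n $$ (a,b) = (if b = dual_index n a then 1 else 0)"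
  by (auto simp: so_form_def dual_index_def)

lemma so_form_carrier: "so_form n \<in> carrier_mat (2 * n) (2 * n)"
  unfolding so_form_def by (intro carrier_matI) auto

lemma mult_so_form_index:
  assumes A: "A \<in> carrier_mat (2 * n) (2 * n)" and ab: "a < 2 * n" "b < 2 * n"
  shows "(A * so_form n) $$ (a,b) = A $$ (a, dual_index n b)"
    and "(so_form n * A) $$ (a,b) = A $$ (dual_index n a, b)"
proof -
  have eq: "b = dual_index n k \<longleftrightarrow> k = dual_index n b" if "k < 2 * n" for k
    using that ab dual_index_dual_index by metis
  have "(A * so_form n) $$ (a,b) = (\<Sum>k = 0..<2 * n. A $$ (a,k) * so_form n $$ (k,b))"
    using ab by (intro mult_mat_index[OF A so_form_carrier])
  also have "\<dots> = (\<Sum>k = 0..<2 * n. if k = dual_index n b then A $$ (a,k) else 0)"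
    using ab eq by (intro sum.cong) (auto simp: so_form_index)
  finally show "(A * so_form n) $$ (a,b) = A $$ (a, dual_index n b)"
    using dual_index_less[OF ab(2)] by simp
  have "(so_form n * A) $$ (a,b) = (\<Sum>k = 0..<2 * n. so_form n $$ (a,k) * A $$ (k,b))"
    using ab by (intro mult_mat_index[OF so_form_carrier A])
  also have "\<dots> = (\<Sum>k = 0..<2 * n. if k = dual_index n a then A $$ (k,b) else 0)"
    using ab by (intro sum.cong) (auto simp: so_form_index)
  finally show "(so_form n * A) $$ (a,b) = A $$ (dual_index n a, b)"
    using dual_index_less[OF ab(1)] by simp
qed

lemma so_iff:
  "X \<in> so n \<longleftrightarrow> X \<in> carrier_mat (2 * n) (2 * n) \<and>
     (\<forall>a<2 * n. \<forall>b<2 * n. X $$ (dual_index n a, b) = - X $$ (dual_index n b, a))"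
proof (cases "X \<in> carrier_mat (2 * n) (2 * n)")
  case X: True
  let ?S = "transpose_mat X * so_form n + so_form n * X"
  have S: "?S $$ (a,b) = X $$ (dual_index n b, a) + X $$ (dual_index n a, b)" if "a < 2 * n" "b < 2 * n" for a b
  proof -
    have Xt: "transpose_mat X \<in> carrier_mat (2 * n) (2 * n)" using X by simp
    have "so_form n * X \<in> carrier_mat (2 * n) (2 * n)" by (rule mult_carrier_mat[OF so_form_carrier X])
    hence "?S $$ (a,b) = (transpose_mat X * so_form n) $$ (a,b) + (so_form n * X) $$ (a,b)"
      using that by (intro index_add_mat) auto
    also have "\<dots> = transpose_mat X $$ (a, dual_index n b) + X $$ (dual_index n a, b)"
      using mult_so_form_index(1)[OF Xt that] mult_so_form_index(2)[OF X that] by simp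
    finally show ?thesis using that X dual_index_less by simp
  qed
  have Sc: "?S \<in> carrier_mat (2 * n) (2 * n)" by (rule add_carrier_mat[OF mult_carrier_mat[OF so_form_carrier X]])
  have "?S = 0\<^sub>m (2 * n) (2 * n) \<longleftrightarrow> (\<forall>a<2 * n. \<forall>b<2 * n. ?S $$ (a,b) = 0)"
  proof
    assume "\<forall>a<2 * n. \<forall>b<2 * n. ?S $$ (a,b) = 0"
    thus "?S = 0\<^sub>m (2 * n) (2 * n)" using Sc by (intro eq_matI) auto
  qed simp
  also have "\<dots> \<longleftrightarrow> (\<forall>a<2 * n. \<forall>b<2 * n. X $$ (dual_index n a, b) = - X $$ (dual_index n b, a))"
    by (simp add: S eq_neg_iff_add_eq_0 add.commute)
  finally show ?thesis using X by (simp add: so_def)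
qed (simp add: so_def)

lemma so_carrier: "X \<in> so n \<Longrightarrow> X \<in> carrier_mat (2 * n) (2 * n)"
  by (simp add: so_def)

lemma so_entry_swap:
  "X \<in> so n \<Longrightarrow> a < 2 * n \<Longrightarrow> b < 2 * n \<Longrightarrow> X $$ (dual_index n a, b) = - X $$ (dual_index n b, a)"
  unfolding so_iff by blast

lemma so_entry:
  assumes "X \<in> so n" "a < 2 * n" "b < 2 * n"
  shows "X $$ (a,b) = - X $$ (dual_index n b, dual_index n a)"
  using assms dual_index_less[of a n] dual_index_dual_index[of a n] unfolding so_iff by metis

text \<open>The form matrix times X is skew and so has zero diagonal; in terms of roots,
  \<plusminus> 2 e_i is not a root. Comparisons of levels between dual indices are therefore
  immaterial.\<close>

lemma so_entry_dual:
  assumes "X \<in> so n" "a < 2 * n"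
  shows "X $$ (a, dual_index n a) = 0"
proof -
  have "X $$ (a, dual_index n a) = - X $$ (a, dual_index n a)"
    using so_entry[OF assms dual_index_less[OF assms(2)]] dual_index_dual_index[OF assms(2)] by metis
  thus ?thesis by simp
qed

lemma pow_mat_commute:
  assumes X: "X \<in> carrier_mat m m"
  shows "X * X ^\<^sub>m k = X ^\<^sub>m k * X"
proof (induction k)
  case (Suc k)
  have "X * X ^\<^sub>m Suc k = X * X ^\<^sub>m k * X"
    using assoc_mult_mat[OF X pow_carrier_mat[OF X] X, of k] by simp
  thus ?case unfolding Suc by simp
qed (use X in simp)

lemma even_rank_odd_pow_so:
  assumes X: "X \<in> so n" and "odd i" and "rank_le (X ^\<^sub>m i) r" "rank_ge (X ^\<^sub>m i) r"
  shows "even r"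
proof -
  let ?J = "so_form n" and ?N = "2 * n"
  note Xc = so_carrier[OF X] and J = so_form_carrier[of n]
  note Xi = pow_carrier_mat[OF Xc]
  have JJ: "?J * ?J = 1\<^sub>m ?N"
  proof (rule eq_matI)
    fix a b assume "a < dim_row (1\<^sub>m ?N :: complex mat)" "b < dim_col (1\<^sub>m ?N :: complex mat)"
    thus "(?J * ?J) $$ (a,b) = 1\<^sub>m ?N $$ (a,b)"
      using mult_so_form_index(2)[OF J, of a b]
      by (auto simp: so_form_index dual_index_less dual_index_dual_index)
  qed (use J in auto)
  have Xentry: "(X ^\<^sub>m k) $$ (dual_index n a, b) = (-1) ^ k * (X ^\<^sub>m k) $$ (dual_index n b, a)"
    if "a < ?N" "b < ?N" for k a b
    using that
  proof (induction k arbitrary: a b)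
    case 0
    have "dual_index n a = b \<longleftrightarrow> dual_index n b = a" using 0 dual_index_dual_index by metis
    thus ?case using 0 Xc by (simp add: dual_index_less)
  next
    case (Suc k)
    let ?d = "dual_index n"
    have "(X ^\<^sub>m Suc k) $$ (?d a, b) = (\<Sum>c = 0..<?N. (X ^\<^sub>m k) $$ (?d a, c) * X $$ (c, b))"
      using Suc.prems by (simp del: index_mult_mat) (intro mult_mat_index[OF Xi Xc] dual_index_less, auto)
    also have "\<dots> = (\<Sum>c = 0..<?N. (-1) ^ Suc k * (X $$ (?d b, ?d c) * (X ^\<^sub>m k) $$ (?d c, a)))"
    proof (rule sum.cong)
      fix c assume "c \<in> {0..<?N}"
      hence c: "c < ?N" by simp
      show "(X ^\<^sub>m k) $$ (?d a, c) * X $$ (c, b) = (-1) ^ Suc k * (X $$ (?d b, ?d c) * (X ^\<^sub>m k) $$ (?d c, a))"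
        using Suc.IH[OF Suc.prems(1) c] so_entry[OF X c Suc.prems(2)] by simp
    qed simp
    also have "\<dots> = (-1) ^ Suc k * (\<Sum>c = 0..<?N. X $$ (?d b, ?d c) * (X ^\<^sub>m k) $$ (?d c, a))"
      by (simp add: sum_distrib_left)
    also have "(\<Sum>c = 0..<?N. X $$ (?d b, ?d c) * (X ^\<^sub>m k) $$ (?d c, a)) =
        (\<Sum>c = 0..<?N. X $$ (?d b, c) * (X ^\<^sub>m k) $$ (c, a))"
      by (rule sum.reindex_bij_witness[of _ ?d ?d]) (auto simp: dual_index_less dual_index_dual_index)
    also have "\<dots> = (X * X ^\<^sub>m k) $$ (?d b, a)"
      using Suc.prems by (intro mult_mat_index[OF Xc Xi, symmetric] dual_index_less)
    also have "X * X ^\<^sub>m k = X ^\<^sub>m Suc k"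
      using pow_mat_commute[OF Xc] by simp
    finally show ?case .
  qed
  let ?A = "?J * X ^\<^sub>m i"
  have A: "?A \<in> carrier_mat ?N ?N" by (rule mult_carrier_mat[OF J Xi])
  have Ae: "?A $$ (a,b) = (X ^\<^sub>m i) $$ (dual_index n a, b)" if "a < ?N" "b < ?N" for a b
    by (rule mult_so_form_index(2)[OF Xi that])
  have "transpose_mat ?A = - ?A"
  proof (rule eq_matI)
    fix a b assume "a < dim_row (- ?A)" "b < dim_col (- ?A)"
    hence ab: "a < ?N" "b < ?N" using A by (auto simp del: index_mult_mat)
    have "transpose_mat ?A $$ (a,b) = ?A $$ (b,a)" using ab A by (intro index_transpose_mat) (auto simp del: index_mult_mat)
    also have "\<dots> = - ?A $$ (a,b)"
      unfolding Ae[OF ab] Ae[OF ab(2,1)] using Xentry[OF ab(2,1), of i] \<open>odd i\<close> by simp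
    also have "\<dots> = (- ?A) $$ (a,b)" using ab A by (intro index_uminus_mat(1)[symmetric]) (auto simp del: index_mult_mat)
    finally show "transpose_mat ?A $$ (a,b) = (- ?A) $$ (a,b)" .
  qed (use A in \<open>auto simp del: index_mult_mat\<close>)
  moreover have "rank_le ?A r" by (rule rank_le_mult_right[OF assms(3) Xi J])
  moreover have "rank_ge ?A r"
  proof -
    obtain P Q where P: "P \<in> carrier_mat r ?N" and Q: "Q \<in> carrier_mat ?N r" and d: "det (P * X ^\<^sub>m i * Q) \<noteq> 0"
      using assms(4) unfolding rank_ge_def carrier_matD[OF Xi] by blast
    have "P * ?J * ?A = P * (?J * ?J) * X ^\<^sub>m i"
      by (simp only: mat_assoc_dim index_mult_mat carrier_matD[OF P] carrier_matD[OF J] carrier_matD[OF Xi])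
    also have "\<dots> = P * X ^\<^sub>m i" using P by (simp add: JJ)
    finally show ?thesis using d P Q J A by (intro rank_geI[of "P * ?J" r ?N Q ?N]) auto
  qed
  ultimately show ?thesis using rank_even_if_skew[OF A] by blast
qed

section \<open>Root spaces\<close>

text \<open>The weight of the basis vector number a, with indices from 0 and coordinates from 1:
  e_(a+1) in the first half, -e_(a+1-n) in the second.\<close>

definition index_weight :: "nat \<Rightarrow> nat \<Rightarrow> nat \<Rightarrow> int" where
  "index_weight n a = (\<lambda>i. if a < n then (if i = a + 1 then 1 else 0) else (if i + n = a + 1 then - 1 else 0))"

lemma index_weight_outside: "a < 2 * n \<Longrightarrow> i \<notin> {1..n} \<Longrightarrow> index_weight n a i = 0"
  by (auto simp: index_weight_def)

lemma index_weight_dual: "a < 2 * n \<Longrightarrow> index_weight n (dual_index n a) i = - index_weight n a i"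
  by (auto simp: index_weight_def dual_index_def)

lemma diagonal_comm_index:
  assumes H: "H \<in> carrier_mat N N" "diagonal_mat H" and X: "X \<in> carrier_mat N N" and ab: "a < N" "b < N"
  shows "(H * X - X * H) $$ (a,b) = (H $$ (a,a) - H $$ (b,b)) * (X $$ (a,b) :: complex)"
proof -
  have H0: "H $$ (i,j) = 0" if "i < N" "j < N" "i \<noteq> j" for i j
    using H that by (auto simp: diagonal_mat_def)
  have "(H * X) $$ (a,b) = (\<Sum>k = 0..<N. H $$ (a,k) * X $$ (k,b))"
    by (rule mult_mat_index[OF H(1) X ab])
  also have "\<dots> = (\<Sum>k = 0..<N. if k = a then H $$ (a,a) * X $$ (a,b) else 0)"
    using ab H0 by (intro sum.cong) auto
  finally have 1: "(H * X) $$ (a,b) = H $$ (a,a) * X $$ (a,b)" using ab by simp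
  have "(X * H) $$ (a,b) = (\<Sum>k = 0..<N. X $$ (a,k) * H $$ (k,b))"
    by (rule mult_mat_index[OF X H(1) ab])
  also have "\<dots> = (\<Sum>k = 0..<N. if k = b then X $$ (a,b) * H $$ (b,b) else 0)"
    using ab H0 by (intro sum.cong) auto
  finally have 2: "(X * H) $$ (a,b) = X $$ (a,b) * H $$ (b,b)" using ab by simp
  have "(H * X - X * H) $$ (a,b) = (H * X) $$ (a,b) - (X * H) $$ (a,b)"
    using H X ab by (intro index_minus_mat) auto
  thus ?thesis unfolding 1 2 by (simp add: algebra_simps)
qed

lemma cartan_entry:
  assumes "H \<in> cartan n" "a < 2 * n"
  shows "H $$ (a,a) = (\<Sum>i = 1..n. of_int (index_weight n a i) * H $$ (i - 1, i - 1))"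
proof -
  have "(\<Sum>i = 1..n. of_int (index_weight n a i) * H $$ (i - 1, i - 1)) =
     (\<Sum>i = 1..n. if i = (if a < n then a + 1 else a + 1 - n) then H $$ (a,a) else 0)"
  proof (rule sum.cong)
    fix i assume i: "i \<in> {1..n}"
    have "H $$ (a,a) = - H $$ (a - n, a - n)" if "n \<le> a"
      using so_entry[of H n a a] assms that by (simp add: cartan_def dual_index_def)
    thus "of_int (index_weight n a i) * H $$ (i - 1, i - 1) =
      (if i = (if a < n then a + 1 else a + 1 - n) then H $$ (a,a) else 0)"
      using i by (cases "a < n") (auto simp: index_weight_def)
  qed simp
  also have "\<dots> = H $$ (a,a)" using assms(2) by auto
  finally show ?thesis ..
qed

text \<open>Under the Cartan subalgebra the entry (a,b) has as weight the difference of the weights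
  of a and b. A root space thus consists of the elements of so supported on the entries of the right
  weight.\<close>

lemma root_space_iff:
  "X \<in> root_space n \<beta> \<longleftrightarrow> X \<in> so n \<and>
     (\<forall>a<2 * n. \<forall>b<2 * n. X $$ (a,b) \<noteq> 0 \<longrightarrow> (\<forall>i \<in> {1..n}. \<beta> i = index_weight n a i - index_weight n b i))"
proof (intro iffI conjI allI impI ballI)
  assume "X \<in> root_space n \<beta>"
  thus so: "X \<in> so n" by (simp add: root_space_def)
  fix a b i assume ab: "a < 2 * n" "b < 2 * n" and nz: "X $$ (a,b) \<noteq> 0" and i: "i \<in> {1..n}"
  \<comment> \<open>The Cartan element on which each weight takes its coefficient number i as
    value.\<close>
  define H where "H = mat (2 * n) (2 * n) (\<lambda>(a,b). if a = b then of_int (index_weight n a i) else (0 :: complex))"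
  have "H \<in> so n" unfolding so_iff
    using dual_index_less dual_index_dual_index by (auto simp: H_def index_weight_dual[of _ n i])
  hence H: "H \<in> cartan n" by (auto simp: cartan_def diagonal_mat_def H_def)
  have "weight_value n \<beta> H = (\<Sum>j = 1..n. if j = i then of_int (\<beta> i) else 0)"
        unfolding weight_value_def
  proof (rule sum.cong)
    fix j assume "j \<in> {1..n}"
    moreover from this have "index_weight n (j - 1) i = (if j = i then 1 else 0)" by (auto simp: index_weight_def)
    ultimately show "of_int (\<beta> j) * H $$ (j - 1, j - 1) = (if j = i then of_int (\<beta> i) else 0)"
      by (auto simp: H_def)
  qed simp
  hence "weight_value n \<beta> H = of_int (\<beta> i)" using i by simp
  moreover have "H * X - X * H = weight_value n \<beta> H \<cdot>\<^sub>m X"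
    using \<open>X \<in> root_space n \<beta>\<close> H by (simp add: root_space_def)
  ultimately have "(H * X - X * H) $$ (a,b) = of_int (\<beta> i) * X $$ (a,b)"
    using ab so_carrier[OF so] by simp
  moreover have "(H * X - X * H) $$ (a,b) = (H $$ (a,a) - H $$ (b,b)) * X $$ (a,b)"
    using H ab so_carrier[OF so] by (intro diagonal_comm_index[of _ "2 * n"]) (auto simp: cartan_def so_carrier)
  ultimately have "of_int (\<beta> i) = (of_int (index_weight n a i - index_weight n b i) :: complex)"
    using nz ab by (simp add: H_def)
  thus "\<beta> i = index_weight n a i - index_weight n b i" by (simp only: of_int_eq_iff)
next
  assume *: "X \<in> so n \<and> (\<forall>a<2 * n. \<forall>b<2 * n. X $$ (a,b) \<noteq> 0 \<longrightarrow>
     (\<forall>i \<in> {1..n}. \<beta> i = index_weight n a i - index_weight n b i))"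
  hence so: "X \<in> so n" by simp
  note X = so_carrier[OF so]
  have "H * X - X * H = weight_value n \<beta> H \<cdot>\<^sub>m X" if H: "H \<in> cartan n" for H
  proof (rule eq_matI)
    fix a b assume "a < dim_row (weight_value n \<beta> H \<cdot>\<^sub>m X)" "b < dim_col (weight_value n \<beta> H \<cdot>\<^sub>m X)"
    hence ab: "a < 2 * n" "b < 2 * n" using X by auto
    have "(H * X - X * H) $$ (a,b) = (H $$ (a,a) - H $$ (b,b)) * X $$ (a,b)"
      using H ab X by (intro diagonal_comm_index[of _ "2 * n"]) (auto simp: cartan_def so_carrier)
    also have "\<dots> = weight_value n \<beta> H * X $$ (a,b)"
    proof (cases "X $$ (a,b) = 0")
      case False
      have "weight_value n \<beta> H =
          (\<Sum>i = 1..n. of_int (index_weight n a i - index_weight n b i) * H $$ (i - 1, i - 1))"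
        unfolding weight_value_def using * ab False by (intro sum.cong) auto
      also have "\<dots> = H $$ (a,a) - H $$ (b,b)"
        unfolding cartan_entry[OF H ab(1)] cartan_entry[OF H ab(2)]
        by (simp add: sum_subtractf algebra_simps)
      finally show ?thesis by simp
    qed simp
    finally show "(H * X - X * H) $$ (a,b) = (weight_value n \<beta> H \<cdot>\<^sub>m X) $$ (a,b)"
      using ab X by simp
  qed (use X H in \<open>auto simp: cartan_def dest!: so_carrier\<close>)
  thus "X \<in> root_space n \<beta>" using so by (simp add: root_space_def)
qed

section \<open>The nilradical\<close>

definition simple_cone :: "nat \<Rightarrow> (nat \<Rightarrow> int) \<Rightarrow> bool" where
  "simple_cone n \<beta> \<longleftrightarrow> (\<exists>c :: nat \<Rightarrow> nat. \<forall>k. \<beta> k = (\<Sum>j = 1..n. int (c j) * simple_root n j k))"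

lemma simple_cone_zero: "simple_cone n (\<lambda>_. 0)"
  unfolding simple_cone_def by (rule exI[of _ "\<lambda>_. 0"]) simp

lemma simple_cone_add:
  assumes "simple_cone n \<beta>" "simple_cone n \<gamma>"
  shows "simple_cone n (\<lambda>k. \<beta> k + \<gamma> k)"
proof -
  obtain c d where "\<forall>k. \<beta> k = (\<Sum>j = 1..n. int (c j) * simple_root n j k)"
    "\<forall>k. \<gamma> k = (\<Sum>j = 1..n. int (d j) * simple_root n j k)"
    using assms unfolding simple_cone_def by blast
  thus ?thesis unfolding simple_cone_def
    by (intro exI[of _ "\<lambda>j. c j + d j"]) (simp add: sum.distrib algebra_simps)
qed

lemma simple_cone_simple_root:
  assumes "i \<in> {1..n}"
  shows "simple_cone n (simple_root n i)"
  unfolding simple_cone_def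
proof (intro exI allI)
  fix k
  have "(\<Sum>j = 1..n. int (if j = i then 1 else 0) * simple_root n j k) = (\<Sum>j = 1..n. if j = i then simple_root n i k else 0)"
    by (intro sum.cong) auto
  thus "simple_root n i k = (\<Sum>j = 1..n. int (if j = i then 1 else 0) * simple_root n j k)"
    using assms by simp
qed

definition coord :: "nat \<Rightarrow> nat \<Rightarrow> int" where
  "coord i = (\<lambda>k. if k = i then 1 else 0)"

lemma simple_cone_diff:
  assumes "1 \<le> i" "i \<le> j" "j \<le> n"
  shows "simple_cone n (\<lambda>k. coord i k - coord j k)"
  using assms(2,3)
proof (induction j rule: dec_induct)
  case base
  then show ?case using simple_cone_zero by simp
next
  case (step j)
  have "simple_cone n (simple_root n j)" using step assms(1) by (intro simple_cone_simple_root) auto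
  hence "simple_cone n (\<lambda>k. (coord i k - coord j k) + simple_root n j k)"
    using step by (intro simple_cone_add) auto
  also have "(\<lambda>k. (coord i k - coord j k) + simple_root n j k) = (\<lambda>k. coord i k - coord (Suc j) k)"
    using step by (auto simp: coord_def simple_root_def)
  finally show ?case .
qed

text \<open>For i < j the sum e_i + e_j equals (e_i - e_(n-1)) + (e_j - e_n) + \<alpha>_n, whose
  differences telescope into simple roots.\<close>

lemma simple_cone_sum:
  assumes n: "2 \<le> n" and ij: "1 \<le> i" "i \<le> n" "1 \<le> j" "j \<le> n" "i \<noteq> j"
  shows "simple_cone n (\<lambda>k. coord i k + coord j k)"
proof -
  have *: "simple_cone n (\<lambda>k. coord i k + coord j k)" if "1 \<le> i" "i < j" "j \<le> n" for i j
  proof -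
    have "simple_cone n (simple_root n n)" using n by (intro simple_cone_simple_root) auto
    moreover have "simple_cone n (\<lambda>k. coord i k - coord (n - 1) k)" using that by (intro simple_cone_diff) auto
    moreover have "simple_cone n (\<lambda>k. coord j k - coord n k)" using that by (intro simple_cone_diff) auto
    ultimately have "simple_cone n (\<lambda>k. ((coord i k - coord (n - 1) k) + (coord j k - coord n k)) + simple_root n n k)"
      by (intro simple_cone_add)
    also have "(\<lambda>k. ((coord i k - coord (n - 1) k) + (coord j k - coord n k)) + simple_root n n k) =
        (\<lambda>k. coord i k + coord j k)"
      using n by (auto simp: coord_def simple_root_def fun_eq_iff)
    finally show ?thesis .
  qed
  show ?thesis
  proof (cases "i < j")
    case False
    hence "simple_cone n (\<lambda>k. coord j k + coord i k)" using * ij by simp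
    thus ?thesis by (simp add: add.commute)
  qed (use * ij in blast)
qed

lemma index_weight_coord:
  "a < n \<Longrightarrow> index_weight n a = coord (a + 1)"
  "n \<le> a \<Longrightarrow> index_weight n a = (\<lambda>k. - coord (a + 1 - n) k)"
  by (auto simp: index_weight_def coord_def fun_eq_iff)

text \<open>Excluding dual indices removes the differences \<plusminus> 2 e_i, for which the claim
  may fail: 2 e_n = \<alpha>_n - \<alpha>_(n-1) has coefficients of both signs.\<close>

lemma simple_cone_index_weight:
  assumes n: "2 \<le> n" and ab: "a < 2 * n" "b < 2 * n" "b \<noteq> dual_index n a"
  shows "simple_cone n (\<lambda>k. index_weight n a k - index_weight n b k) \<or>
    simple_cone n (\<lambda>k. index_weight n b k - index_weight n a k)"
proof -
  consider "a < n" "b < n" | "a < n" "n \<le> b" | "n \<le> a" "b < n" | "n \<le> a" "n \<le> b" by linarith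
  thus ?thesis
  proof cases
    case 1
    then show ?thesis using simple_cone_diff[of "a + 1" "b + 1" n] simple_cone_diff[of "b + 1" "a + 1" n]
      by (cases "a \<le> b") (simp_all add: index_weight_coord)
  next
    case 2
    then show ?thesis using simple_cone_sum[OF n, of "a + 1" "b + 1 - n"] ab
      by (auto simp: index_weight_coord dual_index_def)
  next
    case 3
    then show ?thesis using simple_cone_sum[OF n, of "b + 1" "a + 1 - n"] ab
      by (auto simp: index_weight_coord dual_index_def)
  next
    case 4
    then show ?thesis using simple_cone_diff[of "a + 1 - n" "b + 1 - n" n] simple_cone_diff[of "b + 1 - n" "a + 1 - n" n] ab
      by (cases "a \<le> b") (simp_all add: index_weight_coord)
  qed
qed

text \<open>Twice the grading element that takes the value 1 on the simple roots outside \<open>I\<close> and 0 on those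
  in \<open>I\<close>; the doubling keeps the values at the coordinates integral.\<close>

definition grade_coord :: "nat \<Rightarrow> nat set \<Rightarrow> nat \<Rightarrow> int" where
  "grade_coord n I j = 2 * int (card ({j..<n} - I)) + (if n \<in> I then 0 else 1) - (if n - 1 \<in> I then 0 else 1)"

definition grade :: "nat \<Rightarrow> nat set \<Rightarrow> (nat \<Rightarrow> int) \<Rightarrow> int" where
  "grade n I \<beta> = (\<Sum>k = 1..n. \<beta> k * grade_coord n I k)"

definition index_grade :: "nat \<Rightarrow> nat set \<Rightarrow> nat \<Rightarrow> int" where
  "index_grade n I a = (if a < n then grade_coord n I (a + 1) else - grade_coord n I (a + 1 - n))"

lemma grade_coord_step:
  assumes "j < n"
  shows "grade_coord n I j = grade_coord n I (Suc j) + (if j \<in> I then 0 else 2)"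
proof -
  have "{j..<n} = insert j {Suc j..<n}" using assms by auto
  thus ?thesis by (simp add: grade_coord_def insert_Diff_if)
qed

lemma grade_coord_eq: "1 \<le> i \<Longrightarrow> i \<le> n \<Longrightarrow> grade n I (coord i) = grade_coord n I i"
proof -
  assume i: "1 \<le> i" "i \<le> n"
  have "grade n I (coord i) = (\<Sum>k = 1..n. if k = i then grade_coord n I i else 0)"
    unfolding grade_def by (intro sum.cong) (auto simp: coord_def)
  thus ?thesis using i by simp
qed

lemma grade_diff: "grade n I (\<lambda>k. \<beta> k - \<gamma> k) = grade n I \<beta> - grade n I \<gamma>"
  by (simp add: grade_def left_diff_distrib sum_subtractf)

lemma grade_add: "grade n I (\<lambda>k. \<beta> k + \<gamma> k) = grade n I \<beta> + grade n I \<gamma>"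
  by (simp add: grade_def distrib_right sum.distrib)

lemma grade_minus: "grade n I (\<lambda>k. - \<beta> k) = - grade n I \<beta>"
  by (simp add: grade_def sum_negf)

text \<open>The corrections in \<open>grade_coord\<close> solve the last two equations: the
  coordinates n - 1 and n have difference 2 or 0 according to n - 1, and sum 2 or 0 according to n,
  being outside \<open>I\<close> or not.\<close>

lemma grade_simple_root:
  assumes "2 \<le> n" "j \<in> {1..n}"
  shows "grade n I (simple_root n j) = (if j \<in> I then 0 else 2)"
proof (cases "j < n")
  case True
  hence "simple_root n j = (\<lambda>k. coord j k - coord (Suc j) k)" by (auto simp: simple_root_def coord_def)
  thus ?thesis using True assms grade_coord_step[OF True, of I] by (simp add: grade_diff grade_coord_eq)
next
  case False
  hence j: "j = n" using assms by simp
  have "simple_root n n = (\<lambda>k. coord (n - 1) k + coord n k)" using assms by (auto simp: simple_root_def coord_def fun_eq_iff)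
  moreover have "{n - 1..<n} = {n - 1}" using assms by auto
  ultimately show ?thesis using assms
    by (auto simp: j grade_add grade_coord_eq grade_coord_def insert_Diff_if)
qed

lemma grade_index_weight: "a < 2 * n \<Longrightarrow> grade n I (index_weight n a) = index_grade n I a"
  by (cases "a < n") (auto simp: index_weight_coord index_grade_def grade_minus grade_coord_eq)

lemma grade_sum_simple:
  assumes "2 \<le> n" "\<forall>k. \<beta> k = (\<Sum>j = 1..n. int (c j) * simple_root n j k)"
  shows "grade n I \<beta> = (\<Sum>j = 1..n. int (c j) * (if j \<in> I then 0 else 2))"
proof -
  have "grade n I \<beta> = (\<Sum>k = 1..n. \<Sum>j = 1..n. int (c j) * (simple_root n j k * grade_coord n I k))"
    unfolding grade_def using assms(2) by (simp add: sum_distrib_right mult.assoc)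
  also have "\<dots> = (\<Sum>j = 1..n. int (c j) * grade n I (simple_root n j))"
    by (subst sum.swap) (simp add: grade_def sum_distrib_left)
  also have "\<dots> = (\<Sum>j = 1..n. int (c j) * (if j \<in> I then 0 else 2))"
    using grade_simple_root[OF assms(1)] by (intro sum.cong) auto
  finally show ?thesis .
qed

lemma grade_levi:
  assumes n: "2 \<le> n" and I: "I \<subseteq> {1..n}" and \<beta>: "\<beta> \<in> levi_roots n I"
  shows "grade n I \<beta> = 0"
proof -
  obtain c :: "nat \<Rightarrow> int" where c: "\<forall>k. \<beta> k = (\<Sum>j \<in> I. c j * simple_root n j k)"
    using \<beta> by (auto simp: levi_roots_def)
  have "grade n I \<beta> = (\<Sum>k = 1..n. \<Sum>j \<in> I. c j * (simple_root n j k * grade_coord n I k))"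
    unfolding grade_def using c by (simp add: sum_distrib_right mult.assoc)
  also have "\<dots> = (\<Sum>j \<in> I. c j * grade n I (simple_root n j))"
    by (subst sum.swap) (simp add: grade_def sum_distrib_left)
  also have "\<dots> = 0" using grade_simple_root[OF n] I by (intro sum.neutral) auto
  finally show ?thesis .
qed

text \<open>A nonnegative combination of simple roots has grade 0 only if its coefficients outside
  \<open>I\<close> vanish, and then it is a root of the Levi factor.\<close>

lemma grade_positive:
  assumes n: "2 \<le> n" and I: "I \<subseteq> {1..n}" and \<beta>: "\<beta> \<in> positive_roots n - levi_roots n I"
  shows "0 < grade n I \<beta>"
proof -
  obtain c :: "nat \<Rightarrow> nat" where c: "\<forall>k. \<beta> k = (\<Sum>j = 1..n. int (c j) * simple_root n j k)" and r: "\<beta> \<in> roots n"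
    using \<beta> by (auto simp: positive_roots_def)
  have g: "grade n I \<beta> = (\<Sum>j = 1..n. int (c j) * (if j \<in> I then 0 else 2))" by (rule grade_sum_simple[OF n c])
  have "grade n I \<beta> \<noteq> 0"
  proof
    assume "grade n I \<beta> = 0"
    hence "\<forall>j \<in> {1..n}. int (c j) * (if j \<in> I then 0 else 2) = 0"
      unfolding g by (subst (asm) sum_nonneg_eq_0_iff) auto
    hence z: "c j = 0" if "j \<in> {1..n} - I" for j using that by force
    have "\<beta> k = (\<Sum>j \<in> I. int (c j) * simple_root n j k)" for k
      unfolding c[rule_format, of k] using I z by (intro sum.mono_neutral_right) auto
    hence "\<beta> \<in> levi_roots n I" using r by (auto simp: levi_roots_def intro!: exI[of _ "\<lambda>j. int (c j)"])
    thus False using \<beta> by simp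
  qed
  moreover have "0 \<le> grade n I \<beta>" unfolding g by (intro sum_nonneg) auto
  ultimately show ?thesis by simp
qed

section \<open>The nilradical as the space of strictly level-raising elements\<close>

definition strict_so :: "nat \<Rightarrow> (nat \<Rightarrow> int) \<Rightarrow> complex mat set" where
  "strict_so n L = {X \<in> so n. \<forall>a<2 * n. \<forall>b<2 * n. X $$ (a,b) \<noteq> 0 \<longrightarrow> L b < L a}"

lemma so_add:
  assumes "X \<in> so n" "Y \<in> so n"
  shows "X + Y \<in> so n"
  unfolding so_iff
proof (intro conjI allI impI)
  note XY = so_carrier[OF assms(1)] so_carrier[OF assms(2)]
  show "X + Y \<in> carrier_mat (2 * n) (2 * n)" using XY by simp
  fix a b assume ab: "a < 2 * n" "b < 2 * n"
  have "X $$ (dual_index n a, b) = - X $$ (dual_index n b, a)" "Y $$ (dual_index n a, b) = - Y $$ (dual_index n b, a)"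
    using assms ab by (blast intro: so_entry_swap)+
  thus "(X + Y) $$ (dual_index n a, b) = - (X + Y) $$ (dual_index n b, a)"
    using XY ab dual_index_less[OF ab(1)] dual_index_less[OF ab(2)] by simp
qed

lemma so_smult:
  assumes "X \<in> so n"
  shows "c \<cdot>\<^sub>m X \<in> so n"
  unfolding so_iff
proof (intro conjI allI impI)
  note X = so_carrier[OF assms]
  show "c \<cdot>\<^sub>m X \<in> carrier_mat (2 * n) (2 * n)" using X by simp
  fix a b assume ab: "a < 2 * n" "b < 2 * n"
  have "X $$ (dual_index n a, b) = - X $$ (dual_index n b, a)" using assms ab by (blast intro: so_entry_swap)
  thus "(c \<cdot>\<^sub>m X) $$ (dual_index n a, b) = - (c \<cdot>\<^sub>m X) $$ (dual_index n b, a)"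
    using X ab dual_index_less[OF ab(1)] dual_index_less[OF ab(2)] by simp
qed

lemma so_zero: "0\<^sub>m (2 * n) (2 * n) \<in> so n"
  unfolding so_iff by (auto simp: dual_index_less)

lemma submodule_strict_so:
  "LinearCombinations.submodule class_ring (strict_so n L) (module_mat TYPE(complex) (2 * n) (2 * n))"
proof -
  interpret matrix_vs "2 * n" "2 * n" "TYPE(complex)" .
  have carr: "strict_so n L \<subseteq> carrier_mat (2 * n) (2 * n)"
    by (auto simp: strict_so_def so_carrier)
  have add: "X + Y \<in> strict_so n L" if X: "X \<in> strict_so n L" and Y: "Y \<in> strict_so n L" for X Y
  proof -
    have "X \<in> carrier_mat (2 * n) (2 * n)" "Y \<in> carrier_mat (2 * n) (2 * n)" using X Y carr by auto
    moreover have "L b < L a" if ab: "a < 2 * n" "b < 2 * n" and "(X + Y) $$ (a,b) \<noteq> 0" for a b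
    proof -
      have "X $$ (a,b) \<noteq> 0 \<or> Y $$ (a,b) \<noteq> 0" using that calculation by auto
      thus ?thesis using X Y ab unfolding strict_so_def by blast
    qed
    ultimately show ?thesis using X Y so_add[of X n Y] by (simp add: strict_so_def del: index_add_mat)
  qed
  have smult: "c \<cdot>\<^sub>m X \<in> strict_so n L" if X: "X \<in> strict_so n L" for X c
  proof -
    have "X \<in> carrier_mat (2 * n) (2 * n)" using X carr by auto
    thus ?thesis using X so_smult[of X n c] by (auto simp: strict_so_def)
  qed
  have "0\<^sub>m (2 * n) (2 * n) \<in> strict_so n L" by (simp add: strict_so_def so_zero)
  thus ?thesis
    using carr add smult module_axioms by (intro submodule.intro) (auto simp: module_mat_simps)
qed

lemma nilradical_subset:
  assumes n: "2 \<le> n" and I: "I \<subseteq> {1..n}"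
  shows "parabolic_nilradical n I \<subseteq> strict_so n (index_grade n I)"
proof -
  interpret matrix_vs "2 * n" "2 * n" "TYPE(complex)" .
  have "(\<Union>\<beta> \<in> positive_roots n - levi_roots n I. root_space n \<beta>) \<subseteq> strict_so n (index_grade n I)"
  proof (rule UN_least, rule subsetI)
    fix \<beta> X assume \<beta>: "\<beta> \<in> positive_roots n - levi_roots n I" and X: "X \<in> root_space n \<beta>"
    have "index_grade n I b < index_grade n I a" if ab: "a < 2 * n" "b < 2 * n" "X $$ (a,b) \<noteq> 0" for a b
    proof -
      have "grade n I \<beta> = grade n I (\<lambda>k. index_weight n a k - index_weight n b k)"
        unfolding grade_def using X ab by (intro sum.cong) (auto simp: root_space_iff)
      thus ?thesis using grade_positive[OF n I \<beta>] ab by (simp add: grade_diff grade_index_weight)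
    qed
    thus "X \<in> strict_so n (index_grade n I)" using X by (auto simp: strict_so_def root_space_iff)
  qed
  from span_is_subset[OF this submodule_strict_so]
  show ?thesis by (simp add: parabolic_nilradical_def)
qed

text \<open>X is the finite sum of its weight components \<open>part {\<beta>}\<close>, each a root
  vector. Either \<beta> or -\<beta> is a nonnegative combination of simple roots, and the positive
  grade rules out the second; as Levi roots have grade 0, it also rules out that \<beta> belongs to
  the Levi factor.\<close>

lemma strict_so_subset_nilradical:
  assumes n: "2 \<le> n" and I: "I \<subseteq> {1..n}"
  shows "strict_so n (index_grade n I) \<subseteq> parabolic_nilradical n I"
proof
  interpret matrix_vs "2 * n" "2 * n" "TYPE(complex)" .
  fix X assume X: "X \<in> strict_so n (index_grade n I)"
  let ?N = "2 * n" and ?S = "\<Union>\<beta> \<in> positive_roots n - levi_roots n I. root_space n \<beta>"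
  have so: "X \<in> so n" and strict: "\<And>a b. a < ?N \<Longrightarrow> b < ?N \<Longrightarrow> X $$ (a,b) \<noteq> 0 \<Longrightarrow> index_grade n I b < index_grade n I a"
    using X by (auto simp: strict_so_def)
  note Xc = so_carrier[OF so]
  define wt where "wt a b = (\<lambda>k. index_weight n a k - index_weight n b k)" for a b
  define part where "part S = mat ?N ?N (\<lambda>(a,b). if wt a b \<in> S then X $$ (a,b) else 0)" for S
  define W where "W = {wt a b | a b. a < ?N \<and> b < ?N \<and> X $$ (a,b) \<noteq> 0}"
  have S: "?S \<subseteq> carrier_mat ?N ?N" by (auto simp: root_space_def so_carrier)
  have sub: "LinearCombinations.submodule class_ring (span ?S) (module_mat TYPE(complex) ?N ?N)"
    by (rule span_is_submodule[OF S])
  have "finite W"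
  proof -
    have "W \<subseteq> (\<lambda>(a,b). wt a b) ` ({..<?N} \<times> {..<?N})" by (auto simp: W_def)
    thus ?thesis by (rule finite_subset) auto
  qed
  have part_root: "part {\<beta>} \<in> root_space n \<beta> \<and> \<beta> \<in> positive_roots n - levi_roots n I" if "\<beta> \<in> W" for \<beta>
  proof -
    obtain a b where ab: "a < ?N" "b < ?N" "X $$ (a,b) \<noteq> 0" and \<beta>: "\<beta> = wt a b" using \<open>\<beta> \<in> W\<close> by (auto simp: W_def)
    have "part {\<beta>} \<in> so n"
      unfolding so_iff
    proof (intro conjI allI impI)
      fix c d assume cd: "c < ?N" "d < ?N"
      have "wt (dual_index n c) d = wt (dual_index n d) c"
        using cd by (auto simp: wt_def index_weight_dual fun_eq_iff)
      moreover have "X $$ (dual_index n c, d) = - X $$ (dual_index n d, c)" using so cd by (rule so_entry_swap)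
      ultimately show "part {\<beta>} $$ (dual_index n c, d) = - part {\<beta>} $$ (dual_index n d, c)"
        using cd by (simp add: part_def dual_index_less)
    qed (simp add: part_def)
    hence rs: "part {\<beta>} \<in> root_space n \<beta>" by (auto simp: root_space_iff part_def wt_def)
    have grade: "0 < grade n I \<beta>" using strict[OF ab] ab by (simp add: \<beta> wt_def grade_diff grade_index_weight)
    have "part {\<beta>} $$ (a,b) \<noteq> 0" using ab by (simp add: part_def \<beta>)
    hence "part {\<beta>} \<noteq> 0\<^sub>m ?N ?N" using ab by auto
    moreover have "\<exists>i. \<beta> i \<noteq> 0"
    proof (rule ccontr)
      assume "\<not> (\<exists>i. \<beta> i \<noteq> 0)"
      hence "grade n I \<beta> = 0" by (simp add: grade_def)
      thus False using grade by simp
    qed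
    moreover have "\<beta> i = 0" if "i \<notin> {1..n}" for i
      using index_weight_outside[OF ab(1) that] index_weight_outside[OF ab(2) that] by (simp add: \<beta> wt_def)
    ultimately have "\<beta> \<in> roots n" using rs by (auto simp: roots_def)
    moreover have "simple_cone n \<beta>"
    proof (rule ccontr)
      assume "\<not> simple_cone n \<beta>"
      moreover have "b \<noteq> dual_index n a" using so_entry_dual[OF so ab(1)] ab(3) by auto
      ultimately have "simple_cone n (\<lambda>k. index_weight n b k - index_weight n a k)"
        using simple_cone_index_weight[OF n ab(1,2)] by (auto simp: \<beta> wt_def)
      then obtain c :: "nat \<Rightarrow> nat" where
        c: "\<forall>k. index_weight n b k - index_weight n a k = (\<Sum>j = 1..n. int (c j) * simple_root n j k)"
        by (auto simp: simple_cone_def)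
      have "0 \<le> grade n I (\<lambda>k. index_weight n b k - index_weight n a k)"
        unfolding grade_sum_simple[OF n c] by (intro sum_nonneg) auto
      thus False using strict[OF ab] ab by (simp add: grade_diff grade_index_weight)
    qed
    ultimately have "\<beta> \<in> positive_roots n" by (simp add: positive_roots_def simple_cone_def)
    moreover have "\<beta> \<notin> levi_roots n I" using grade_levi[OF n I] grade by auto
    ultimately show ?thesis using rs by simp
  qed
  have "part T \<in> span ?S" if "T \<subseteq> W" for T
    using finite_subset[OF that \<open>finite W\<close>] that
  proof (induction T rule: finite_induct)
    case empty
    have "part {} = 0\<^sub>m ?N ?N" by (auto simp: part_def)
    thus ?case using submodule.zero_closed[OF sub] by (simp add: module_mat_simps)
  next
    case (insert \<beta> T)
    have "part (insert \<beta> T) = part {\<beta>} + part T"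
      using insert by (intro eq_matI) (auto simp: part_def)
    moreover have "part {\<beta>} \<in> span ?S"
      using part_root[of \<beta>] insert in_own_span[OF S] by blast
    ultimately show ?case
      using submodule.m_closed[OF sub] insert by (simp add: module_mat_simps)
  qed
  moreover have "part W = X"
  proof (rule eq_matI)
    fix a b assume "a < dim_row X" "b < dim_col X"
    thus "part W $$ (a,b) = X $$ (a,b)" using Xc by (auto simp: part_def W_def)
  qed (use Xc in \<open>auto simp: part_def\<close>)
  ultimately show "X \<in> parabolic_nilradical n I" unfolding parabolic_nilradical_def by blast
qed

lemma nilradical_eq:
  assumes "2 \<le> n" "I \<subseteq> {1..n}"
  shows "parabolic_nilradical n I = strict_so n (index_grade n I)"
  using nilradical_subset[OF assms] strict_so_subset_nilradical[OF assms] by blast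

section \<open>The Jordan type of the Richardson orbit of a level function\<close>

lemma col_count_append [simp]: "col_count (xs @ ys) r = col_count xs r + col_count ys r"
  by (simp add: col_count_def)

lemma col_count_mset_cong: "mset xs = mset ys \<Longrightarrow> col_count xs r = col_count ys r"
  by (rule col_count_cong_mset) (metis mset_filter)

lemma col_count_levels:
  assumes "\<And>j. sz (- j) = sz (j :: int)"
  shows "col_count (map sz [- int K..int K]) r = col_count [sz 0] r + 2 * col_count (map (\<lambda>j. sz (int j)) [1..<Suc K]) r"
proof (induction K)
  case (Suc K)
  have "[- int (Suc K)..int (Suc K)] = - int (Suc K) # [- int K..int K] @ [int (Suc K)]"
  proof -
    have "[- int (Suc K)..int (Suc K)] = - int (Suc K) # [- int (Suc K) + 1..int (Suc K)]"
      by (rule upto_rec1) simp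
    also have "[- int (Suc K) + 1..int (Suc K)] = [- int (Suc K) + 1..int (Suc K) - 1] @ [int (Suc K)]"
      by (rule upto_rec2) simp
    finally show ?thesis by simp
  qed
  hence "col_count (map sz [- int (Suc K)..int (Suc K)]) r =
      col_count (map sz [- int K..int K]) r + 2 * col_count [sz (int (Suc K))] r"
    using assms[of "int (Suc K)"] by (simp del: of_nat_Suc)
  thus ?case unfolding Suc by (simp del: of_nat_Suc add: upt_Suc_append)
qed simp

lemma card_dual_level:
  assumes "\<And>a. a < 2 * n \<Longrightarrow> L (dual_index n a) = - L a"
  shows "card {a. a < 2 * n \<and> L a = - j} = card {a. a < 2 * n \<and> L a = (j :: int)}"
proof (rule bij_betw_same_card)
  show "bij_betw (dual_index n) {a. a < 2 * n \<and> L a = - j} {a. a < 2 * n \<and> L a = j}"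
    by (rule bij_betwI[of _ _ _ "dual_index n"]) (auto simp: dual_index_less dual_index_dual_index assms)
qed

lemma card_level_zero:
  fixes L :: "nat \<Rightarrow> int"
  assumes "\<And>a. a < 2 * n \<Longrightarrow> L (dual_index n a) = - L a"
  shows "card {a. a < 2 * n \<and> L a = 0} = 2 * card {a. a < n \<and> L a = 0}"
proof -
  have "{a. a < 2 * n \<and> L a = 0} = {a. a < n \<and> L a = 0} \<union> (\<lambda>a. a + n) ` {a. a < n \<and> L a = 0}"
  proof (rule Set.set_eqI)
    fix a
    have "L (a + n) = - L a" if "a < n" for a using assms[of a] that by (simp add: dual_index_def)
    from this[of "a - n"]
    show "a \<in> {a. a < 2 * n \<and> L a = 0} \<longleftrightarrow> a \<in> {a. a < n \<and> L a = 0} \<union> (\<lambda>a. a + n) ` {a. a < n \<and> L a = 0}"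
      by (cases "a < n") (auto simp: image_iff intro!: exI[of _ "a - n"])
  qed
  also have "card \<dots> = card {a. a < n \<and> L a = 0} + card ((\<lambda>a. a + n) ` {a. a < n \<and> L a = 0})"
    by (rule card_Un_disjoint) auto
  also have "card ((\<lambda>a. a + n) ` {a. a < n \<and> L a = 0}) = card {a. a < n \<and> L a = 0}"
    by (rule card_image) (simp add: inj_on_def)
  finally show ?thesis by simp
qed

lemma richardson_element_exists:
  fixes L :: "nat \<Rightarrow> int"
  assumes dual: "\<And>a. a < 2 * n \<Longrightarrow> L (dual_index n a) = - L a"
    and sizes: "mset (map (\<lambda>j. card {a. a < 2 * n \<and> L a = int j}) [1..<Suc K]) = mset bs"
    and zero: "card {a. a < n \<and> L a = 0} = a0"
  obtains X where "X \<in> strict_so n L"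
    "\<And>i M. rank_ge (X ^\<^sub>m i) (\<Sum>c<M. collapse_row a0 (row_length a0 bs) c - i)"
proof -
  interpret graded_form "2 * n" "dual_index n" L
    by unfold_locales (auto simp: dual_index_less dual_index_dual_index dual)
  obtain e where e: "bij_betw e {0..<a0} {a. a < n \<and> L a = 0}"
    using ex_bij_betw_nat_finite[of "{a. a < n \<and> L a = 0}"] zero by auto
  have en: "e c < n" "L (e c) = 0" if "c < a0" for c using bij_betwE[OF e, rule_format, of c] that by auto
  let ?bs = "map (\<lambda>j. card {a. a < 2 * n \<and> L a = int j}) (rev [1..<Suc K])"
  have "mset ?bs = mset bs" unfolding rev_map[symmetric] mset_rev by (rule sizes)
  hence len: "row_length a0 ?bs = row_length a0 bs"
    unfolding row_length_def fun_eq_iff using col_count_mset_cong[of ?bs bs] by simp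
  have "\<exists>X x s. chain_system (2 * n) (dual_index n) L (int K) X x (collapse_row a0 (row_length a0 ?bs)) (dual_row a0 (row_length a0 ?bs)) s"
  proof (rule chain_system_exists)
    show "inj_on e {..<a0}" using e by (simp add: bij_betw_def lessThan_atLeast0)
    show "e c < 2 * n" "L (e c) = 0" if "c < a0" for c using en[OF that] by auto
    show "e c \<noteq> dual_index n (e d)" if "c < a0" "d < a0" for c d
      using en(1)[OF that(1)] en(1)[OF that(2)] by (simp add: dual_index_def)
  qed
  then obtain X x s where
    "chain_system (2 * n) (dual_index n) L (int K) X x (collapse_row a0 (row_length a0 bs)) (dual_row a0 (row_length a0 bs)) s"
    unfolding len by blast
  then interpret cs: chain_system "2 * n" "dual_index n" L "int K" X x "collapse_row a0 (row_length a0 bs)"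
      "dual_row a0 (row_length a0 bs)" s .
  have "cs.X_mat \<in> so n"
    unfolding so_iff
  proof (intro conjI allI impI)
    show "cs.X_mat \<in> carrier_mat (2 * n) (2 * n)" by (rule cs.X_mat_carrier)
    fix a b assume ab: "a < 2 * n" "b < 2 * n"
    have "X (unit b) (dual_index n a) = - X (unit a) (dual_index n b)"
      using cs.skew[of "unit b" "unit a"] ab by (simp add: bform_unit_left bform_unit_right)
    thus "cs.X_mat $$ (dual_index n a, b) = - cs.X_mat $$ (dual_index n b, a)"
      using ab by (simp add: cs.X_mat_def dual_index_less)
  qed
  hence "cs.X_mat \<in> strict_so n L"
    using cs.strict by (auto simp: strict_so_def cs.X_mat_def)
  thus ?thesis using cs.rank_ge_X_mat_pow by (rule that)
qed

lemma rank_le_strict_so: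
  fixes L :: "nat \<Rightarrow> int"
  assumes dual: "\<And>a. a < 2 * n \<Longrightarrow> L (dual_index n a) = - L a"
    and L: "\<And>a. a < 2 * n \<Longrightarrow> \<bar>L a\<bar> \<le> int K"
    and sizes: "mset (map (\<lambda>j. card {a. a < 2 * n \<and> L a = int j}) [1..<Suc K]) = mset bs"
    and zero: "card {a. a < n \<and> L a = 0} = a0"
    and X: "X \<in> strict_so n L"
  shows "rank_le (X ^\<^sub>m i) (\<Sum>r<2 * n. row_length a0 bs r - i)"
proof -
  define sz where "sz j = card {a. a < 2 * n \<and> L a = j}" for j
  have "rank_le (X ^\<^sub>m i) (row_excess (2 * n) i (map sz [- int K..int K]))"
    unfolding sz_def using X L so_carrier[of X n] by (intro rank_le_pow_levels) (auto simp: strict_so_def)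
  moreover have "col_count (map sz [- int K..int K]) r = row_length a0 bs r" for r
  proof -
    have "col_count (map sz [- int K..int K]) r = col_count [sz 0] r + 2 * col_count (map (\<lambda>j. sz (int j)) [1..<Suc K]) r"
      by (rule col_count_levels) (simp add: sz_def card_dual_level[of n L, OF dual])
    also have "col_count (map (\<lambda>j. sz (int j)) [1..<Suc K]) r = col_count bs r"
      using sizes by (intro col_count_mset_cong) (simp add: sz_def)
    also have "sz 0 = 2 * a0" using card_level_zero[of n L, OF dual] zero by (simp add: sz_def)
    finally show ?thesis by (simp add: row_length_def)
  qed
  ultimately show ?thesis by (simp add: row_excess_def)
qed

text \<open>Only an odd level function and the multiset of its level sizes enter, so both cases of
  the theorem are instances, with different levels for coordinate n.\<close>

lemma orbit_partition_strict_so: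
  fixes L :: "nat \<Rightarrow> int"
  assumes dual: "\<And>a. a < 2 * n \<Longrightarrow> L (dual_index n a) = - L a"
    and L: "\<And>a. a < 2 * n \<Longrightarrow> \<bar>L a\<bar> \<le> int K"
    and sizes: "mset (map (\<lambda>j. card {a. a < 2 * n \<and> L a = int j}) [1..<Suc K]) = mset bs"
    and zero: "card {a. a < n \<and> L a = 0} = a0"
    and orbit: "nilpotent_orbit n \<O>"
    and dense: "subtopology (mat_topology (2 * n)) (strict_so n L) closure_of (\<O> \<inter> strict_so n L) = strict_so n L"
  shows "orbit_partition n \<O> (D_collapse n (Z_diagram_shape a0 bs))"
proof -
  let ?u = "strict_so n L" and ?p = "row_length a0 bs"
  let ?q = "collapse_row a0 ?p"
  let ?Z = "Z_diagram_shape a0 bs"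
  obtain X r where X: "X \<in> so n" "X ^\<^sub>m r = 0\<^sub>m (2 * n) (2 * n)"
    and \<O>: "\<O> = {Y. \<exists>g \<in> SO n. \<exists>h. similar_mat_wit Y X g h}"
    using orbit unfolding nilpotent_orbit_def by blast
  note Xc = so_carrier[OF X(1)]
  obtain d where d: "is_partition (2 * n) d" and jnf: "jordan_nf X (map (\<lambda>r. (r, 0)) d)"
    using nilpotent_jordan_type[OF Xc X(2)] .
  have jnfY: "jordan_nf Y (map (\<lambda>r. (r, 0)) d)" if "Y \<in> \<O>" for Y
  proof -
    have "similar_mat Y X" using that unfolding \<O> similar_mat_def by blast
    thus ?thesis using jnf unfolding jordan_nf_def using similar_mat_trans by blast
  qed
  have D: "D_partition n d"
    by (rule D_partitionI[OF d]) (rule even_rank_odd_pow_so[OF X(1) _ jordan_nf_rank_pow[OF Xc jnf]])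
  have col_le: "c \<le> 2 * n" if "c \<in> set (2 * a0 # bs @ bs)" for c
  proof -
    have "b \<le> 2 * n" if "b \<in> set bs" for b
    proof -
      have "b \<in># mset (map (\<lambda>j. card {a. a < 2 * n \<and> L a = int j}) [1..<Suc K])"
        using that sizes by simp
      then obtain j where "b = card {a. a < 2 * n \<and> L a = int j}" by auto
      also have "\<dots> \<le> card {..<2 * n}" by (intro card_mono) auto
      finally show ?thesis by simp
    qed
    moreover have "2 * a0 \<le> 2 * n"
      using card_mono[of "{..<n}" "{a. a < n \<and> L a = 0}"] zero by auto
    ultimately show ?thesis using that by auto
  qed
  have p: "?p r = col_count (2 * a0 # bs @ bs) r" for r by (simp add: row_length_def)
  have excess_Z: "excess i ?Z = (\<Sum>r<2 * n. ?p r - i)" for i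
    unfolding Z_diagram_shape_def p by (rule excess_conjugate_lengths[OF col_le])
  obtain X0 where X0: "X0 \<in> ?u" and rank_X0: "\<And>i M. rank_ge (X0 ^\<^sub>m i) (\<Sum>c<M. ?q c - i)"
    using richardson_element_exists[OF dual sizes zero] by blast
  \<comment> \<open>The element Y may depend on i. This is harmless, because all elements of the
    orbit have the same Jordan type d.\<close>
  have near: "\<exists>Y \<in> \<O>. Y \<in> ?u \<and> rank_ge (Y ^\<^sub>m i) (\<Sum>c<2 * n. ?q c - i)" for i
    using rank_ge_near[of X0 "2 * n" ?u "\<O> \<inter> ?u" i] X0 rank_X0 dense by blast
  have uc: "Y \<in> carrier_mat (2 * n) (2 * n)" if "Y \<in> ?u" for Y using that by (auto simp: strict_so_def so_carrier)
  have upper: "excess i d \<le> excess i ?Z" for i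
  proof -
    obtain Y where Y: "Y \<in> \<O>" "Y \<in> ?u" using near by blast
    have "rank_le (Y ^\<^sub>m i) (\<Sum>r<2 * n. ?p r - i)" by (rule rank_le_strict_so[OF dual L sizes zero Y(2)])
    moreover have "rank_ge (Y ^\<^sub>m i) (excess i d)" by (rule jordan_nf_rank_pow(2)[OF uc[OF Y(2)] jnfY[OF Y(1)]])
    ultimately show ?thesis unfolding excess_Z by (metis rank_ge_le_imp_le)
  qed
  have lower: "(\<Sum>c<2 * n. ?q c - i) \<le> excess i d" for i
  proof -
    obtain Y where Y: "Y \<in> \<O>" "Y \<in> ?u" "rank_ge (Y ^\<^sub>m i) (\<Sum>c<2 * n. ?q c - i)" using near by blast
    have "rank_le (Y ^\<^sub>m i) (excess i d)" by (rule jordan_nf_rank_pow(1)[OF uc[OF Y(2)] jnfY[OF Y(1)]])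
    thus ?thesis by (rule rank_ge_le_imp_le[OF Y(3)])
  qed
  have sd: "sorted_wrt (\<ge>) d" using d by (simp add: is_partition_def)
  have "D_collapse n ?Z = d"
  proof (rule D_collapse_eqI[OF D])
    show "dominates ?Z d"
      unfolding Z_diagram_shape_def
      by (rule dominates_if_excess_le[OF sorted_conjugate_lengths]) (rule upper[unfolded Z_diagram_shape_def])
    fix g assume g: "D_partition n g" "dominates ?Z g"
    have sg: "sorted_wrt (\<ge>) g" using g by (simp add: D_partition_def is_partition_def)
    have le: "excess i g \<le> (\<Sum>r<2 * n. ?p r - i)" for i
      using excess_le_if_dominates[OF sg g(2), of i] by (simp only: excess_Z)
    have "excess i g \<le> (\<Sum>c<2 * n. ?q c - i)" for i
    proof (rule excess_le_collapse_row[OF row_length_antimono _ _ _ g(1) le])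
      show "?p (2 * n) = 0" unfolding p by (rule col_count_eq_0) (rule col_le)
    qed (auto simp: row_length_def)
    thus "dominates d g" using lower by (intro dominates_if_excess_le[OF sd]) (rule order_trans)
  qed
  thus ?thesis using d jnfY by (simp add: orbit_partition_def)
qed

section \<open>The column lengths of Z-diagrams\<close>

lemma mset_concat_doubled: "mset (concat (map (\<lambda>m. [m, m]) xs)) = mset xs + mset xs"
  by (induction xs) auto

lemma sorted_concat_doubled: "sorted_wrt (\<ge>) xs \<Longrightarrow> sorted_wrt (\<ge>) (concat (map (\<lambda>m. [m, m :: nat]) xs))"
  by (induction xs) auto

lemma doubled_except_append:
  "doubled_except (hi @ a # lo) (length hi) =
     concat (map (\<lambda>m. [m, m]) hi) @ [2 * a] @ concat (map (\<lambda>m. [m, m]) lo)"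
proof -
  let ?f = "\<lambda>i. if i = length hi then [2 * (hi @ a # lo) ! i] else [(hi @ a # lo) ! i, (hi @ a # lo) ! i]"
  let ?h = "length hi" and ?l = "length lo"
  have "[0..<length (hi @ a # lo)] = [0..<?h] @ ?h # map (\<lambda>i. i + Suc ?h) [0..<?l]"
  proof -
    have "[0..<length (hi @ a # lo)] = [0..<?h] @ [?h..<?h + Suc ?l]"
      using upt_add_eq_append[of 0 ?h "Suc ?l"] by simp
    also have "[?h..<?h + Suc ?l] = ?h # [Suc ?h..<Suc ?h + ?l]" using upt_conv_Cons[of ?h "?h + Suc ?l"] by simp
    also have "[Suc ?h..<Suc ?h + ?l] = map (\<lambda>i. i + Suc ?h) [0..<?l]" by (simp only: map_add_upt add.commute[of ?l])
    finally show ?thesis .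
  qed
  moreover have "map ?f [0..<?h] = map (\<lambda>m. [m, m]) hi"
    by (rule nth_equalityI) (auto simp: nth_append)
  moreover have "map (\<lambda>i. ?f (i + Suc ?h)) [0..<?l] = map (\<lambda>m. [m, m]) lo"
    by (rule nth_equalityI) (auto simp: nth_append)
  ultimately show ?thesis unfolding doubled_except_def by (simp add: comp_def)
qed

lemma Z_diagram_columns:
  "\<exists>ms s. mset ms = mset (bs @ [a]) \<and> s < length ms \<and> ms ! s = a \<and>
     sorted_wrt (\<ge>) (doubled_except ms s) \<and>
     conjugate_lengths (Z_diagram_shape a bs) = filter (\<lambda>c. c \<noteq> 0) (doubled_except ms s)"
proof -
  define sb where "sb = rev (sort bs)"
  have sb: "sorted_wrt (\<ge>) sb" "mset sb = mset bs" by (simp_all add: sb_def sorted_wrt_rev)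
  \<comment> \<open>The position s of the middle column is the number of bs that are at least 2 * a;
    ties go before it. For a = 0 it contributes an empty column, which the filter in the statement
    drops.\<close>
  define hi where "hi = filter (\<lambda>b. 2 * a \<le> b) sb"
  define lo where "lo = filter (\<lambda>b. \<not> 2 * a \<le> b) sb"
  have hl: "mset hi + mset lo = mset bs" unfolding hi_def lo_def mset_filter sb(2) by simp
  let ?d = "concat (map (\<lambda>m. [m, m]) hi) @ [2 * a] @ concat (map (\<lambda>m. [m, m]) lo)"
  have d: "doubled_except (hi @ a # lo) (length hi) = ?d" by (rule doubled_except_append)
  have sorted: "sorted_wrt (\<ge>) ?d"
    using sorted_concat_doubled[OF sorted_wrt_filter[OF sb(1)]]
    by (auto simp: sorted_wrt_append hi_def lo_def)
  have "conjugate_lengths (Z_diagram_shape a bs) = filter (\<lambda>c. c \<noteq> 0) ?d"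
    unfolding Z_diagram_shape_def
  proof (rule conjugate_conjugate_lengths)
    show "sorted_wrt (\<ge>) (filter (\<lambda>c. c \<noteq> 0) ?d)" by (rule sorted_wrt_filter[OF sorted])
    have "mset ?d = mset (2 * a # bs @ bs)"
      using hl by (simp add: mset_concat_doubled) (metis (no_types, lifting) add.assoc add.commute)
    thus "mset (filter (\<lambda>c. c \<noteq> 0) (2 * a # bs @ bs)) = mset (filter (\<lambda>c. c \<noteq> 0) ?d)"
      by (simp only: mset_filter)
  qed simp
  thus ?thesis using sorted hl
    by (intro exI[of _ "hi @ a # lo"] exI[of _ "length hi"]) (simp add: d[unfolded append.simps])
qed

lemma Z_diagram_columns_zero:
  assumes pos: "\<forall>b \<in> set bs. 0 < b"
  shows "\<exists>ms. mset ms = mset bs \<and> sorted_wrt (\<ge>) ms \<and>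
     conjugate_lengths (Z_diagram_shape 0 bs) = concat (map (\<lambda>m. [m, m]) ms)"
proof -
  define ms where "ms = rev (sort bs)"
  have ms: "sorted_wrt (\<ge>) ms" "mset ms = mset bs" by (simp_all add: ms_def sorted_wrt_rev)
  have "conjugate_lengths (Z_diagram_shape 0 bs) = concat (map (\<lambda>m. [m, m]) ms)"
    unfolding Z_diagram_shape_def
  proof (rule conjugate_conjugate_lengths)
    show "sorted_wrt (\<ge>) (concat (map (\<lambda>m. [m, m]) ms))" by (rule sorted_concat_doubled[OF ms(1)])
    show "0 \<notin> set (concat (map (\<lambda>m. [m, m]) ms))" using pos by (auto simp: ms_def)
    have "filter (\<lambda>c. c \<noteq> 0) (2 * 0 # bs @ bs) = bs @ bs" using pos by (simp add: filter_id_conv)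
    thus "mset (filter (\<lambda>c. c \<noteq> 0) (2 * 0 # bs @ bs)) = mset (concat (map (\<lambda>m. [m, m]) ms))"
      by (simp add: mset_concat_doubled ms)
  qed
  thus ?thesis using ms by blast
qed

section \<open>The level function of a standard parabolic subalgebra\<close>

definition partial_sums :: "nat list \<Rightarrow> nat set" where
  "partial_sums ms = (\<lambda>t. sum_list (take t ms)) ` {1..length ms}"

text \<open>For positive entries, the number of the block containing coordinate j, counted from the
  inside: the last block has level 1, the first one level \<open>length ms\<close>, and coordinates
  beyond all blocks have level 0.\<close>

definition block_level :: "nat list \<Rightarrow> nat \<Rightarrow> nat" where
  "block_level ms j = card {x \<in> partial_sums ms. j \<le> x}"

lemma partial_sums_Nil [simp]: "partial_sums [] = {}"
  by (simp add: partial_sums_def)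

lemma partial_sums_Cons: "partial_sums (m # ms) = insert m ((+) m ` partial_sums ms)"
proof -
  have "{1..length (m # ms)} = insert 1 (Suc ` {1..length ms})"
    by auto
  hence "partial_sums (m # ms) = (\<lambda>t. sum_list (take t (m # ms))) ` insert 1 (Suc ` {1..length ms})"
    by (simp only: partial_sums_def)
  thus ?thesis unfolding partial_sums_def image_insert image_image by simp
qed

lemma finite_partial_sums [simp]: "finite (partial_sums ms)"
  by (simp add: partial_sums_def)

lemma partial_sums_le: "x \<in> partial_sums ms \<Longrightarrow> x \<le> sum_list ms"
  by (induction ms arbitrary: x) (auto simp: partial_sums_Cons)

lemma sum_list_in_partial_sums: "ms \<noteq> [] \<Longrightarrow> sum_list ms \<in> partial_sums ms"
  by (auto simp: partial_sums_def intro!: image_eqI[of _ _ "length ms"] simp: Suc_le_eq)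

lemma partial_sums_pos: "\<forall>m \<in> set ms. 0 < m \<Longrightarrow> x \<in> partial_sums ms \<Longrightarrow> 0 < x"
  by (induction ms arbitrary: x) (auto simp: partial_sums_Cons)

lemma card_partial_sums: "\<forall>m \<in> set ms. 0 < m \<Longrightarrow> card (partial_sums ms) = length ms"
proof (induction ms)
  case (Cons m ms)
  have "m \<notin> (+) m ` partial_sums ms" using partial_sums_pos[of ms 0] Cons.prems by auto
  thus ?case using Cons by (simp add: partial_sums_Cons card_image)
qed simp

lemma block_level_Cons:
  assumes pos: "\<forall>k \<in> set (m # ms). 0 < k"
  shows "block_level (m # ms) j = (if j \<le> m then Suc (length ms) else block_level ms (j - m))"
proof (cases "j \<le> m")
  case True
  hence "{x \<in> partial_sums (m # ms). j \<le> x} = partial_sums (m # ms)" by (auto simp: partial_sums_Cons)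
  thus ?thesis using card_partial_sums[OF pos] True by (simp add: block_level_def)
next
  case False
  hence "{x \<in> partial_sums (m # ms). j \<le> x} = (+) m ` {x \<in> partial_sums ms. j - m \<le> x}"
    by (auto simp: partial_sums_Cons)
  thus ?thesis using False by (simp add: block_level_def card_image)
qed

lemma card_block_level:
  assumes "\<forall>k \<in> set ms. 0 < k" "sum_list ms \<le> N"
  shows "card {j \<in> {1..N}. block_level ms j = l} =
    (if l = 0 then N - sum_list ms else if l \<le> length ms then rev ms ! (l - 1) else 0)"
  using assms
proof (induction ms arbitrary: N)
  case Nil
  have "{j \<in> {1..N}. block_level [] j = l} = (if l = 0 then {1..N} else {})"
    by (auto simp: block_level_def)
  thus ?case by simp
next
  case (Cons m ms)
  let ?A = "{j \<in> {1..m}. Suc (length ms) = l}" and ?B = "{j \<in> {1..N - m}. block_level ms j = l}"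
  have "{j \<in> {1..N}. block_level (m # ms) j = l} = ?A \<union> (+) m ` ?B"
  proof (rule Set.set_eqI)
    fix j
    show "j \<in> {j \<in> {1..N}. block_level (m # ms) j = l} \<longleftrightarrow> j \<in> ?A \<union> (+) m ` ?B"
    proof (cases "j \<le> m")
      case True
      then show ?thesis using Cons.prems by (auto simp: block_level_Cons[OF Cons.prems(1)])
    next
      case False
      have "j \<in> (+) m ` ?B \<longleftrightarrow> j - m \<in> ?B"
      proof (rule iffI[rotated])
        assume "j - m \<in> ?B"
        moreover have "j = m + (j - m)" using False by simp
        ultimately show "j \<in> (+) m ` ?B" by (rule rev_image_eqI)
      next
        assume "j \<in> (+) m ` ?B"
        then obtain x where "x \<in> ?B" "j = m + x" by (rule imageE)
        thus "j - m \<in> ?B" by (simp only: add_diff_cancel_left')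
      qed
      moreover have "j - m \<in> {1..N - m} \<longleftrightarrow> j \<in> {1..N}" using False Cons.prems by auto
      moreover have "j \<notin> {1..m}" using False by simp
      ultimately show ?thesis using False
        by (simp add: block_level_Cons[OF Cons.prems(1)] del: atLeastAtMost_iff)
    qed
  qed
  hence "card {j \<in> {1..N}. block_level (m # ms) j = l} = card ?A + card ?B"
    by (simp only:) (subst card_Un_disjoint, auto simp: card_image)
  also have "card ?B = (if l = 0 then N - m - sum_list ms else if l \<le> length ms then rev ms ! (l - 1) else 0)"
    using Cons.prems by (intro Cons.IH) auto
  also have "?A = (if l = Suc (length ms) then {1..m} else {})" by auto
  finally show ?case by (auto simp: nth_append)
qed

lemma block_level_zero_iff: "block_level ms j = 0 \<longleftrightarrow> ms = [] \<or> sum_list ms < j"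
proof -
  have "block_level ms j = 0 \<longleftrightarrow> (\<forall>x \<in> partial_sums ms. x < j)"
    by (auto simp: block_level_def not_le)
  also have "\<dots> \<longleftrightarrow> ms = [] \<or> sum_list ms < j"
    using partial_sums_le sum_list_in_partial_sums by (cases "ms = []") (auto intro: le_less_trans)
  finally show ?thesis .
qed

lemma block_level_le: "\<forall>m \<in> set ms. 0 < m \<Longrightarrow> block_level ms j \<le> length ms"
  unfolding block_level_def card_partial_sums[symmetric] by (rule card_mono) auto

lemma parabolic_type_partial_sums:
  assumes "parabolic_type n I ns"
  shows "{1..n} - I = partial_sums (butlast ns)" "I \<subseteq> {1..n}" "\<forall>m \<in> set (butlast ns). 0 < m"
    "n = sum_list (butlast ns) + last ns"
proof -
  have ns: "ns \<noteq> []" "sum_list ns = n" and eq: "{1..n} - I = (\<lambda>t. sum_list (take t ns)) ` {1..<length ns}"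
    and "I \<subseteq> {1..n}" "\<forall>m \<in> set (butlast ns). 0 < m"
    using assms by (auto simp: parabolic_type_def)
  thus "I \<subseteq> {1..n}" "\<forall>m \<in> set (butlast ns). 0 < m" by auto
  have "ns = butlast ns @ [last ns]" using ns by simp
  thus "n = sum_list (butlast ns) + last ns" using ns by (metis sum_list_append sum_list.Cons sum_list.Nil add_0_right)
  have "{1..<length ns} = {1..length (butlast ns)}" using ns by (cases ns) auto
  thus "{1..n} - I = partial_sums (butlast ns)"
    unfolding eq partial_sums_def by (intro image_cong) (auto simp: take_butlast)
qed

text \<open>Needed because levels of dual indices can compare differently: if n - 1 and n are both
  outside \<open>I\<close>, then e_n and -e_n have grade 0, while their block levels are 1 and
  -1.\<close>

lemma strict_so_cong:
  assumes "\<And>a b. a < 2 * n \<Longrightarrow> b < 2 * n \<Longrightarrow> b \<noteq> dual_index n a \<Longrightarrow> L b < L a \<longleftrightarrow> L' b < L' a"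
  shows "strict_so n L = strict_so n L'"
proof -
  have "b \<noteq> dual_index n a" if "X \<in> so n" "a < 2 * n" "X $$ (a,b) \<noteq> 0" for X a b
    using so_entry_dual[OF that(1,2)] that(3) by auto
  thus ?thesis using assms unfolding strict_so_def by blast
qed

section \<open>Block levels compared with the grading\<close>

definition level :: "nat \<Rightarrow> (nat \<Rightarrow> int) \<Rightarrow> nat \<Rightarrow> int" where
  "level n D a = (if a < n then D (a + 1) else - D (a + 1 - n))"

lemma level_dual: "a < 2 * n \<Longrightarrow> level n D (dual_index n a) = - level n D a"
  by (auto simp: level_def dual_index_def Suc_diff_le)

lemma card_level:
  "card {a. a < n \<and> level n D a = l} = card {j \<in> {1..n}. D j = l}"
  "card {a. a < 2 * n \<and> level n D a = l} = card {j \<in> {1..n}. D j = l} + card {j \<in> {1..n}. D j = - l}"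
proof -
  show 1: "card {a. a < n \<and> level n D a = l} = card {j \<in> {1..n}. D j = l}"
  proof (rule bij_betw_same_card)
    show "bij_betw Suc {a. a < n \<and> level n D a = l} {j \<in> {1..n}. D j = l}"
      by (rule bij_betwI[of _ _ _ "\<lambda>j. j - 1"]) (auto simp: level_def)
  qed
  have "card {a. n \<le> a \<and> a < 2 * n \<and> level n D a = l} = card {j \<in> {1..n}. D j = - l}"
  proof (rule bij_betw_same_card)
    show "bij_betw (\<lambda>a. a + 1 - n) {a. n \<le> a \<and> a < 2 * n \<and> level n D a = l} {j \<in> {1..n}. D j = - l}"
      by (rule bij_betwI[of _ _ _ "\<lambda>j. j + n - 1"]) (auto simp: level_def)
  qed
  moreover have "{a. a < 2 * n \<and> level n D a = l} =
      {a. a < n \<and> level n D a = l} \<union> {a. n \<le> a \<and> a < 2 * n \<and> level n D a = l}" by auto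
  moreover have "card ({a. a < n \<and> level n D a = l} \<union> {a. n \<le> a \<and> a < 2 * n \<and> level n D a = l}) =
      card {a. a < n \<and> level n D a = l} + card {a. n \<le> a \<and> a < 2 * n \<and> level n D a = l}"
    by (rule card_Un_disjoint) auto
  ultimately show "card {a. a < 2 * n \<and> level n D a = l} = card {j \<in> {1..n}. D j = l} + card {j \<in> {1..n}. D j = - l}"
    using 1 by simp
qed

text \<open>The block level counts n itself if n is outside \<open>I\<close>, the cardinality in
  \<open>grade_coord\<close> does not; this reverses the sign of the correction at n.\<close>

lemma grade_coord_block_level:
  assumes "{1..n} - I = partial_sums ms" "I \<subseteq> {1..n}" "2 \<le> n" "j \<in> {1..n}"
  shows "grade_coord n I j = 2 * int (block_level ms j) - (if n \<in> I then 0 else 1) - (if n - 1 \<in> I then 0 else 1)"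
proof -
  have "{x \<in> partial_sums ms. j \<le> x} = (if n \<in> I then {} else {n}) \<union> ({j..<n} - I)"
    unfolding assms(1)[symmetric] using assms(3,4) by (auto simp: less_le)
  moreover have "card ((if n \<in> I then {} else {n}) \<union> ({j..<n} - I)) = (if n \<in> I then 0 else 1) + card ({j..<n} - I)"
    by (subst card_Un_disjoint) auto
  ultimately show ?thesis by (simp add: block_level_def grade_coord_def)
qed

theorem theorem6p7:
  fixes n :: nat and I :: "nat set" and ns :: "nat list" and \<O> :: "complex mat set"
  assumes "2 \<le> n"
    and "parabolic_type n I ns"
    and "richardson_orbit n I \<O>"
  shows "(last ns \<noteq> 1 \<longrightarrow>
            (let p = Z_diagram_shape (last ns) (butlast ns) in
               (\<exists>ms s. mset ms = mset ns \<and> s < length ms \<and> ms ! s = last ns \<and>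
                  sorted_wrt (\<ge>) (doubled_except ms s) \<and>
                  conjugate_lengths p = filter (\<lambda>c. c \<noteq> 0) (doubled_except ms s)) \<and>
               orbit_partition n \<O> (D_collapse n p)))
       \<and> (last ns = 1 \<longrightarrow>
            (let bs = butlast (butlast ns) @ [last (butlast ns) + 1];
                 p = Z_diagram_shape 0 bs in
               (\<exists>ms. mset ms = mset bs \<and> sorted_wrt (\<ge>) ms \<and>
                  conjugate_lengths p = concat (map (\<lambda>m. [m, m]) ms)) \<and>
               orbit_partition n \<O> (D_collapse n p)))"
proof -
  define ms where "ms = butlast ns"
  note par = parabolic_type_partial_sums[OF assms(2), folded ms_def]
  have n: "2 \<le> n" by (rule assms(1))
  have nil: "parabolic_nilradical n I = strict_so n (index_grade n I)" by (rule nilradical_eq[OF n par(2)])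
  have orbit: "nilpotent_orbit n \<O>"
    and dense: "subtopology (mat_topology (2 * n)) (parabolic_nilradical n I) closure_of (\<O> \<inter> parabolic_nilradical n I) =
      parabolic_nilradical n I"
    using assms(3) by (auto simp: richardson_orbit_def Let_def)
  have grade: "index_grade n I = level n (grade_coord n I)" by (simp add: index_grade_def level_def fun_eq_iff)
  note gc = grade_coord_block_level[OF par(1,2) n]
  have notin: "j \<notin> I \<longleftrightarrow> j \<in> partial_sums ms" if "j \<in> {1..n}" for j
    unfolding par(1)[symmetric] using that by simp
  define co where "co a = (if a < n then a + 1 else a + 1 - n)" for a
  have co: "co a \<in> {1..n}" if "a < 2 * n" for a using that by (auto simp: co_def)
  have co_neq: "co a \<noteq> co b" if "a < 2 * n" "b < 2 * n" "b \<noteq> dual_index n a" "a < n \<longleftrightarrow> \<not> b < n" for a b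
    using that by (auto simp: co_def dual_index_def)
  have level: "level n F a = (if a < n then F (co a) else - F (co a))" for F a
    by (simp add: level_def co_def)
  show ?thesis
  proof (intro conjI impI)
    assume last: "last ns \<noteq> 1"
    define D where "D j = int (block_level ms j)" for j
    \<comment> \<open>If n - 1 is a partial sum, at most one coordinate remains beyond the blocks;
      as n_k = 1 is excluded, none does, and n is the last partial sum.\<close>
    have eps: "n \<notin> I" if "n - 1 \<notin> I"
    proof -
      have "n - 1 \<in> partial_sums ms" using notin[of "n - 1"] that n by auto
      hence "n - 1 \<le> sum_list ms" "ms \<noteq> []" using partial_sums_le by auto
      hence "sum_list ms = n" using par(4) last by auto
      thus ?thesis using sum_list_in_partial_sums[OF \<open>ms \<noteq> []\<close>] notin[of n] n by simp
    qed
    have D1: "1 \<le> D j" if "n \<notin> I" "j \<in> {1..n}" for j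
    proof -
      have "n \<in> partial_sums ms" using notin[of n] that by auto
      hence "ms \<noteq> []" "\<not> sum_list ms < j" using partial_sums_le[of n ms] that by auto
      thus ?thesis using block_level_zero_iff[of ms j] by (auto simp: D_def)
    qed
    \<comment> \<open>Here the grade is 2 * D - 2. To compare e_i with -e_j in the same way as the
      block levels do, D i + D j > 2 is required; i and j differ because the indices are not
      dual.\<close>
    have D2: "3 \<le> D i + D j" if "n - 1 \<notin> I" "i \<in> {1..n}" "j \<in> {1..n}" "i \<noteq> j" for i j
    proof -
      have "2 \<le> D k" if "k \<in> {1..n}" "k \<noteq> n" for k
      proof -
        have "{n - 1, n} \<subseteq> {x \<in> partial_sums ms. k \<le> x}"
          using notin[of n] notin[of "n - 1"] \<open>n - 1 \<notin> I\<close> eps n that by auto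
        hence "card {n - 1, n} \<le> block_level ms k" unfolding block_level_def by (rule card_mono[rotated]) simp
        thus ?thesis using n by (simp add: D_def)
      qed
      from this[of i] this[of j] D1[OF eps[OF that(1)] that(2)] D1[OF eps[OF that(1)] that(3)]
      show ?thesis using that by (cases "i = n"; cases "j = n") auto
    qed
    have D0: "0 \<le> D j" for j by (simp add: D_def)
    have L: "strict_so n (index_grade n I) = strict_so n (level n D)"
      unfolding grade
    proof (rule strict_so_cong)
      fix a b assume ab: "a < 2 * n" "b < 2 * n" "b \<noteq> dual_index n a"
      show "level n (grade_coord n I) b < level n (grade_coord n I) a \<longleftrightarrow> level n D b < level n D a"
        unfolding level gc[OF co[OF ab(1)]] gc[OF co[OF ab(2)]] D_def[symmetric]
        using eps D0[of "co a"] D0[of "co b"] D1[OF _ co[OF ab(1)]] D1[OF _ co[OF ab(2)]]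
          D2[OF _ co[OF ab(1)] co[OF ab(2)]] co_neq[OF ab]
        by (cases "n \<in> I"; cases "n - 1 \<in> I"; cases "a < n"; cases "b < n") auto
    qed
    have D_eq: "{j \<in> {1..n}. D j = int l} = {j \<in> {1..n}. block_level ms j = l}" for l by (simp add: D_def)
    have "orbit_partition n \<O> (D_collapse n (Z_diagram_shape (last ns) ms))"
    proof (rule orbit_partition_strict_so)
      show "level n D (dual_index n a) = - level n D a" if "a < 2 * n" for a by (rule level_dual[OF that])
      show "\<bar>level n D a\<bar> \<le> int (length ms)" for a
        using block_level_le[OF par(3)] by (simp add: level_def D_def)
      have "map (\<lambda>j. card {a. a < 2 * n \<and> level n D a = int j}) [1..<Suc (length ms)] = rev ms"
      proof (rule nth_equalityI)
        fix i assume "i < length (map (\<lambda>j. card {a. a < 2 * n \<and> level n D a = int j}) [1..<Suc (length ms)])"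
        hence i: "i < length ms" by (simp del: upt_Suc)
        have "{j \<in> {1..n}. D j = - int (Suc i)} = {}" using D0 by (auto simp: D_def)
        hence "card {a. a < 2 * n \<and> level n D a = int (Suc i)} = rev ms ! i"
          unfolding card_level D_eq using i par(4) by (subst card_block_level[OF par(3)]) auto
        thus "map (\<lambda>j. card {a. a < 2 * n \<and> level n D a = int j}) [1..<Suc (length ms)] ! i = rev ms ! i"
          using i by (simp del: of_nat_Suc upt_Suc)
      qed (simp del: upt_Suc)
      thus "mset (map (\<lambda>j. card {a. a < 2 * n \<and> level n D a = int j}) [1..<Suc (length ms)]) = mset ms" by (simp only: mset_rev)
      show "card {a. a < n \<and> level n D a = 0} = last ns"
        using card_level(1)[of n D 0] D_eq[of 0] card_block_level[OF par(3), of n 0] par(4) by simp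
    qed (use orbit dense in \<open>simp_all only: nil L\<close>)
    moreover have "mset ns = mset (ms @ [last ns])"
      using assms(2) by (simp add: ms_def parabolic_type_def)
    ultimately show "let p = Z_diagram_shape (last ns) (butlast ns) in
               (\<exists>ms s. mset ms = mset ns \<and> s < length ms \<and> ms ! s = last ns \<and>
                  sorted_wrt (\<ge>) (doubled_except ms s) \<and>
                  conjugate_lengths p = filter (\<lambda>c. c \<noteq> 0) (doubled_except ms s)) \<and>
               orbit_partition n \<O> (D_collapse n p)"
      using Z_diagram_columns[of ms "last ns"] unfolding Let_def ms_def by simp
  next
    assume last: "last ns = 1"
    hence sum_ms: "sum_list ms = n - 1" using par(4) by simp
    hence ne: "ms \<noteq> []" using n by auto
    define bs where "bs = butlast ms @ [last ms + 1]"
    have rev_ms: "rev ms = last ms # rev (butlast ms)" and rev_bs: "rev bs = (last ms + 1) # rev (butlast ms)"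
      using append_butlast_last_id[OF ne] by (metis rev.simps(2) rev_append rev_rev_ident rev_singleton_conv append_Cons append_Nil rev_eq_Cons_iff, simp add: bs_def)
    have len: "length bs = length ms" using ne by (simp add: bs_def)
    have pos: "\<forall>b \<in> set bs. 0 < b" using par(3) by (auto simp: bs_def dest: in_set_butlastD)
    have nI: "n \<in> I" using notin[of n] partial_sums_le[of n ms] sum_ms n by fastforce
    have n1: "n - 1 \<notin> I" using notin[of "n - 1"] sum_list_in_partial_sums[OF ne] sum_ms n by simp
    \<comment> \<open>Since \<alpha>_n belongs to the Levi factor, -e_n must be on the level 1 of
      e_(n-1); so e_n is put on level -1 instead of its block level 0.\<close>
    define D where "D j = (if j = n then - 1 else int (block_level ms j))" for j
    have bn: "block_level ms n = 0" using block_level_zero_iff[of ms n] sum_ms n by simp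
    have D1: "1 \<le> D j" if "j \<in> {1..n}" "j \<noteq> n" for j
      using block_level_zero_iff[of ms j] that ne sum_ms by (auto simp: D_def)
    have gD: "grade_coord n I j = (if j = n then - 1 else 2 * D j - 1)" if "j \<in> {1..n}" for j
      using gc[OF that] bn nI n1 by (simp add: D_def)
    have Dn: "D n = - 1" by (simp add: D_def)
    have L: "strict_so n (index_grade n I) = strict_so n (level n D)"
      unfolding grade
    proof (rule strict_so_cong)
      fix a b assume ab: "a < 2 * n" "b < 2 * n" "b \<noteq> dual_index n a"
      show "level n (grade_coord n I) b < level n (grade_coord n I) a \<longleftrightarrow> level n D b < level n D a"
        unfolding level gD[OF co[OF ab(1)]] gD[OF co[OF ab(2)]]
        using D1[OF co[OF ab(1)]] D1[OF co[OF ab(2)]] Dn co_neq[OF ab]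
        by (cases "co a = n"; cases "co b = n"; cases "a < n"; cases "b < n") auto
    qed
    have D_eq: "{j \<in> {1..n}. D j = int (Suc l)} = {j \<in> {1..n}. block_level ms j = Suc l}" for l
      using bn by (auto simp: D_def)
    have "orbit_partition n \<O> (D_collapse n (Z_diagram_shape 0 bs))"
    proof (rule orbit_partition_strict_so)
      show "level n D (dual_index n a) = - level n D a" if "a < 2 * n" for a by (rule level_dual[OF that])
      have "1 \<le> length ms" using ne by (cases ms) auto
      thus "\<bar>level n D a\<bar> \<le> int (length ms)" for a
        using block_level_le[OF par(3)] by (simp add: level_def D_def)
      have "map (\<lambda>j. card {a. a < 2 * n \<and> level n D a = int j}) [1..<Suc (length ms)] = rev bs"
      proof (rule nth_equalityI)
        fix i assume "i < length (map (\<lambda>j. card {a. a < 2 * n \<and> level n D a = int j}) [1..<Suc (length ms)])"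
        hence i: "i < length ms" by (simp del: upt_Suc)
        \<comment> \<open>The coordinate n accounts, through its dual basis vector, for the
          additional element of level 1.\<close>
        have "{j \<in> {1..n}. D j = - int (Suc i)} = (if i = 0 then {n} else {})"
          using n by (auto simp: D_def)
        hence "card {a. a < 2 * n \<and> level n D a = int (Suc i)} = rev ms ! i + (if i = 0 then 1 else 0)"
          unfolding card_level D_eq using i par(4) by (subst card_block_level[OF par(3)]) auto
        also have "\<dots> = rev bs ! i" unfolding rev_ms rev_bs by (cases i) auto
        finally show "map (\<lambda>j. card {a. a < 2 * n \<and> level n D a = int j}) [1..<Suc (length ms)] ! i = rev bs ! i"
          using i by (simp del: of_nat_Suc upt_Suc)
      qed (simp add: len del: upt_Suc)
      thus "mset (map (\<lambda>j. card {a. a < 2 * n \<and> level n D a = int j}) [1..<Suc (length ms)]) = mset bs" by (simp only: mset_rev)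
      have "{j \<in> {1..n}. D j = 0} = {}" using D1 Dn by force
      thus "card {a. a < n \<and> level n D a = 0} = 0" unfolding card_level by (simp only: card.empty)
    qed (use orbit dense in \<open>simp_all only: nil L\<close>)
    thus "let bs = butlast (butlast ns) @ [last (butlast ns) + 1];
                 p = Z_diagram_shape 0 bs in
               (\<exists>ms. mset ms = mset bs \<and> sorted_wrt (\<ge>) ms \<and>
                  conjugate_lengths p = concat (map (\<lambda>m. [m, m]) ms)) \<and>
               orbit_partition n \<O> (D_collapse n p)"
      using Z_diagram_columns_zero[OF pos] unfolding Let_def bs_def ms_def by blast
  qed
qed

end
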